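(* Let $g$ be a regular kernel on the finite alphabet $S$. The following statements are equivalent: (i) $g$ exhibits dynamic uniqueness, i.e. for all $A\in\mathcal T^+$ and all $\underline x,\underline y\in\mathcal X^-$, $P^{\underline x}[A]=P^{\underline y}[A]$. (ii) For all $\underline x,\underline y\in\mathcal X^-$, $\lim_{n\to\infty}\sup_{B\in\mathcal F_{[n,\infty)}}|P^{\underline x}[B]-P^{\underline y}[B]|=0$. (iii) For all $\underline x,\underline y\in\mathcal X^-$ there exists a coupling $\tilde P$ between $P^{\underline x}$ and $P^{\underline y}$ whose coupling time $\Theta$ satisfies $\tilde P[\Theta<\infty]=1$. (iv) For all $\lambda,\lambda'\in\mathcal M$, $P^{\lambda}|_{\mathcal T^+}=P^{\lambda'}|_{\mathcal T^+}$. (v) For all $\lambda\in\mathcal M$, $P^\lambda$ is trivial on $\mathcal T^+$ (i.e. $P^\lambda[A]\in\{0,1\}$ for every $A\in\mathcal T^+$). (vi) For all $\lambda\in\mathcal M$, $P^\lambda$ is mixing, i.e. for all $B\in\mathcal F$, $\lim_{n\to\infty}\sup_{A\in\mathcal F_{[n,\infty)}}|P^\lambda[A\cap B]-P^\lambda[A]P^\lambda[B]|=0$. (vii) For all $\underline x,\underline y\in\mathcal X^-$, $P^{\underline x}|_{\mathcal F^+}\ll P^{\underline y}|_{\mathcal F^+}$. (viii) $g$ satisfies the weak-$\ell^2$ criterion: for every pair $\underline x,\underline y\in\mathcal X^-$, $$\sum_{n=0}^\infty\sum_{a\in S}\big(g(a\omega_0^n\underline x)-g(a\omega_0^n\underline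 y)\big)^2<\infty\quad\text{for }P^{\underline x}\text{-a.e. }\omega.$$
   Context: $S$ is a finite set, $\mathcal X=S^{\mathbb Z}$, $\mathcal X^-=S^{\{-1,-2,\dots\}}$. Sequences are written with the past to the right: $x_j^i=(x_i,\dots,x_j)$ for $j\le i$, $x_{-\infty}^i=(x_i,x_{i-1},\dots)$, and $\underline x=x_{-\infty}^{-1}=(x_{-1},x_{-2},\dots)$. Concatenations are read in the same order, so $a\omega_0^n\underline x$ is the sequence $(a,\omega_n,\dots,\omega_0,x_{-1},x_{-2},\dots)$, sequences indexed by a left half-line of $\mathbb Z$ being identified by shifting indices. For $I\subset\mathbb R$, $\mathcal F_I$ is the $\sigma$-algebra on $\mathcal X$ generated by the coordinates with index in $I\cap\mathbb Z$; $\mathcal F=\mathcal F_{\mathbb R}$, $\mathcal F^-=\mathcal F_{(-\infty,-1]}$ (also regarded as the product $\sigma$-algebra on $\mathcal X^-$), $\mathcal F^+=\mathcal F_{[0,\infty)}$, and $\mathcal T^+=\bigcap_{n\ge1}\mathcal F_{[n,\infty)}$ is the future tail $\sigma$-algebra. $\mu|_{\mathcal H}$ denotes the restriction of $\mu$ to $\mathcal H$. A (probability) kernel $g$ on $S$ is a measurable function assigning to each $a\in S$, $\underline x\in\mathcal X^-$ a number $g(a\underline x)\in[0,1]$ with $\sum_{a\in S}g(a\underline x)=1$ for all $\underline x$. It is strongly non-null if $\inf_{a\in S,\underline x\in\mathcal X^-}g(a\underline x)>0$. Its variation rate is $\mathrm{var}_k(g)=\sup_{a\in S}\sup_{\omega_{-k}^{-1}\in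 S^k}\sup_{\underline x,\underline y\in\mathcal X^-}|g(a\omega_{-k}^{-1}\underline x)-g(a\omega_{-k}^{-1}\underline y)|$; $g$ is continuous if $\mathrm{var}_k(g)\to0$. $g$ is regular if it is strongly non-null and continuous. $\mathcal M$ is the set of probability measures on $(\mathcal X^-,\mathcal F^-)$. For $\lambda\in\mathcal M$, $P^\lambda$ is the unique probability measure on $(\mathcal X,\mathcal F)$, with canonical process $(X_j)_{j\in\mathbb Z}$, such that $P^\lambda[B]=\lambda[B]$ for $B\in\mathcal F^-$ and, for $j\ge0$, $P^\lambda[X_j=a\mid X_{-\infty}^{j-1}=y_{-\infty}^{j-1}]=g(ay_{-\infty}^{j-1})$. If $\lambda$ is the point mass at $\underline x\in\mathcal X^-$, write $P^{\underline x}$ for $P^\lambda$. For a coupling of two measures $\mu,\mu'$ on $(\mathcal X,\mathcal F)$, with associated process $(X_j,X_j')_{j\in\mathbb Z}$ where $(X_j)$ has law $\mu$ and $(X'_j)$ has law $\mu'$, the coupling time is $\Theta=\inf\{t\ge0:X_j=X_j'\text{ for all }j\ge t\}$ (with $\inf\emptyset=\infty$). *)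

theory Defs
  imports "HOL-Probability.Probability"
begin

text \<open>
  The alphabet \<open>S\<close> is a type \<open>'a\<close> of class \<open>finite\<close>.  A one-sided sequence
  (an element of \<open>S^{-1,-2,...}\<close>, or of any left half-line, up to shifting indices) is a function
  \<open>x :: nat \<Rightarrow> 'a\<close> read from the most recent symbol backwards: \<open>x k\<close> is the
  coordinate with index \<open>-1 - k\<close>.  A two-sided sequence is a function of type \<open>int \<Rightarrow> 'a\<close>.
\<close>

definition past_space :: "(nat \<Rightarrow> 'a) measure" where
  "past_space = PiM UNIV (\<lambda>_. count_space UNIV)"

text \<open>For a list \<open>w\<close>, \<open>conc w x\<close> is the concatenation \<open>w x\<close>; the head of \<open>w\<close> is the most recent symbol.\<close>

definition conc :: "'a list \<Rightarrow> (nat \<Rightarrow> 'a) \<Rightarrow> nat \<Rightarrow> 'a" where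
  "conc w x = (\<lambda>k. if k < length w then w ! k else x (k - length w))"

text \<open>\<open>hist j \<omega>\<close> is the left-infinite sequence \<open>(\<omega>_{j-1}, \<omega>_{j-2}, ...)\<close>.\<close>

definition hist :: "int \<Rightarrow> (int \<Rightarrow> 'a) \<Rightarrow> nat \<Rightarrow> 'a" where
  "hist j \<omega> = (\<lambda>k. \<omega> (j - 1 - int k))"

text \<open>\<open>block n \<omega>\<close> is the word \<open>(\<omega>_n, ..., \<omega>_0)\<close>.\<close>

definition block :: "nat \<Rightarrow> (int \<Rightarrow> 'a) \<Rightarrow> 'a list" where
  "block n \<omega> = map (\<lambda>i. \<omega> (int i)) (rev [0..<Suc n])"

text \<open>Sub-\<open>\<sigma>\<close>-algebras are represented, as in \<open>HOL-Probability.Conditional_Expectation\<close>, by measures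
  of which only the space and the measurable sets matter.\<close>

definition coord_algebra :: "int set \<Rightarrow> (int \<Rightarrow> 'a) measure" where
  "coord_algebra I = sigma UNIV {{\<omega>. \<omega> i \<in> A} | i A. i \<in> I}"

definition tail_algebra :: "(int \<Rightarrow> 'a) measure" where
  "tail_algebra = sigma UNIV (\<Inter>n\<in>{1::nat..}. sets (coord_algebra {int n..}))"

lemma space_coord_algebra [simp]: "space (coord_algebra I) = UNIV"
  by (simp add: coord_algebra_def space_measure_of_conv)

lemma space_tail_algebra [simp]: "space tail_algebra = UNIV"
  by (simp add: tail_algebra_def space_measure_of_conv)

lemma sets_coord_algebra:
  "sets (coord_algebra I) = sigma_sets UNIV {{\<omega>. \<omega> i \<in> A} | i A. i \<in> I}"
  by (simp add: coord_algebra_def)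

lemma sets_tail_algebra:
  "sets tail_algebra = (\<Inter>n\<in>{1::nat..}. sets (coord_algebra {int n..} :: (int \<Rightarrow> 'a) measure))"
proof -
  let ?T = "\<Inter>n\<in>{1::nat..}. sets (coord_algebra {int n..} :: (int \<Rightarrow> 'a) measure)"
  have "sigma_sets UNIV ?T \<subseteq> ?T"
  proof (intro subsetI INT_I)
    fix A :: "(int \<Rightarrow> 'a) set" and n :: nat
    assume "A \<in> sigma_sets UNIV ?T" and n: "n \<in> {1..}"
    then show "A \<in> sets (coord_algebra {int n..})"
    proof (induction rule: sigma_sets.induct)
      case (Compl A)
      then show ?case using sets.compl_sets[of A "coord_algebra {int n..}"] by simp
    next
      case (Union A)
      then show ?case by (intro sets.countable_UN) auto
    qed auto
  qed
  moreover have "?T \<subseteq> sigma_sets UNIV ?T"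
    by auto
  ultimately show ?thesis
    by (simp add: tail_algebra_def)
qed

lemma sets_coord_algebra_UNIV:
  "sets (coord_algebra UNIV :: (int \<Rightarrow> 'a) measure) = sets (PiM UNIV (\<lambda>_. count_space UNIV))"
  by (simp add: sets_coord_algebra sets_PiM_single)

lemma measurable_coord: "i \<in> I \<Longrightarrow> (\<lambda>\<omega>. \<omega> i) \<in> measurable (coord_algebra I) (count_space UNIV)"
  by (auto simp: measurable_def sets_coord_algebra vimage_def intro!: sigma_sets.Basic)

lemma measurable_hist: "hist j \<in> measurable (coord_algebra {..j - 1}) past_space"
  unfolding hist_def past_space_def
  by (rule measurable_PiM_single') (auto intro!: measurable_coord)

lemma sets_coord_algebra_mono: "I \<subseteq> J \<Longrightarrow> sets (coord_algebra I) \<subseteq> sets (coord_algebra J)"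
  unfolding sets_coord_algebra by (rule sigma_sets_mono') auto

lemma subalgebra_coord_algebra:
  "sets P = sets (coord_algebra UNIV) \<Longrightarrow> subalgebra P (coord_algebra I)"
  using sets_coord_algebra_mono[of I UNIV] sets_eq_imp_space_eq[of P "coord_algebra UNIV"]
  by (simp add: subalgebra_def)

lemma subalgebra_tail_algebra:
  assumes "sets P = sets (coord_algebra UNIV)"
  shows "subalgebra P tail_algebra"
proof -
  have "sets tail_algebra \<subseteq> sets (coord_algebra {int 1..})"
    unfolding sets_tail_algebra by (rule INT_lower) simp
  then show ?thesis
    using subalgebra_coord_algebra[OF assms, of "{int 1..}"] by (auto simp: subalgebra_def)
qed

definition prob_kernel :: "((nat \<Rightarrow> 'a::finite) \<Rightarrow> real) \<Rightarrow> bool" where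
  "prob_kernel g \<longleftrightarrow>
     g \<in> borel_measurable past_space \<and>
     (\<forall>a x. 0 \<le> g (conc [a] x) \<and> g (conc [a] x) \<le> 1) \<and>
     (\<forall>x. (\<Sum>a\<in>UNIV. g (conc [a] x)) = 1)"

definition strongly_non_null :: "((nat \<Rightarrow> 'a) \<Rightarrow> real) \<Rightarrow> bool" where
  "strongly_non_null g \<longleftrightarrow> (INF (a, x)\<in>UNIV. g (conc [a] x)) > 0"

definition var_rate :: "((nat \<Rightarrow> 'a) \<Rightarrow> real) \<Rightarrow> nat \<Rightarrow> real" where
  "var_rate g k =
     Sup {\<bar>g (conc (a # w) x) - g (conc (a # w) y)\<bar> | a w x y. length w = k}"

definition continuous_kernel :: "((nat \<Rightarrow> 'a) \<Rightarrow> real) \<Rightarrow> bool" where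
  "continuous_kernel g \<longleftrightarrow> var_rate g \<longlonglongrightarrow> 0"

definition regular_kernel :: "((nat \<Rightarrow> 'a::finite) \<Rightarrow> real) \<Rightarrow> bool" where
  "regular_kernel g \<longleftrightarrow> prob_kernel g \<and> strongly_non_null g \<and> continuous_kernel g"

definition is_law ::
  "((nat \<Rightarrow> 'a) \<Rightarrow> real) \<Rightarrow> (nat \<Rightarrow> 'a) measure \<Rightarrow> (int \<Rightarrow> 'a) measure \<Rightarrow> bool" where
  "is_law g \<nu> P \<longleftrightarrow>
     prob_space P \<and> sets P = sets (coord_algebra UNIV) \<and>
     (\<forall>B\<in>sets past_space. measure P {\<omega>. hist 0 \<omega> \<in> B} = measure \<nu> B) \<and>
     (\<forall>j\<ge>0. \<forall>a. AE \<omega> in P.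
        real_cond_exp P (coord_algebra {..j - 1}) (indicator {\<omega>. \<omega> j = a}) \<omega> = g (conc [a] (hist j \<omega>)))"

text \<open>For a kernel \<open>g\<close> and a probability measure \<open>\<nu>\<close> on \<open>past_space\<close>, existence and uniqueness of
  the law is the Ionescu-Tulcea theorem.\<close>

definition law ::
  "((nat \<Rightarrow> 'a) \<Rightarrow> real) \<Rightarrow> (nat \<Rightarrow> 'a) measure \<Rightarrow> (int \<Rightarrow> 'a) measure" where
  "law g \<nu> = (THE P. is_law g \<nu> P)"

definition law_at ::
  "((nat \<Rightarrow> 'a) \<Rightarrow> real) \<Rightarrow> (nat \<Rightarrow> 'a) \<Rightarrow> (int \<Rightarrow> 'a) measure" where
  "law_at g x = law g (return past_space x)"

definition is_coupling ::
  "(int \<Rightarrow> 'a) measure \<Rightarrow> (int \<Rightarrow> 'a) measure \<Rightarrow> ((int \<Rightarrow> 'a) \<times> (int \<Rightarrow> 'a)) measure \<Rightarrow> bool" where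
  "is_coupling P P' Q \<longleftrightarrow>
     prob_space Q \<and> sets Q = sets (coord_algebra UNIV \<Otimes>\<^sub>M coord_algebra UNIV) \<and>
     distr Q (coord_algebra UNIV) fst = P \<and> distr Q (coord_algebra UNIV) snd = P'"

definition coupling_time :: "(int \<Rightarrow> 'a) \<times> (int \<Rightarrow> 'a) \<Rightarrow> enat" where
  "coupling_time = (\<lambda>(\<omega>, \<omega>'). Inf (enat ` {t. \<forall>j\<ge>int t. \<omega> j = \<omega>' j}))"

definition dynamic_uniqueness :: "((nat \<Rightarrow> 'a) \<Rightarrow> real) \<Rightarrow> bool" where
  "dynamic_uniqueness g \<longleftrightarrow>
     (\<forall>A\<in>sets tail_algebra. \<forall>x y. measure (law_at g x) A = measure (law_at g y) A)"

definition tail_trivial :: "(int \<Rightarrow> 'a) measure \<Rightarrow> bool" where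
  "tail_trivial P \<longleftrightarrow> (\<forall>A\<in>sets tail_algebra. measure P A \<in> {0, 1})"

definition mixing :: "(int \<Rightarrow> 'a) measure \<Rightarrow> bool" where
  "mixing P \<longleftrightarrow> (\<forall>B\<in>sets (coord_algebra UNIV).
     (\<lambda>n. SUP A\<in>sets (coord_algebra {int n..}). \<bar>measure P (A \<inter> B) - measure P A * measure P B\<bar>)
       \<longlonglongrightarrow> 0)"

definition weak_l2 :: "((nat \<Rightarrow> 'a::finite) \<Rightarrow> real) \<Rightarrow> bool" where
  "weak_l2 g \<longleftrightarrow> (\<forall>x y. AE \<omega> in law_at g x.
     summable (\<lambda>n. \<Sum>a\<in>UNIV. (g (conc (a # block n \<omega>) x) - g (conc (a # block n \<omega>) y))\<^sup>2))"

end

theory Submission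
  imports Defs
begin

text \<open>
  All conditions are equivalent to a uniform overlap of the futures: for some \<open>\<kappa> > 0\<close> the laws of the
  future from any two pasts have total variation distance at most \<open>1 - \<kappa>\<close>. Overlap makes the future tail
  trivial and the futures mutually absolutely continuous, since an event violating either could be
  conditioned on a long word so that two futures become almost singular.

  Conversely, if two futures are not mutually singular, then after a suitable common word they are
  close in total variation. Baire's theorem, applied to the closed sets of pasts where this happens
  for a given word, shows that all pasts beginning with one fixed word have nearly the same future,
  and strong non-nullness upgrades this to overlap. It remains to find a countable set of pasts such
  that every past in some cylinder is non-singular to one of them. Under absolute continuity any
  single past will do. Under dynamic uniqueness a second use of Baire's theorem gives a cylinder and
  an \<open>n\<close> such that the futures of its pasts are close on the coordinates from \<open>n\<close> on, and then
  a pigeonhole argument bounds the number of pairwise singular pasts in it; a maximal such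
  family is the required set.

  Absolute continuity is compared with the weak square-summability criterion through exponential
  supermartingales built from the likelihood ratio (second moment in one direction, Hellinger
  affinity in the other).
\<close>

section \<open>Words and streams\<close>

text \<open>The pairwise hypotheses provide a word or an \<open>n\<close> that depends on the pair
  of pasts, whereas overlap is uniform. Baire's theorem bridges this gap because closeness in total
  variation is a closed condition on the past: every cylinder probability is continuous in the past,
  so the distance is a supremum of continuous functions. Overlap serves as the hub because it
  mentions neither \<open>n\<close> nor a word: conditioning on a word \<open>u\<close> replaces a
  past \<open>x\<close> by \<open>after u x\<close>, and the bound applies to the new pair at once.
  The pigeonhole count is needed because closeness from \<open>n\<close> on does not control how the
  first \<open>n\<close> letters depend on the rest, so a priori the full futures may still be
  singular. All of this takes place on one-sided streams: with a fixed past the two-sided law is the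
  image of \<open>future x\<close> under gluing. Since \<open>law\<close> is a definite description,
  existence and uniqueness have to be proved before any property of it. A coupling made at one time
  \<open>n\<close> may leave positive mass uncoupled; therefore common mass is removed stage by
  stage.\<close>

definition pre :: "nat \<Rightarrow> (nat \<Rightarrow> 'a) \<Rightarrow> 'a list" where
  "pre n \<omega> = map \<omega> [0..<n]"

definition shift :: "nat \<Rightarrow> (nat \<Rightarrow> 'a) \<Rightarrow> nat \<Rightarrow> 'a" where
  "shift n \<omega> = (\<lambda>k. \<omega> (n + k))"

definition words :: "nat \<Rightarrow> 'a list set" where
  "words n = {u. length u = n}"

definition cylinder :: "'a list \<Rightarrow> (nat \<Rightarrow> 'a) set" where
  "cylinder u = {\<omega>. pre (length u) \<omega> = u}"

text \<open>Words are read in chronological order here, whereas the first argument of \<^const>\<open>conc\<close> starts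
  with the most recent symbol; \<open>after u x\<close> is the past at the end of \<open>u\<close>.\<close>

definition after :: "'a list \<Rightarrow> (nat \<Rightarrow> 'a) \<Rightarrow> nat \<Rightarrow> 'a" where
  "after u x = conc (rev u) x"

lemma length_pre [simp]: "length (pre n \<omega>) = n"
  by (simp add: pre_def)

lemma nth_pre: "i < n \<Longrightarrow> pre n \<omega> ! i = \<omega> i"
  by (simp add: pre_def)

lemma pre_0 [simp]: "pre 0 \<omega> = []"
  by (simp add: pre_def)

lemma pre_Suc: "pre (Suc n) \<omega> = pre n \<omega> @ [\<omega> n]"
  by (simp add: pre_def)

lemma pre_add: "pre (n + m) \<omega> = pre n \<omega> @ pre m (shift n \<omega>)"
  by (induction m) (simp_all add: pre_Suc shift_def)

lemma take_pre: "m \<le> n \<Longrightarrow> take m (pre n \<omega>) = pre m \<omega>"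
  by (simp add: pre_def take_map take_upt)

lemma shift_0 [simp]: "shift 0 \<omega> = \<omega>"
  by (simp add: shift_def)

lemma shift_shift: "shift m (shift n \<omega>) = shift (n + m) \<omega>"
  by (simp add: shift_def add.assoc)

lemma pre_conc: "pre (length u) (conc u \<omega>) = u"
  by (rule nth_equalityI) (simp_all add: nth_pre conc_def)

lemma shift_conc: "shift (length u) (conc u \<omega>) = \<omega>"
  by (simp add: shift_def conc_def fun_eq_iff)

lemma conc_pre_shift: "conc (pre n \<omega>) (shift n \<omega>) = \<omega>"
  by (simp add: conc_def shift_def nth_pre fun_eq_iff)

lemma conc_Nil [simp]: "conc [] x = x"
  by (simp add: conc_def)

lemma conc_append: "conc (u @ v) x = conc u (conc v x)"
  by (auto simp: conc_def fun_eq_iff nth_append)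

lemma after_Nil [simp]: "after [] x = x"
  by (simp add: after_def)

lemma after_Cons: "after (a # u) x = after u (conc [a] x)"
  by (simp add: after_def conc_append)

lemma after_append: "after (u @ v) x = after v (after u x)"
  by (simp add: after_def conc_append)

lemma after_rev: "after (rev u) x = conc u x"
  by (simp add: after_def)

lemma finite_words [simp]: "finite (words n :: 'a::finite list set)"
  using finite_lists_length_eq[of "UNIV :: 'a set" n] by (simp add: words_def)

lemma words_0 [simp]: "words 0 = {[]}"
  by (auto simp: words_def)

lemma pre_in_words [simp]: "pre n \<omega> \<in> words n"
  by (simp add: words_def)

lemma space_past [simp]: "space past_space = UNIV"
  by (simp add: past_space_def space_PiM)

lemma measurable_component_past [measurable]: "(\<lambda>\<omega>. \<omega> i) \<in> measurable past_space (count_space UNIV)"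
  unfolding past_space_def by (rule measurable_component_singleton) simp

lemma measurable_pastI:
  "(\<And>i. (\<lambda>z. f z i) \<in> measurable M (count_space UNIV)) \<Longrightarrow> f \<in> measurable M past_space"
  unfolding past_space_def by (rule measurable_PiM_single') auto

lemma measurable_shift [measurable]: "shift n \<in> measurable past_space past_space"
  by (rule measurable_pastI) (simp add: shift_def)

lemma measurable_conc [measurable]: "conc u \<in> measurable past_space past_space"
proof (rule measurable_pastI)
  show "(\<lambda>z. conc u z i) \<in> measurable past_space (count_space UNIV)" for i
    by (cases "i < length u") (simp_all add: conc_def)
qed

lemma measurable_after [measurable]: "after u \<in> measurable past_space past_space"
  unfolding after_def[abs_def] by simp

lemma measurable_pre [measurable]:
  "pre n \<in> measurable past_space (count_space (UNIV :: 'a::finite list set))"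
proof (induction n)
  case 0
  then show ?case by (simp add: pre_def[abs_def])
next
  case (Suc n)
  have "(\<lambda>\<omega>::nat \<Rightarrow> 'a. (\<lambda>(u, a). u @ [a]) (pre n \<omega>, \<omega> n)) \<in> measurable past_space (count_space UNIV)"
    by (rule measurable_compose[OF measurable_Pair[OF Suc measurable_component_past]])
       (simp add: pair_measure_countable)
  then show ?case
    by (simp add: pre_Suc[abs_def])
qed

lemma sets_pre [measurable]: "{\<omega>. pre n \<omega> \<in> W} \<in> sets past_space"
  for W :: "'a::finite list set"
  using measurable_sets[OF measurable_pre, of W n] by (simp add: vimage_def)

lemma sets_cylinder [measurable]: "cylinder u \<in> sets past_space" for u :: "'a::finite list"
  using sets_pre[of "length u" "{u}"] by (simp add: cylinder_def)

lemma sets_vimage_past: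
  "f \<in> measurable past_space past_space \<Longrightarrow> B \<in> sets past_space \<Longrightarrow> f -` B \<in> sets past_space"
  using measurable_sets[of f past_space past_space B] by simp

lemma cylinder_Nil [simp]: "cylinder [] = UNIV"
  by (simp add: cylinder_def)

lemma mem_cylinder: "\<omega> \<in> cylinder u \<longleftrightarrow> pre (length u) \<omega> = u"
  by (simp add: cylinder_def)

text \<open>Either one word is a prefix of the other, and the cylinder of the longer word is the
  intersection, or the words differ at a common position.\<close>

lemma cylinder_Int: "cylinder u \<inter> cylinder v = {} \<or> cylinder u \<inter> cylinder v \<in> range cylinder"
proof -
  have *: "cylinder u \<inter> cylinder v = {} \<or> cylinder u \<inter> cylinder v = cylinder v"
    if "length u \<le> length v" for u v :: "'a list"
  proof (cases "take (length u) v = u")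
    case True
    then have "cylinder v \<subseteq> cylinder u"
      using that by (auto simp: mem_cylinder) (metis take_pre)
    then show ?thesis by auto
  next
    case False
    then show ?thesis
      using that by (auto simp: mem_cylinder) (metis take_pre)
  qed
  show ?thesis
    using *[of u v] *[of v u] by (cases "length u \<le> length v") (auto simp: Int_commute)
qed

lemma pre_vimage_eq: "{\<omega>. pre n \<omega> \<in> W} = (\<Union>u\<in>W \<inter> words n. cylinder u)"
  by (auto simp: mem_cylinder words_def)

text \<open>Over a finite alphabet a coordinate event is a finite union of cylinders. The empty set
  joins the generator so that it is stable under intersection.\<close>

lemma sets_past_cylinder:
  "sets (past_space :: (nat \<Rightarrow> 'a::finite) measure) = sigma_sets UNIV (insert {} (range cylinder))"
proof (rule antisym)
  have "{\<omega>. \<omega> i \<in> A} \<in> sigma_sets UNIV (insert {} (range cylinder))" for i and A :: "'a set"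
  proof -
    have "{\<omega>. \<omega> i \<in> A} = {\<omega>. pre (Suc i) \<omega> \<in> {u. u ! i \<in> A}}"
      by (simp add: nth_pre)
    also have "\<dots> = (\<Union>u\<in>{u. u ! i \<in> A} \<inter> words (Suc i). cylinder u)"
      by (rule pre_vimage_eq)
    finally show ?thesis
      by (auto intro!: sigma_sets_UNION countable_finite)
  qed
  then have "{{\<omega> :: nat \<Rightarrow> 'a. \<omega> i \<in> A} | i A. True} \<subseteq> sigma_sets UNIV (insert {} (range cylinder))"
    by (intro subsetI, elim CollectE exE conjE) (simp only:)
  then have "sigma_sets UNIV {{\<omega> :: nat \<Rightarrow> 'a. \<omega> i \<in> A} | i A. True}
      \<subseteq> sigma_sets UNIV (insert {} (range cylinder))"
    by (rule sigma_sets_mono)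
  moreover have "sets past_space = sigma_sets UNIV {{\<omega> :: nat \<Rightarrow> 'a. \<omega> i \<in> A} | i A. True}"
    by (simp add: past_space_def sets_PiM_single)
  ultimately show "sets past_space \<subseteq> sigma_sets UNIV (insert {} (range (cylinder :: 'a list \<Rightarrow> _)))"
    by (simp only:)
  show "sigma_sets UNIV (insert {} (range cylinder)) \<subseteq> sets (past_space :: (nat \<Rightarrow> 'a) measure)"
    by (metis sets.sigma_sets_subset space_past insert_subset sets.empty_sets image_subsetI sets_cylinder)
qed

lemma Int_stable_cylinder: "Int_stable (insert {} (range cylinder))"
  using cylinder_Int by (auto simp: Int_stable_def)

text \<open>Uniqueness on a pi-system; the cylinder of the empty word is the whole space and serves
  as the exhausting sequence.\<close>

lemma measure_eqI_cylinder:
  assumes "sets M = sets past_space" "sets N = sets past_space" "finite_measure M"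
    and "\<And>u :: 'a::finite list. emeasure M (cylinder u) = emeasure N (cylinder u)"
  shows "M = N"
proof (rule measure_eqI_generator_eq[OF Int_stable_cylinder, where \<Omega>=UNIV and A="\<lambda>_. UNIV"])
  interpret finite_measure M by fact
  show "emeasure M UNIV \<noteq> \<infinity>" for i :: nat
    by simp
  show "range (\<lambda>_::nat. UNIV) \<subseteq> insert {} (range (cylinder :: 'a list \<Rightarrow> _))"
    using rangeI[of cylinder "[] :: 'a list"] by auto
qed (use assms sets_past_cylinder in auto)

lemma disjoint_cylinder: "u \<in> words n \<Longrightarrow> v \<in> words n \<Longrightarrow> u \<noteq> v \<Longrightarrow> cylinder u \<inter> cylinder v = {}"
  by (auto simp: mem_cylinder words_def)

lemma UN_cylinder: "(\<Union>u\<in>words n. cylinder u) = UNIV"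
  by (auto simp: mem_cylinder words_def)

lemma measure_split_words:
  fixes M :: "(nat \<Rightarrow> 'a::finite) measure"
  assumes "finite_measure M" "sets M = sets past_space" "A \<in> sets past_space"
  shows "measure M A = (\<Sum>u\<in>words n. measure M (cylinder u \<inter> A))"
proof -
  interpret finite_measure M by fact
  have "A = (\<Union>u\<in>words n. cylinder u \<inter> A)"
    using UN_cylinder[of n] by auto
  then have "measure M A = measure M (\<Union>u\<in>words n. cylinder u \<inter> A)"
    by simp
  also have "\<dots> = (\<Sum>u\<in>words n. measure M (cylinder u \<inter> A))"
  proof (intro finite_measure_finite_Union)
    show "disjoint_family_on (\<lambda>u. cylinder u \<inter> A) (words n)"
      unfolding disjoint_family_on_def
    proof (intro ballI impI)
      fix u v :: "'a list" assume "u \<in> words n" "v \<in> words n" "u \<noteq> v"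
      then have "cylinder u \<inter> cylinder v = {}" by (rule disjoint_cylinder)
      then show "cylinder u \<inter> A \<inter> (cylinder v \<inter> A) = {}" by auto
    qed
  qed (use assms in \<open>simp_all add: image_subset_iff\<close>)
  finally show ?thesis .
qed

section \<open>Measure-theoretic preliminaries\<close>

text \<open>If the signed measure \<open>M1 - M2\<close> does not vanish uniformly along the decreasing algebras, choose
  nearly maximal sets \<open>B k\<close>. Adding \<open>B j\<close> to the union of the later ones costs little because
  their intersection lies in \<open>G (N j)\<close> and hence is not much better than \<open>B j\<close>; so \<open>limsup B\<close>
  is a tail event on which \<open>M1 - M2\<close> is positive.\<close>

lemma decreasing_algebras_uniform:
  fixes G :: "nat \<Rightarrow> 'b set set"
  assumes "finite_measure M1" "finite_measure M2" and sets_eq: "sets M1 = sets M2"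
    and alg: "\<And>n. sigma_algebra (space M1) (G n)" and sub: "\<And>n. G n \<subseteq> sets M1"
    and dec: "\<And>m n. n \<le> m \<Longrightarrow> G m \<subseteq> G n"
    and tail: "\<And>A. (\<And>n. A \<in> G n) \<Longrightarrow> measure M1 A = measure M2 A"
  shows "(\<lambda>n. SUP A\<in>G n. \<bar>measure M1 A - measure M2 A\<bar>) \<longlonglongrightarrow> 0"
proof -
  interpret M1: finite_measure M1 by fact
  interpret M2: finite_measure M2 by fact
  have sp: "space M2 = space M1"
    using sets_eq_imp_space_eq[OF sets_eq] by simp
  have alg_Un: "A \<union> B \<in> G n" and alg_Int: "A \<inter> B \<in> G n" if "A \<in> G n" "B \<in> G n" for A B n
  proof -
    interpret sigma_algebra "space M1" "G n" by (rule alg)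
    show "A \<union> B \<in> G n" "A \<inter> B \<in> G n" using that by auto
  qed
  have alg_compl: "space M1 - A \<in> G n" if "A \<in> G n" for A n
  proof -
    interpret sigma_algebra "space M1" "G n" by (rule alg)
    show ?thesis using that by (rule compl_sets)
  qed
  have alg_UN: "(\<Union>k. A k) \<in> G n" if "\<And>k. A k \<in> G n" for A :: "nat \<Rightarrow> 'b set" and n
    using sigma_algebra.countable_nat_UN[OF alg] that by (metis image_subsetI)
  have alg_INT: "(\<Inter>k. A k) \<in> G n" if "\<And>k. A k \<in> G n" for A :: "nat \<Rightarrow> 'b set" and n
  proof -
    interpret sigma_algebra "space M1" "G n" by (rule alg)
    show ?thesis using that by (intro countable_INT) auto
  qed
  have ne: "space M1 \<in> G n" for n
  proof -
    interpret sigma_algebra "space M1" "G n" by (rule alg)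
    show ?thesis by (rule top)
  qed
  define D where "D A = measure M1 A - measure M2 A" for A
  have D_space: "D (space M1) = 0"
    using tail[of "space M1"] ne by (simp add: D_def)
  have D_compl: "D (space M1 - A) = - D A" if "A \<in> sets M1" for A
    using that D_space M1.finite_measure_compl M2.finite_measure_compl sets_eq sp by (simp add: D_def)
  have D_Un: "D (A \<union> B) = D A + D B - D (A \<inter> B)" if "A \<in> sets M1" "B \<in> sets M1" for A B
    using that M1.finite_measure_Union'[of A B] M2.finite_measure_Union'[of A B]
      M1.finite_measure_Diff'[of B A] M2.finite_measure_Diff'[of B A] sets_eq
    by (simp add: D_def Int_commute)
  have D_le: "D A \<le> measure M1 (space M1)" for A
    using M1.bounded_measure[of A] measure_nonneg[of M2 A] unfolding D_def by linarith
  \<comment> \<open>A one-sided bound suffices: the whole space is a tail set, so \<open>D\<close>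
    vanishes there and complements reverse its sign.\<close>
  have main: "\<exists>n. \<forall>A\<in>G n. D A \<le> e" if e: "0 < e" for e
  proof (rule ccontr)
    assume "\<not> (\<exists>n. \<forall>A\<in>G n. D A \<le> e)"
    then have big: "\<exists>A\<in>G n. e < D A" for n
      by (auto simp: not_le)
    define d where "d n = (SUP A\<in>G n. D A)" for n
    have bdd: "bdd_above (D ` G n)" for n
      using D_le by (auto intro!: bdd_aboveI)
    have le_d: "D A \<le> d n" if "A \<in> G n" for A n
      unfolding d_def using that bdd by (rule cSUP_upper)
    have d_gt: "e < d n" for n
      using big[of n] le_d by force
    have dec_d: "d m \<le> d n" if "n \<le> m" for n m
      unfolding d_def using dec[OF that] bdd ne[of m] by (intro cSUP_subset_mono) auto
    obtain L where L: "d \<longlonglongrightarrow> L" and L_le: "\<And>n. L \<le> d n"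
      using decseq_convergent[of d e] d_gt dec_d by (metis decseq_def less_imp_le)
    have eL: "e \<le> L"
      using L d_gt by (intro LIMSEQ_le_const) (auto intro: less_imp_le)
    \<comment> \<open>Joining \<open>B j\<close> to the later sets costs \<open>\<epsilon> j\<close>
      for \<open>B j\<close>, \<open>\<epsilon> j\<close> for the intersection, and
      \<open>4 * \<epsilon> (Suc j)\<close>, inherited from the later sets, which is
      \<open>2 * \<epsilon> j\<close> by halving. The total \<open>4 * \<epsilon> j\<close>
      reproduces itself, and the factor 8 in the denominator keeps it below
      \<open>e / 2\<close>.\<close>
    define \<epsilon> where "\<epsilon> k = e / 2 ^ (k + 3)" for k :: nat
    have \<epsilon>_pos: "0 < \<epsilon> k" for k
      using e by (simp add: \<epsilon>_def)
    have \<epsilon>_Suc: "\<epsilon> k = 2 * \<epsilon> (Suc k)" for k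
      by (simp add: \<epsilon>_def power_add)
    have "\<exists>m. d m \<le> L + \<epsilon> k" for k
    proof -
      have "\<forall>\<^sub>F m in sequentially. d m < L + \<epsilon> k"
        using L \<epsilon>_pos[of k] by (intro order_tendstoD(2)[OF L]) simp
      then show ?thesis
        by (metis eventually_sequentially less_imp_le order_refl)
    qed
    then obtain m where m: "\<And>k. d (m k) \<le> L + \<epsilon> k"
      by metis
    \<comment> \<open>The partial sums make \<open>N\<close> monotone and at least
      \<open>m k\<close>; the summand \<open>k\<close> drives \<open>N\<close> to infinity, so that
      the limit set lies in every \<open>G n\<close>.\<close>
    define N where "N k = k + (\<Sum>i\<le>k. m i)" for k
    have N_Suc: "N k \<le> N (Suc k)" for k
      by (simp add: N_def)
    have N_mono: "N k \<le> N l" if "k \<le> l" for k l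
      using lift_Suc_mono_le[of N, OF N_Suc that] .
    have dN: "d (N k) \<le> L + \<epsilon> k" for k
    proof -
      have "m k \<le> N k"
        using member_le_sum[of k "{..k}" m] by (simp add: N_def)
      then show ?thesis
        using dec_d m order_trans by blast
    qed
    have "\<exists>A\<in>G (N k). L - \<epsilon> k < D A" for k
      using less_cSUP_iff[of "G (N k)" D "L - \<epsilon> k"] bdd ne L_le[of "N k"] \<epsilon>_pos[of k]
      unfolding d_def by (metis diff_less_eq empty_iff less_add_same_cancel1 order_le_less_trans)
    then obtain B where B: "\<And>k. B k \<in> G (N k)" "\<And>k. L - \<epsilon> k < D (B k)"
      by metis
    define V where "V j l = (\<Union>i\<in>{j..j+l}. B i)" for j l
    have B_G: "B i \<in> G (N j)" if "j \<le> i" for i j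
      using B(1) dec[OF N_mono[OF that]] by auto
    have V_Suc: "V j (Suc l) = B j \<union> V (Suc j) l" for j l
      unfolding V_def by (simp add: Icc_eq_insert_lb_nat)
    have V_G: "V j l \<in> G (N j)" for j l
    proof (induction l arbitrary: j)
      case 0
      then show ?case using B by (simp add: V_def)
    next
      case (Suc l)
      then show ?case
        unfolding V_Suc using B(1) dec[OF N_Suc] by (auto intro!: alg_Un)
    qed
    have V_ge: "L - 4 * \<epsilon> j \<le> D (V j l)" for j l
    proof (induction l arbitrary: j)
      case 0
      then show ?case
        using B(2)[of j] \<epsilon>_pos[of j] by (simp add: V_def)
    next
      case (Suc l)
      have "V (Suc j) l \<in> G (N j)"
        using V_G dec[OF N_Suc] by blast
      then have "D (B j \<inter> V (Suc j) l) \<le> L + \<epsilon> j"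
        using le_d[OF alg_Int[OF B(1)]] dN order_trans by blast
      moreover have "D (V j (Suc l)) = D (B j) + D (V (Suc j) l) - D (B j \<inter> V (Suc j) l)"
        unfolding V_Suc using V_G B(1) sub by (intro D_Un) blast+
      ultimately show ?case
        using Suc[of "Suc j"] B(2)[of j] \<epsilon>_Suc[of j] by linarith
    qed
    define U where "U j = (\<Union>i\<in>{j..}. B i)" for j
    have U_eq: "U j = (\<Union>l. V j l)" for j
    proof (intro set_eqI iffI)
      fix x assume "x \<in> U j"
      then obtain i where "x \<in> B i" "j \<le> i" by (auto simp: U_def)
      then have "x \<in> V j (i - j)" by (auto simp: V_def)
      then show "x \<in> (\<Union>l. V j l)" by blast
    qed (auto simp: U_def V_def)
    have V_sets: "V j l \<in> sets M1" for j l
      using V_G sub by blast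
    have U_ge: "L - 4 * \<epsilon> j \<le> D (U j)" for j
    proof (rule LIMSEQ_le_const)
      have "incseq (V j)"
        unfolding V_def by (intro incseq_SucI UN_mono) auto
      then show "(\<lambda>l. D (V j l)) \<longlonglongrightarrow> D (U j)"
        unfolding U_eq D_def using V_sets sets_eq
        by (intro tendsto_diff M1.finite_Lim_measure_incseq M2.finite_Lim_measure_incseq) auto
    qed (use V_ge in auto)
    have U_sets: "U j \<in> sets M1" for j
      unfolding U_eq using V_sets by auto
    have U_anti: "decseq U"
      unfolding U_def by (intro decseq_SucI UN_mono) auto
    have U_lim: "(\<lambda>j. D (U j)) \<longlonglongrightarrow> D (\<Inter>j. U j)"
      unfolding D_def using U_sets sets_eq U_anti
      by (intro tendsto_diff M1.finite_Lim_measure_decseq M2.finite_Lim_measure_decseq) auto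
    have "L / 2 \<le> D (\<Inter>j. U j)"
    proof (rule LIMSEQ_le_const[OF U_lim], intro exI allI impI)
      fix j :: nat
      have "4 * \<epsilon> j \<le> e / 2"
        using e by (simp add: \<epsilon>_def power_add field_simps)
      then show "L / 2 \<le> D (U j)"
        using U_ge[of j] eL by linarith
    qed
    moreover have "D (\<Inter>j. U j) = 0"
    proof -
      have "(\<Inter>j. U j) \<in> G n" for n
      proof -
        have UG: "U (n + j) \<in> G n" for j
        proof -
          have "n \<le> N (n + j)" by (simp add: N_def)
          then have "V (n + j) l \<in> G n" for l
            using V_G dec by blast
          then show ?thesis
            unfolding U_eq by (rule alg_UN)
        qed
        have "(\<Inter>j. U j) = (\<Inter>j. U (n + j))"
          using U_anti by (auto simp: decseq_def) (meson le_add2 subsetD)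
        then show ?thesis
          using UG by (auto intro!: alg_INT)
      qed
      then show ?thesis
        using tail by (simp add: D_def)
    qed
    ultimately show False
      using eL e by simp
  qed
  show ?thesis
  proof (rule LIMSEQ_I)
    fix r :: real assume r: "0 < r"
    obtain n where n: "\<forall>A\<in>G n. D A \<le> r / 2"
      using main[of "r / 2"] r by auto
    have "norm ((SUP A\<in>G k. \<bar>D A\<bar>) - 0) < r" if "n \<le> k" for k
    proof -
      have le: "\<bar>D A\<bar> \<le> r / 2" if "A \<in> G k" for A
      proof -
        have "A \<in> G n" "space M1 - A \<in> G n" "A \<in> sets M1"
          using that dec[OF \<open>n \<le> k\<close>] alg_compl sub by blast+
        then show ?thesis
          using n D_compl[of A] by (metis abs_le_iff)
      qed
      have "(SUP A\<in>G k. \<bar>D A\<bar>) \<le> r / 2"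
        using le ne by (intro cSUP_least) auto
      moreover have "0 \<le> (SUP A\<in>G k. \<bar>D A\<bar>)"
        using le ne[of k] by (intro cSUP_upper2[where x="space M1"]) (auto intro!: bdd_aboveI[of _ "r/2"])
      ultimately show ?thesis
        using r by simp
    qed
    then show "\<exists>no. \<forall>n\<ge>no. norm ((SUP A\<in>G n. \<bar>measure M1 A - measure M2 A\<bar>) - 0) < r"
      unfolding D_def by blast
  qed
qed

text \<open>Induction over the generation of the \<sigma>-algebra. Errors add under finite unions,
  and a countable union is first cut off at a finite stage by continuity from below.\<close>

lemma cylinder_approx_ex:
  fixes M :: "(nat \<Rightarrow> 'a::finite) measure"
  assumes "finite_measure M" and sets_M: "sets M = sets past_space"
    and "A \<in> sets past_space" "0 < e"
  shows "\<exists>N W. measure M (sym_diff A {\<omega>. pre N \<omega> \<in> W}) < e"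
proof -
  interpret finite_measure M by fact
  have [measurable]: "{\<omega>. pre N \<omega> \<in> W} \<in> sets M" for N and W :: "'a list set"
    using sets_M by simp
  have sp: "space M = UNIV"
    using sets_eq_imp_space_eq[OF sets_M] by simp
  have Un: "\<exists>N W. measure M (sym_diff (A \<union> B) {\<omega>. pre N \<omega> \<in> W}) < e"
    if AB: "A \<in> sets M" "B \<in> sets M" and "0 < e"
      and A: "\<And>e. 0 < e \<Longrightarrow> \<exists>N W. measure M (sym_diff A {\<omega>. pre N \<omega> \<in> W}) < e"
      and B: "\<And>e. 0 < e \<Longrightarrow> \<exists>N W. measure M (sym_diff B {\<omega>. pre N \<omega> \<in> W}) < e" for A B e
  proof -
    obtain N W where NW: "measure M (sym_diff A {\<omega>. pre N \<omega> \<in> W}) < e / 2"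
      using A[of "e / 2"] \<open>0 < e\<close> by auto
    obtain N' W' where NW': "measure M (sym_diff B {\<omega>. pre N' \<omega> \<in> W'}) < e / 2"
      using B[of "e / 2"] \<open>0 < e\<close> by auto
    define V where "V = {u. take N u \<in> W \<or> take N' u \<in> W'}"
    have V: "{\<omega>. pre (max N N') \<omega> \<in> V} = {\<omega>. pre N \<omega> \<in> W} \<union> {\<omega>. pre N' \<omega> \<in> W'}"
      by (auto simp: V_def take_pre)
    have "measure M (sym_diff (A \<union> B) {\<omega>. pre (max N N') \<omega> \<in> V})
        \<le> measure M (sym_diff A {\<omega>. pre N \<omega> \<in> W} \<union> sym_diff B {\<omega>. pre N' \<omega> \<in> W'})"
      unfolding V using AB by (intro finite_measure_mono) auto
    also have "\<dots> \<le> measure M (sym_diff A {\<omega>. pre N \<omega> \<in> W}) + measure M (sym_diff B {\<omega>. pre N' \<omega> \<in> W'})"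
      using AB by (intro measure_Un_le) auto
    finally show ?thesis
      using NW NW' by (intro exI[of _ "max N N'"] exI[of _ V]) simp
  qed
  have "A \<in> sigma_sets UNIV (insert {} (range cylinder))"
    using assms(3) by (simp add: sets_past_cylinder)
  then show ?thesis
    using \<open>0 < e\<close>
  proof (induction arbitrary: e rule: sigma_sets.induct)
    case (Basic A)
    then consider "A = {}" | u where "A = cylinder u"
      by auto
    then show ?case
    proof cases
      case 1
      then show ?thesis using Basic by (intro exI[of _ 0] exI[of _ "{}"]) simp
    next
      case 2
      then show ?thesis using Basic by (intro exI[of _ "length u"] exI[of _ "{u}"]) (simp add: cylinder_def)
    qed
  next
    case Empty
    then show ?case by (intro exI[of _ 0] exI[of _ "{}"]) simp
  next
    case (Compl A)
    then obtain N W where "measure M (sym_diff A {\<omega>. pre N \<omega> \<in> W}) < e"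
      by blast
    moreover have "sym_diff (UNIV - A) {\<omega>. pre N \<omega> \<in> - W} = sym_diff A {\<omega>. pre N \<omega> \<in> W}"
      by auto
    ultimately show ?case by metis
  next
    case (Union A)
    have A[measurable]: "A i \<in> sets M" for i
      using Union(1)[of i] by (simp add: sets_M sets_past_cylinder)
    have fin: "\<exists>N W. measure M (sym_diff (\<Union>i<k. A i) {\<omega>. pre N \<omega> \<in> W}) < e" if "0 < e" for k e
      using that
    proof (induction k arbitrary: e)
      case 0
      then show ?case by (intro exI[of _ 0] exI[of _ "{}"]) simp
    next
      case (Suc k)
      have "(\<Union>i<Suc k. A i) = (\<Union>i<k. A i) \<union> A k"
        by (auto simp: less_Suc_eq)
      then show ?case
        unfolding \<open>(\<Union>i<Suc k. A i) = _\<close>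
        by (intro Un[OF _ A Suc.prems] Suc.IH Union.IH) auto
    qed
    have "(\<lambda>k. measure M (\<Union>i<k. A i)) \<longlonglongrightarrow> measure M (\<Union>k. \<Union>i<k. A i)"
      by (intro finite_Lim_measure_incseq incseq_SucI) (auto simp: less_Suc_eq)
    moreover have "(\<Union>k. \<Union>i<k. A i) = (\<Union>i. A i)"
      by auto
    ultimately have "(\<lambda>k. measure M (\<Union>i<k. A i)) \<longlonglongrightarrow> measure M (\<Union>i. A i)"
      by simp
    then have "\<forall>\<^sub>F k in sequentially. measure M (\<Union>i. A i) - e / 2 < measure M (\<Union>i<k. A i)"
      using Union(3) by (intro order_tendstoD(1)) auto
    from eventually_happens'[OF sequentially_bot this]
    obtain k where k: "measure M (\<Union>i. A i) - e / 2 < measure M (\<Union>i<k. A i)"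
      by blast
    obtain N W where NW: "measure M (sym_diff (\<Union>i<k. A i) {\<omega>. pre N \<omega> \<in> W}) < e / 2"
      using fin[of "e / 2" k] Union(3) by auto
    have diff: "measure M ((\<Union>i. A i) - (\<Union>i<k. A i)) = measure M (\<Union>i. A i) - measure M (\<Union>i<k. A i)"
      by (intro finite_measure_Diff) auto
    have "measure M (sym_diff (\<Union>i. A i) {\<omega>. pre N \<omega> \<in> W})
        \<le> measure M (((\<Union>i. A i) - (\<Union>i<k. A i)) \<union> sym_diff (\<Union>i<k. A i) {\<omega>. pre N \<omega> \<in> W})"
      by (intro finite_measure_mono) auto
    also have "\<dots> \<le> measure M ((\<Union>i. A i) - (\<Union>i<k. A i)) + measure M (sym_diff (\<Union>i<k. A i) {\<omega>. pre N \<omega> \<in> W})"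
      by (intro measure_Un_le) auto
    finally show ?case
      using NW diff k by (intro exI[of _ N] exI[of _ W]) simp
  qed
qed

text \<open>Truncation pulls \<open>W\<close> back to longer words. All large lengths are provided
  because two events will have to be treated at a common length.\<close>

lemma cylinder_approx:
  fixes M :: "(nat \<Rightarrow> 'a::finite) measure"
  assumes "finite_measure M" "sets M = sets past_space" "A \<in> sets past_space" "0 < e"
  shows "\<exists>N. \<forall>n\<ge>N. \<exists>W. measure M (sym_diff A {\<omega>. pre n \<omega> \<in> W}) < e"
proof -
  obtain N W where NW: "measure M (sym_diff A {\<omega>. pre N \<omega> \<in> W}) < e"
    using cylinder_approx_ex[OF assms] by auto
  show ?thesis
  proof (intro exI[of _ N] allI impI)
    fix n assume "N \<le> n"
    then show "\<exists>W. measure M (sym_diff A {\<omega>. pre n \<omega> \<in> W}) < e"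
      using NW by (intro exI[of _ "{u. take N u \<in> W}"]) (simp add: take_pre)
  qed
qed

text \<open>A density theorem by averaging: if \<open>B\<close> left more than the fraction
  \<open>e\<close> of every charged cylinder of length \<open>n\<close> uncovered, then a union of
  such cylinders approximating \<open>B\<close> would exceed \<open>B\<close> by too much.\<close>

lemma cylinder_density:
  fixes M :: "(nat \<Rightarrow> 'a::finite) measure"
  assumes "finite_measure M" and sets_M: "sets M = sets past_space" and B: "B \<in> sets past_space"
    and pos: "0 < measure M B" and e: "0 < e"
  shows "\<exists>N. \<forall>n\<ge>N. \<exists>u\<in>words n. 0 < measure M (cylinder u)
    \<and> measure M (cylinder u - B) \<le> e * measure M (cylinder u)"
proof -
  interpret finite_measure M by fact
  have [measurable]: "{\<omega>. pre n \<omega> \<in> W} \<in> sets M" "cylinder u \<in> sets M" "B \<in> sets M"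
    for n u and W :: "'a list set"
    using sets_M B by simp_all
  \<comment> \<open>The solution of \<open>e' = e * (measure M B - e')\<close>, the value at which
    the two estimates of the excess contradict each other.\<close>
  define e' where "e' = e * measure M B / (1 + e)"
  have e': "0 < e'" "e' = e * (measure M B - e')"
    using pos e by (auto simp: e'_def field_simps)
  then have less: "e' < measure M B"
    using e by (metis diff_gt_0_iff_gt zero_less_mult_pos)
  obtain N where N: "\<forall>n\<ge>N. \<exists>W. measure M (sym_diff B {\<omega>. pre n \<omega> \<in> W}) < e'"
    using cylinder_approx[OF assms(1) sets_M B e'(1)] by blast
  have "\<exists>u\<in>words n. 0 < measure M (cylinder u) \<and> measure M (cylinder u - B) \<le> e * measure M (cylinder u)"
    if "N \<le> n" for n
  proof (rule ccontr)
    assume neg: "\<not> ?thesis"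
    obtain W where W: "measure M (sym_diff B {\<omega>. pre n \<omega> \<in> W}) < e'"
      using N \<open>N \<le> n\<close> by auto
    let ?C = "{\<omega>. pre n \<omega> \<in> W}"
    have C_eq: "?C = (\<Union>u\<in>W \<inter> words n. cylinder u)"
      by (rule pre_vimage_eq)
    have disj: "disjoint_family_on cylinder (W \<inter> words n)"
      using disjoint_cylinder by (auto simp: disjoint_family_on_def)
    have fin: "finite (W \<inter> words n)"
      by simp
    have C: "measure M ?C = (\<Sum>u\<in>W \<inter> words n. measure M (cylinder u))"
      unfolding C_eq by (rule finite_measure_finite_Union) (use disj in auto)
    have "measure M (?C - B) = measure M (\<Union>u\<in>W \<inter> words n. cylinder u - B)"
      unfolding C_eq by (rule arg_cong[where f="measure M"]) auto
    also have "\<dots> = (\<Sum>u\<in>W \<inter> words n. measure M (cylinder u - B))"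
      by (rule finite_measure_finite_Union) (use disj in \<open>auto simp: disjoint_family_on_def\<close>)
    finally have CB: "measure M (?C - B) = (\<Sum>u\<in>W \<inter> words n. measure M (cylinder u - B))" .
    have "e * measure M ?C \<le> measure M (?C - B)"
      unfolding C CB sum_distrib_left
    proof (rule sum_mono)
      fix u assume "u \<in> W \<inter> words n"
      then show "e * measure M (cylinder u) \<le> measure M (cylinder u - B)"
        using neg measure_nonneg[of M "cylinder u"]
        by (cases "measure M (cylinder u) = 0") (simp, metis IntD2 less_eq_real_def linorder_le_cases)
    qed
    moreover have "measure M (?C - B) < e'"
      using W finite_measure_mono[of "?C - B" "sym_diff B ?C"] by auto
    moreover have "measure M B \<le> measure M (B - ?C) + measure M ?C"
      using measure_Un_le[of "B - ?C" M ?C] finite_measure_mono[of B "B - ?C \<union> ?C"] by auto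
    moreover have "measure M (B - ?C) < e'"
      using W finite_measure_mono[of "B - ?C" "sym_diff B ?C"] by auto
    ultimately have "e * (measure M B - e') < e'"
      using e mult_left_mono[of "measure M B - e'" "measure M ?C" e] by linarith
    then show False
      using e'(2) by simp
  qed
  then show ?thesis by blast
qed

text \<open>Integration against counting measure covers all index types met below:
  \<open>bool\<close> for the sum of two measures, pairs of words, and \<open>nat\<close> for a
  series.\<close>

definition measure_sum :: "'b measure \<Rightarrow> ('i \<Rightarrow> 'b measure) \<Rightarrow> 'b measure" where
  "measure_sum N M = measure_of (space N) (sets N) (\<lambda>A. \<integral>\<^sup>+i. emeasure (M i) A \<partial>count_space UNIV)"

lemma sets_measure_sum [simp, measurable_cong]: "sets (measure_sum N M) = sets N"
  by (simp add: measure_sum_def)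

lemma space_measure_sum [simp]: "space (measure_sum N M) = space N"
  by (simp add: measure_sum_def)

lemma emeasure_measure_sum:
  assumes "\<And>i. sets (M i) = sets N" "A \<in> sets N"
  shows "emeasure (measure_sum N M) A = (\<integral>\<^sup>+i. emeasure (M i) A \<partial>count_space UNIV)"
  unfolding measure_sum_def
proof (rule emeasure_measure_of_sigma)
  show "countably_additive (sets N) (\<lambda>A. \<integral>\<^sup>+i. emeasure (M i) A \<partial>count_space UNIV)"
  proof (rule countably_additiveI)
    fix A :: "nat \<Rightarrow> _" assume A: "range A \<subseteq> sets N" "disjoint_family A"
    have "(\<Sum>k. \<integral>\<^sup>+i. emeasure (M i) (A k) \<partial>count_space UNIV) = (\<integral>\<^sup>+i. (\<Sum>k. emeasure (M i) (A k)) \<partial>count_space UNIV)"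
      by (rule nn_integral_suminf[symmetric]) simp
    also have "\<dots> = (\<integral>\<^sup>+i. emeasure (M i) (\<Union>k. A k) \<partial>count_space UNIV)"
      using A assms(1) by (intro nn_integral_cong suminf_emeasure) auto
    finally show "(\<Sum>k. \<integral>\<^sup>+i. emeasure (M i) (A k) \<partial>count_space UNIV)
        = (\<integral>\<^sup>+i. emeasure (M i) (\<Union>k. A k) \<partial>count_space UNIV)" .
  qed
qed (use assms sets.sigma_algebra_axioms in \<open>auto simp: positive_def\<close>)

section \<open>The law of the future given the past\<close>

locale probability_kernel =
  fixes g :: "(nat \<Rightarrow> 'a::finite) \<Rightarrow> real"
  assumes prob_kernel: "prob_kernel g"
begin

lemma measurable_g [measurable]: "g \<in> borel_measurable past_space"
  using prob_kernel by (simp add: prob_kernel_def)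

lemma g_nonneg [simp]: "0 \<le> g x" and g_le_1 [simp]: "g x \<le> 1"
proof -
  have "conc [x 0] (shift 1 x) = x"
    using conc_pre_shift[of 1 x] by (simp add: pre_def)
  then show "0 \<le> g x" "g x \<le> 1"
    using prob_kernel unfolding prob_kernel_def by metis+
qed

lemma sum_g: "(\<Sum>a\<in>UNIV. g (conc [a] x)) = 1"
  using prob_kernel by (simp add: prob_kernel_def)

primrec word_prob :: "'a list \<Rightarrow> (nat \<Rightarrow> 'a) \<Rightarrow> real" where
  "word_prob [] x = 1"
| "word_prob (a # u) x = g (conc [a] x) * word_prob u (conc [a] x)"

lemma word_prob_append: "word_prob (u @ v) x = word_prob u x * word_prob v (after u x)"
  by (induction u arbitrary: x) (simp_all add: after_Cons)

lemma word_prob_nonneg [simp]: "0 \<le> word_prob u x"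
  by (induction u arbitrary: x) simp_all

lemma word_prob_le_1: "word_prob u x \<le> 1"
  by (induction u arbitrary: x) (simp_all add: mult_le_one)

lemma measurable_word_prob [measurable]: "word_prob u \<in> borel_measurable past_space"
  by (induction u) simp_all

text \<open>Ionescu-Tulcea, where the kernel at step \<open>n\<close> reads the past
  \<open>x\<close> extended by the \<open>n\<close> letters already produced. Only the cylinder
  probabilities are kept, since they determine the measure.\<close>

lemma future_exists:
  "\<exists>M. prob_space M \<and> sets M = sets past_space \<and> (\<forall>u. emeasure M (cylinder u) = ennreal (word_prob u x))"
proof -
  let ?S = "\<lambda>n. PiM {0..<n} (\<lambda>_::nat. count_space (UNIV :: 'a set))"
  define K where "K n \<omega> = point_measure UNIV (\<lambda>a. ennreal (g (conc [a] (after (pre n \<omega>) x))))"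
    for n and \<omega> :: "nat \<Rightarrow> 'a"
  have K: "emeasure (K n \<omega>) A = (\<Sum>a\<in>A. ennreal (g (conc [a] (after (pre n \<omega>) x))))" for n \<omega> A
    unfolding K_def by (rule emeasure_point_measure_finite) auto
  have sets_K: "sets (K n \<omega>) = UNIV" and space_K: "space (K n \<omega>) = UNIV" for n \<omega>
    by (simp_all add: K_def sets_point_measure space_point_measure)
  have prob_K: "prob_space (K n \<omega>)" for n \<omega>
  proof (rule prob_spaceI)
    show "emeasure (K n \<omega>) (space (K n \<omega>)) = 1"
      unfolding space_K K by (subst sum_ennreal) (simp_all add: sum_g)
  qed
  have after_meas: "(\<lambda>\<omega>. after (pre n \<omega>) x) \<in> measurable (?S n) past_space" for n
  proof (rule measurable_pastI)
    show "(\<lambda>\<omega>. after (pre n \<omega>) x i) \<in> measurable (?S n) (count_space UNIV)" for i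
    proof (cases "i < n")
      case True
      then have "(\<lambda>\<omega>. after (pre n \<omega>) x i) = (\<lambda>\<omega>. \<omega> (n - Suc i))"
        by (simp add: after_def conc_def rev_nth nth_pre)
      then show ?thesis
        using True by (simp add: measurable_component_singleton)
    qed (simp add: after_def conc_def)
  qed
  interpret IT: Ionescu_Tulcea K "\<lambda>_. count_space (UNIV :: 'a set)"
  proof (rule Ionescu_Tulcea.intro)
    show "K n \<in> measurable (?S n) (subprob_algebra (count_space UNIV))" for n
    proof (rule measurable_subprob_algebra)
      show "(\<lambda>\<omega>. emeasure (K n \<omega>) A) \<in> borel_measurable (?S n)" for A
        unfolding K
        by (intro borel_measurable_sum measurable_compose[OF _ measurable_ennreal]
            measurable_compose[OF _ measurable_g] measurable_compose[OF after_meas] measurable_conc)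
    qed (auto simp: sets_K intro: prob_K prob_space_imp_subprob_space)
  qed (rule prob_K)
  let ?X = "\<lambda>u. {f \<in> space (?S (length u)). pre (length u) f = u}"
  have X_sets: "?X u \<in> sets (?S (length u))" for u
  proof -
    have "(\<lambda>f. f i) \<in> measurable (?S n) (count_space UNIV)" if "i < n" for i n
      using that by (intro measurable_component_singleton) auto
    then have "{f \<in> space (?S (length u)). \<forall>i\<in>{..<length u}. f i = u ! i} \<in> sets (?S (length u))"
      by (intro sets.sets_Collect_finite_All) (auto intro!: measurable_sets_Collect simp: pred_def)
    moreover have "pre (length u) f = u \<longleftrightarrow> (\<forall>i\<in>{..<length u}. f i = u ! i)" for f
      by (auto simp: list_eq_iff_nth_eq nth_pre)
    ultimately show ?thesis by simp
  qed
  \<comment> \<open>The construction appends coordinates at the end, so the induction runs over the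
    last letter, whereas \<open>word_prob\<close> recurses on the first;
    \<open>word_prob_append\<close> reconciles the two.\<close>
  have C: "emeasure (IT.C 0 (length u) (\<lambda>_. undefined)) (?X u) = word_prob u x" for u
  proof (induction u rule: rev_induct)
    case Nil
    show ?case
      using emeasure_return[OF X_sets[of "[]"], of "\<lambda>_. undefined"] by (simp add: space_PiM)
  next
    case (snoc a u)
    let ?n = "length u"
    have "emeasure (IT.C 0 (length (u @ [a])) (\<lambda>_. undefined)) (?X (u @ [a]))
        = (\<integral>\<^sup>+f. emeasure (IT.eP ?n f) (?X (u @ [a])) \<partial>IT.C 0 ?n (\<lambda>_. undefined))"
      using X_sets[of "u @ [a]"] IT.measurable_eP[of ?n]
      by (simp, intro emeasure_bind[where N="?S (Suc ?n)"]) (auto simp: IT.space_C IT.sets_C space_PiM cong: measurable_cong_sets)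
    also have "\<dots> = (\<integral>\<^sup>+f. ennreal (g (conc [a] (after u x))) * indicator (?X u) f \<partial>IT.C 0 ?n (\<lambda>_. undefined))"
    proof (rule nn_integral_cong)
      fix f assume "f \<in> space (IT.C 0 ?n (\<lambda>_. undefined))"
      then have f: "f \<in> space (?S ?n)"
        by (simp add: IT.space_C space_PiM)
      have pre_upd: "pre ?n (f(?n := b)) = pre ?n f" for b
        by (simp add: pre_def)
      have "emeasure (IT.eP ?n f) (?X (u @ [a])) = emeasure (K ?n f) ((\<lambda>b. f(?n := b)) -` ?X (u @ [a]))"
        using IT.emeasure_eP[OF f, of "?X (u @ [a])"] X_sets[of "u @ [a]"] by simp
      also have "(\<lambda>b. f(?n := b)) -` ?X (u @ [a]) = (if f \<in> ?X u then {a} else {})"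
        using f by (auto simp: pre_Suc pre_upd space_PiM PiE_iff extensional_def less_Suc_eq)
      finally show "emeasure (IT.eP ?n f) (?X (u @ [a])) = ennreal (g (conc [a] (after u x))) * indicator (?X u) f"
        by (auto simp: K)
    qed
    also have "\<dots> = ennreal (g (conc [a] (after u x))) * emeasure (IT.C 0 ?n (\<lambda>_. undefined)) (?X u)"
      using X_sets[of u] by (intro nn_integral_cmult_indicator) (simp add: IT.sets_C space_PiM)
    also have "\<dots> = word_prob (u @ [a]) x"
      using snoc by (simp add: word_prob_append mult.commute flip: ennreal_mult)
    finally show ?case .
  qed
  define M where "M = IT.PF.lim"
  have sets_M: "sets M = sets past_space"
    by (simp add: M_def past_space_def)
  have cyl: "emeasure M (cylinder u) = word_prob u x" for u
  proof -
    have "map (restrict f {0..<n}) [0..<n] = map f [0..<n]" for f :: "nat \<Rightarrow> 'a" and n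
      by simp
    then have "cylinder u = IT.PF.emb UNIV {0..<length u} (?X u)"
      unfolding cylinder_def prod_emb_def pre_def space_PiM by (auto simp del: map_eq_conv)
    then have "emeasure M (cylinder u) = emeasure (IT.CI {0..<length u}) (?X u)"
      unfolding M_def using X_sets IT.lim[of "{0..<length u}" "?X u"] by simp
    also have "\<dots> = emeasure (IT.C 0 (length u) (\<lambda>_. undefined)) (IT.PF.emb {0..<length u} {0..<length u} (?X u))"
      using X_sets by (intro IT.emeasure_CI) auto
    also have "IT.PF.emb {0..<length u} {0..<length u} (?X u) = ?X u"
      using sets.sets_into_space[OF X_sets[of u]] by (intro prod_emb_id) (auto simp: space_PiM)
    finally show ?thesis
      using C by simp
  qed
  have "prob_space M"
  proof (rule prob_spaceI)
    show "emeasure M (space M) = 1"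
      using cyl[of "[]"] sets_eq_imp_space_eq[OF sets_M] by simp
  qed
  with sets_M cyl show ?thesis by blast
qed

text \<open>Cylinder probabilities determine the measure (\<open>measure_eqI_cylinder\<close>), so
  the choice operator has only one candidate.\<close>

definition future :: "(nat \<Rightarrow> 'a) \<Rightarrow> (nat \<Rightarrow> 'a) measure" where
  "future x = (SOME M. prob_space M \<and> sets M = sets past_space \<and>
    (\<forall>u. emeasure M (cylinder u) = ennreal (word_prob u x)))"

lemma prob_space_future: "prob_space (future x)"
  and sets_future [simp, measurable_cong]: "sets (future x) = sets past_space"
  and emeasure_future_cylinder: "emeasure (future x) (cylinder u) = ennreal (word_prob u x)"
  using someI_ex[OF future_exists[of x]] unfolding future_def by auto

sublocale future: prob_space "future x" for x
  by (rule prob_space_future)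

lemma space_future [simp]: "space (future x) = UNIV"
  using sets_eq_imp_space_eq[OF sets_future] by simp

lemma measure_future_cylinder: "measure (future x) (cylinder u) = word_prob u x"
  by (simp add: measure_def emeasure_future_cylinder)

text \<open>By the pi-system criterion only cylinders need checking, and there the map is
  \<open>word_prob\<close>. This makes averages over random pasts meaningful.\<close>

lemma measurable_future [measurable]: "future \<in> measurable past_space (prob_algebra past_space)"
proof (rule measurable_prob_algebra_generated[OF _ Int_stable_cylinder])
  show "sets past_space = sigma_sets UNIV (insert {} (range (cylinder :: 'a list \<Rightarrow> _)))"
    by (rule sets_past_cylinder)
  show "(\<lambda>x. emeasure (future x) A) \<in> borel_measurable past_space"
    if "A \<in> insert {} (range cylinder)" for A
    using that by (auto simp: emeasure_future_cylinder)
qed (simp_all add: prob_space_future)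

text \<open>Markov property. As functions of \<open>B\<close> both sides are finite measures, and
  they agree on cylinders by \<open>word_prob_append\<close>; the image under \<open>conc u\<close>
  is the part of \<open>cylinder u\<close> whose remainder lies in \<open>B\<close>.\<close>

lemma future_markov:
  assumes B: "B \<in> sets past_space"
  shows "measure (future x) (conc u ` B) = word_prob u x * measure (future (after u x)) B"
proof -
  have conc_image: "conc u ` B = cylinder u \<inter> shift (length u) -` B" for B
  proof (intro set_eqI iffI)
    fix \<omega> assume "\<omega> \<in> cylinder u \<inter> shift (length u) -` B"
    then have "conc u (shift (length u) \<omega>) = \<omega>" "shift (length u) \<omega> \<in> B"
      using conc_pre_shift[of "length u" \<omega>] by (auto simp: mem_cylinder)
    then show "\<omega> \<in> conc u ` B"
      by (metis imageI)
  qed (auto simp: mem_cylinder pre_conc shift_conc)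
  define N where "N = distr (density (future x) (indicator (cylinder u))) past_space (shift (length u))"
  have N: "emeasure N A = emeasure (future x) (conc u ` A)" if "A \<in> sets past_space" for A
  proof -
    have A[measurable]: "shift (length u) -` A \<in> sets past_space"
      using that by (intro sets_vimage_past measurable_shift)
    have "emeasure N A = emeasure (density (future x) (indicator (cylinder u))) (shift (length u) -` A)"
      unfolding N_def using that by (subst emeasure_distr) auto
    also have "\<dots> = (\<integral>\<^sup>+\<omega>. indicator (cylinder u) \<omega> * indicator (shift (length u) -` A) \<omega> \<partial>future x)"
      by (rule emeasure_density) auto
    also have "\<dots> = (\<integral>\<^sup>+\<omega>. indicator (cylinder u \<inter> shift (length u) -` A) \<omega> \<partial>future x)"
      by (rule nn_integral_cong) (auto split: split_indicator)
    also have "\<dots> = emeasure (future x) (cylinder u \<inter> shift (length u) -` A)"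
      by (rule nn_integral_indicator) auto
    finally show ?thesis
      by (simp add: conc_image)
  qed
  define N' where "N' = scale_measure (ennreal (word_prob u x)) (future (after u x))"
  have "N = N'"
  proof (rule measure_eqI_cylinder)
    show "sets N = sets past_space" "sets N' = sets past_space"
      by (simp_all add: N_def N'_def)
    show "finite_measure N"
    proof (rule finite_measureI)
      have "space N = UNIV" by (simp add: N_def)
      then show "emeasure N (space N) \<noteq> \<infinity>"
        using N[of UNIV] sets.top[of "past_space :: (nat \<Rightarrow> 'a) measure"] by simp
    qed
    show "emeasure N (cylinder v) = emeasure N' (cylinder v)" for v
    proof -
      have "conc u ` cylinder v = cylinder (u @ v)"
        by (auto simp: conc_image mem_cylinder pre_add)
      then show ?thesis
        by (simp add: N N'_def emeasure_future_cylinder word_prob_append ennreal_mult)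
    qed
  qed
  then have "emeasure (future x) (conc u ` B) = ennreal (word_prob u x) * emeasure (future (after u x)) B"
    using N[OF B] B by (simp add: N'_def)
  then show ?thesis
    by (simp add: measure_def enn2real_mult)
qed

end

section \<open>Two-sided processes\<close>

definition glue :: "(nat \<Rightarrow> 'a) \<Rightarrow> (nat \<Rightarrow> 'a) \<Rightarrow> int \<Rightarrow> 'a" where
  "glue x \<omega> = (\<lambda>i. if 0 \<le> i then \<omega> (nat i) else x (nat (- 1 - i)))"

definition forward :: "nat \<Rightarrow> (int \<Rightarrow> 'a) \<Rightarrow> nat \<Rightarrow> 'a" where
  "forward n \<omega> = (\<lambda>k. \<omega> (int (n + k)))"

lemma forward_glue [simp]: "forward n (glue x \<omega>) = shift n \<omega>"
  by (simp add: forward_def glue_def shift_def nat_int_add)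

lemma hist_glue: "hist (int n) (glue x \<omega>) = after (pre n \<omega>) x"
  by (auto simp: fun_eq_iff hist_def glue_def after_def conc_def rev_nth nth_pre nat_diff_distrib'
      intro!: arg_cong[where f=x] arg_cong[where f=\<omega>])

lemma glue_of_nat [simp]: "glue x \<omega> (int n) = \<omega> n"
  by (simp add: glue_def)

lemma hist_0_glue [simp]: "hist 0 (glue x \<omega>) = x"
  using hist_glue[of 0] by simp

text \<open>A map that exhibits every coordinate in \<open>I\<close> generates at least the algebra
  of \<open>I\<close>. With \<open>forward n\<close> and \<open>hist j\<close> this turns two-sided
  events into events on streams.\<close>

lemma coord_algebra_vimage:
  fixes f :: "(int \<Rightarrow> 'a) \<Rightarrow> nat \<Rightarrow> 'a"
  assumes "A \<in> sets (coord_algebra I)" and f: "\<And>i. i \<in> I \<Longrightarrow> \<exists>k. \<forall>\<omega>. f \<omega> k = \<omega> i"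
  shows "\<exists>B\<in>sets past_space. A = f -` B"
proof -
  have "A \<in> sigma_sets UNIV {{\<omega>. \<omega> i \<in> A} | i A. i \<in> I}"
    using assms(1) by (simp add: sets_coord_algebra)
  then show ?thesis
  proof induction
    case (Basic A)
    then obtain i C where i: "i \<in> I" "A = {\<omega>. \<omega> i \<in> C}"
      by auto
    then obtain k where "\<forall>\<omega>. f \<omega> k = \<omega> i"
      using f by auto
    then show ?case
      using i measurable_sets[OF measurable_component_past, of C k]
      by (intro bexI[of _ "(\<lambda>x. x k) -` C"]) auto
  next
    case Empty
    then show ?case by (intro bexI[of _ "{}"]) auto
  next
    case (Compl A)
    then obtain B where "B \<in> sets past_space" "A = f -` B"
      by auto
    then show ?case
      using sets.compl_sets[of B past_space] by (intro bexI[of _ "UNIV - B"]) auto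
  next
    case (Union A)
    then obtain B where "\<And>i. B i \<in> sets past_space" "\<And>i. A i = f -` B i"
      by metis
    then show ?case
      by (intro bexI[of _ "\<Union>i. B i"]) auto
  qed
qed

lemma measurable_forward: "forward n \<in> measurable (coord_algebra {int n..}) past_space"
  by (rule measurable_pastI) (auto simp: forward_def intro!: measurable_coord)

lemma sets_coord_algebra_future:
  "A \<in> sets (coord_algebra {int n..}) \<longleftrightarrow> (\<exists>B\<in>sets past_space. A = forward n -` B)"
proof
  assume "A \<in> sets (coord_algebra {int n..})"
  then show "\<exists>B\<in>sets past_space. A = forward n -` B"
  proof (rule coord_algebra_vimage)
    show "\<exists>k. \<forall>\<omega>. forward n \<omega> k = \<omega> i" if "i \<in> {int n..}" for i
      using that by (intro exI[of _ "nat (i - int n)"]) (simp add: forward_def)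
  qed
next
  assume "\<exists>B\<in>sets past_space. A = forward n -` B"
  then show "A \<in> sets (coord_algebra {int n..})"
    using measurable_sets[OF measurable_forward] by fastforce
qed

lemma sets_coord_algebra_past:
  "A \<in> sets (coord_algebra {..j - 1}) \<longleftrightarrow> (\<exists>B\<in>sets past_space. A = hist j -` B)"
proof
  assume "A \<in> sets (coord_algebra {..j - 1})"
  then show "\<exists>B\<in>sets past_space. A = hist j -` B"
  proof (rule coord_algebra_vimage)
    show "\<exists>k. \<forall>\<omega>. hist j \<omega> k = \<omega> i" if "i \<in> {..j - 1}" for i
      using that by (intro exI[of _ "nat (j - 1 - i)"]) (simp add: hist_def)
  qed
next
  assume "\<exists>B\<in>sets past_space. A = hist j -` B"
  then show "A \<in> sets (coord_algebra {..j - 1})"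
    using measurable_sets[OF measurable_hist] by fastforce
qed

lemma measurable_coord_algebra_UNIV_I:
  assumes "\<And>i. (\<lambda>z. f z i) \<in> measurable M (count_space UNIV)"
  shows "f \<in> measurable M (coord_algebra UNIV)"
  unfolding measurable_cong_sets[OF refl sets_coord_algebra_UNIV]
  using assms by (intro measurable_PiM_single') auto

lemma measurable_hist_UNIV [measurable]: "hist j \<in> measurable (coord_algebra UNIV) past_space"
  unfolding hist_def by (rule measurable_pastI) (simp add: measurable_coord)

lemma measurable_coord_UNIV [measurable]: "(\<lambda>\<omega>. \<omega> i) \<in> measurable (coord_algebra UNIV) (count_space UNIV)"
  by (rule measurable_coord) simp

lemma measurable_glue_pair:
  "(\<lambda>(x, \<omega>). glue x \<omega>) \<in> measurable (past_space \<Otimes>\<^sub>M past_space) (coord_algebra UNIV)"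
proof (rule measurable_coord_algebra_UNIV_I)
  show "(\<lambda>z. (case z of (x, \<omega>) \<Rightarrow> glue x \<omega>) i) \<in> measurable (past_space \<Otimes>\<^sub>M past_space) (count_space UNIV)" for i
    unfolding glue_def case_prod_beta by (cases "0 \<le> i") simp_all
qed

lemma measurable_glue [measurable]: "glue x \<in> measurable past_space (coord_algebra UNIV)"
  using measurable_compose[OF measurable_Pair1'[of x past_space past_space] measurable_glue_pair] by simp

lemma hist_shift: "hist (int n) \<omega> = shift m (hist (int (n + m)) \<omega>)"
  by (simp add: hist_def shift_def fun_eq_iff algebra_simps)

text \<open>Events seen from times \<open>n\<close> and \<open>m\<close> are both seen from their
  maximum, and every coordinate is seen from some nonnegative time; so the history events form a
  generating pi-system.\<close>

lemma process_eqI: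
  fixes P Q :: "(int \<Rightarrow> 'a) measure"
  assumes "prob_space P" and sets_P: "sets P = sets (coord_algebra UNIV)"
    and sets_Q: "sets Q = sets (coord_algebra UNIV)"
    and eq: "\<And>n. distr P past_space (hist (int n)) = distr Q past_space (hist (int n))"
  shows "P = Q"
proof -
  interpret prob_space P by fact
  have sp: "space P = UNIV" "space Q = UNIV"
    using sets_eq_imp_space_eq[OF sets_P] sets_eq_imp_space_eq[OF sets_Q] by simp_all
  let ?E = "{hist (int n) -` B | n B. B \<in> sets past_space} :: (int \<Rightarrow> 'a) set set"
  have E_sub: "?E \<subseteq> sets (coord_algebra UNIV)"
    using measurable_sets[OF measurable_hist_UNIV] by fastforce
  show ?thesis
  proof (rule measure_eqI_generator_eq[where E="?E" and \<Omega>=UNIV and A="\<lambda>_. UNIV"])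
    show "Int_stable ?E"
    proof (rule Int_stableI, elim CollectE exE conjE)
      fix a b n m and B C :: "(nat \<Rightarrow> 'a) set"
      assume *: "a = hist (int n) -` B" "b = hist (int m) -` C" "B \<in> sets past_space" "C \<in> sets past_space"
      define k where "k = max n m"
      obtain i j where ij: "k = n + i" "k = m + j"
        unfolding k_def by (metis le_add_diff_inverse max.cobounded1 max.cobounded2)
      have "a \<inter> b = hist (int k) -` (shift i -` B \<inter> shift j -` C)"
        using hist_shift[of n _ i] hist_shift[of m _ j] by (auto simp: * simp flip: ij)
      moreover have "shift i -` B \<inter> shift j -` C \<in> sets past_space"
        using * by (intro sets.Int sets_vimage_past measurable_shift)
      ultimately show "a \<inter> b \<in> ?E"
        by blast
    qed
    have "sigma_sets UNIV ?E = sets (coord_algebra UNIV)"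
    proof (rule antisym)
      show "sigma_sets UNIV ?E \<subseteq> sets (coord_algebra UNIV)"
        using sets.sigma_sets_subset[OF E_sub] by simp
      have "{\<omega>. \<omega> i \<in> A} \<in> ?E" for i and A :: "'a set"
      proof -
        \<comment> \<open>\<open>hist j\<close> starts at coordinate \<open>j - 1\<close>, so
          coordinate \<open>i\<close> is visible from time \<open>i + 1\<close>, or from time 0 if
          \<open>i\<close> is negative.\<close>
        have "(nat (int (nat (i + 1)) - 1 - i)) = nat (max 0 (i + 1) - 1 - i)"
          by simp
        then have "{\<omega>. \<omega> i \<in> A} = hist (int (nat (i + 1))) -` ((\<lambda>x. x (nat (int (nat (i + 1)) - 1 - i))) -` A)"
          by (auto simp: hist_def)
        moreover have "(\<lambda>x. x k) -` A \<in> sets past_space" for k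
          using measurable_sets[OF measurable_component_past, of A k] by simp
        ultimately show ?thesis
          by blast
      qed
      then have "{{\<omega>. \<omega> i \<in> A} | i A. i \<in> UNIV} \<subseteq> ?E"
        by (intro subsetI, elim CollectE exE conjE) (simp only:)
      then show "sets (coord_algebra UNIV) \<subseteq> sigma_sets UNIV ?E"
        unfolding sets_coord_algebra by (rule sigma_sets_mono')
    qed
    then show "sets P = sigma_sets UNIV ?E" "sets Q = sigma_sets UNIV ?E"
      by (simp_all add: sets_P sets_Q)
    show "emeasure P X = emeasure Q X" if "X \<in> ?E" for X
    proof -
      obtain n B where X: "X = hist (int n) -` B" "B \<in> sets past_space"
        using \<open>X \<in> ?E\<close> by blast
      have "emeasure (distr M past_space (hist (int n))) B = emeasure M X"
        if "sets M = sets (coord_algebra UNIV)" "space M = UNIV" for M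
        using X that by (subst emeasure_distr) (auto cong: measurable_cong_sets)
      then show ?thesis
        using eq[of n] sets_P sets_Q sp by metis
    qed
    show "range (\<lambda>_::nat. UNIV) \<subseteq> ?E"
      using sets.top[of "past_space :: (nat \<Rightarrow> 'a) measure"] by (auto intro!: exI[of _ 0] exI[of _ UNIV])
  qed auto
qed

context probability_kernel
begin

text \<open>Conditional expectation is characterised by integrals over sets of the algebra, which
  are exactly the preimages under \<open>hist j\<close>. The nonnegative integral on the right frees
  later computations from integrability conditions.\<close>

lemma cond_exp_iff:
  assumes "prob_space P" and sets_P: "sets P = sets (coord_algebra UNIV)"
  shows "(AE \<omega> in P. real_cond_exp P (coord_algebra {..j - 1}) (indicator {\<omega>. \<omega> j = a}) \<omega> = g (conc [a] (hist j \<omega>)))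
    \<longleftrightarrow> (\<forall>B\<in>sets past_space. emeasure P ({\<omega>. \<omega> j = a} \<inter> hist j -` B)
        = (\<integral>\<^sup>+\<omega>. ennreal (g (conc [a] (hist j \<omega>))) * indicator (hist j -` B) \<omega> \<partial>P))"
    (is "?L \<longleftrightarrow> ?R")
proof -
  let ?F = "coord_algebra {..j - 1} :: (int \<Rightarrow> 'a) measure"
  let ?h = "\<lambda>\<omega>. g (conc [a] (hist j \<omega>))"
  interpret prob_space P by fact
  interpret finite_measure_subalgebra P ?F
    by (rule finite_measure_subalgebra.intro)
      (simp_all add: finite_measure_axioms finite_measure_subalgebra_axioms_def subalgebra_coord_algebra sets_P)
  note [measurable_cong] = sets_P
  have sp: "space P = UNIV"
    using sets_eq_imp_space_eq[OF sets_P] by simp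
  have h_F: "?h \<in> borel_measurable ?F"
    by (intro measurable_compose[OF _ measurable_g] measurable_compose[OF measurable_hist] measurable_conc)
  have [measurable]: "?h \<in> borel_measurable P"
    by measurable
  have j_meas[measurable]: "{\<omega>. \<omega> j = a} \<in> sets P"
    using measurable_sets[OF measurable_coord_UNIV, of "{a}" j] by (simp add: sets_P vimage_def)
  have int_h: "integrable P ?h"
    by (rule integrable_const_bound[of _ 1]) auto
  have int_i: "integrable P (indicator {\<omega>. \<omega> j = a} :: _ \<Rightarrow> real)"
    by (simp add: integrable_indicator_iff less_top[symmetric])
  have L1: "(\<integral>\<omega>\<in>hist j -` B. indicat_real {\<omega>. \<omega> j = a} \<omega> \<partial>P) = measure P ({\<omega>. \<omega> j = a} \<inter> hist j -` B)"
    if [measurable]: "B \<in> sets past_space" for B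
  proof -
    have "(\<integral>\<omega>\<in>hist j -` B. indicat_real {\<omega>. \<omega> j = a} \<omega> \<partial>P)
        = (\<integral>\<omega>. indicat_real ({\<omega>. \<omega> j = a} \<inter> hist j -` B) \<omega> \<partial>P)"
      unfolding set_lebesgue_integral_def by (intro Bochner_Integration.integral_cong) (auto split: split_indicator)
    then show ?thesis
      by (simp add: sp)
  qed
  have L2: "(\<integral>\<^sup>+\<omega>. ennreal (?h \<omega>) * indicator (hist j -` B) \<omega> \<partial>P) = ennreal (\<integral>\<omega>\<in>hist j -` B. ?h \<omega> \<partial>P)"
    if B[measurable]: "B \<in> sets past_space" for B
  proof -
    have [measurable]: "hist j -` B \<in> sets P"
      using measurable_sets[OF measurable_hist_UNIV B] by (simp add: sets_P)
    have "(\<integral>\<^sup>+\<omega>. ennreal (?h \<omega>) * indicator (hist j -` B) \<omega> \<partial>P)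
        = (\<integral>\<^sup>+\<omega>. ennreal (indicator (hist j -` B) \<omega> *\<^sub>R ?h \<omega>) \<partial>P)"
      by (intro nn_integral_cong) (auto split: split_indicator)
    also have "\<dots> = ennreal (\<integral>\<omega>. indicator (hist j -` B) \<omega> *\<^sub>R ?h \<omega> \<partial>P)"
      using int_h by (intro nn_integral_eq_integral integrable_mult_indicator) auto
    finally show ?thesis
      by (simp add: set_lebesgue_integral_def)
  qed
  have L3: "0 \<le> (\<integral>\<omega>\<in>hist j -` B. ?h \<omega> \<partial>P)" for B
    unfolding set_lebesgue_integral_def by (rule Bochner_Integration.integral_nonneg) auto
  have R_iff: "?R \<longleftrightarrow> (\<forall>B\<in>sets past_space. (\<integral>\<omega>\<in>hist j -` B. indicat_real {\<omega>. \<omega> j = a} \<omega> \<partial>P) = (\<integral>\<omega>\<in>hist j -` B. ?h \<omega> \<partial>P))"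
    using L1 L2 L3 by (simp add: emeasure_eq_measure)
  show ?thesis
  proof
    assume ?L
    show ?R
      unfolding R_iff
    proof
      fix B :: "(nat \<Rightarrow> 'a) set" assume "B \<in> sets past_space"
      then have B: "hist j -` B \<in> sets ?F"
        using sets_coord_algebra_past by blast
      have "(\<integral>\<omega>\<in>hist j -` B. indicat_real {\<omega>. \<omega> j = a} \<omega> \<partial>P)
          = (\<integral>\<omega>\<in>hist j -` B. real_cond_exp P ?F (indicator {\<omega>. \<omega> j = a}) \<omega> \<partial>P)"
        by (rule real_cond_exp_intA[OF int_i B])
      also have "\<dots> = (\<integral>\<omega>\<in>hist j -` B. ?h \<omega> \<partial>P)"
        unfolding set_lebesgue_integral_def using \<open>?L\<close>
        using B subalg by (intro integral_cong_AE) (auto simp: subalgebra_def)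
      finally show "(\<integral>\<omega>\<in>hist j -` B. indicat_real {\<omega>. \<omega> j = a} \<omega> \<partial>P) = (\<integral>\<omega>\<in>hist j -` B. ?h \<omega> \<partial>P)" .
    qed
  next
    assume ?R
    then have R: "(\<integral>\<omega>\<in>hist j -` B. indicat_real {\<omega>. \<omega> j = a} \<omega> \<partial>P) = (\<integral>\<omega>\<in>hist j -` B. ?h \<omega> \<partial>P)"
      if "B \<in> sets past_space" for B
      unfolding R_iff using that by blast
    show ?L
    proof (rule real_cond_exp_charact[OF _ int_i int_h h_F])
      fix A :: "(int \<Rightarrow> 'a) set" assume "A \<in> sets ?F"
      then obtain B where "B \<in> sets past_space" "A = hist j -` B"
        using sets_coord_algebra_past by blast
      then show "(\<integral>\<omega>\<in>A. indicat_real {\<omega>. \<omega> j = a} \<omega> \<partial>P) = (\<integral>\<omega>\<in>A. ?h \<omega> \<partial>P)"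
        using R by simp
    qed
  qed
qed

section \<open>Existence and uniqueness of the two-sided law\<close>

lemma measurable_glue_future [measurable]: "glue x \<in> measurable (future y) (coord_algebra UNIV)"
  using measurable_glue[of x] by (simp add: measurable_cong_sets[OF sets_future refl])

text \<open>The explicit candidate for the law: draw a past from \<open>\<nu>\<close>, then glue to
  it a stream from its future.\<close>

definition mixture :: "(nat \<Rightarrow> 'a) measure \<Rightarrow> (int \<Rightarrow> 'a) measure" where
  "mixture \<nu> = \<nu> \<bind> (\<lambda>x. distr (future x) (coord_algebra UNIV) (glue x))"

lemma measurable_kernel_prob:
  "(\<lambda>x. distr (future x) (coord_algebra UNIV) (glue x)) \<in> measurable past_space (prob_algebra (coord_algebra UNIV))"
  by (intro measurable_distr_prob_space2[OF measurable_future] measurable_glue_pair)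

lemma measurable_kernel_subprob:
  "(\<lambda>x. distr (future x) (coord_algebra UNIV) (glue x)) \<in> measurable past_space (subprob_algebra (coord_algebra UNIV))"
  using measurable_kernel_prob by (rule measurable_prob_algebraD)

context
  fixes \<nu> :: "(nat \<Rightarrow> 'a) measure"
  assumes \<nu>: "\<nu> \<in> space (prob_algebra past_space)"
begin

lemma sets_nu [measurable_cong]: "sets \<nu> = sets past_space" and prob_nu: "prob_space \<nu>"
  using \<nu> by (simp_all add: space_prob_algebra)

lemma space_nu [simp]: "space \<nu> = UNIV"
  using sets_eq_imp_space_eq[OF sets_nu] by simp

lemma kernel_nu:
  "(\<lambda>x. distr (future x) (coord_algebra UNIV) (glue x)) \<in> measurable \<nu> (subprob_algebra (coord_algebra UNIV))"
  using measurable_kernel_subprob by (simp add: measurable_cong_sets[OF sets_nu refl])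

lemma sets_mixture: "sets (mixture \<nu>) = sets (coord_algebra UNIV)"
  unfolding mixture_def by (rule sets_bind) simp_all

lemma space_mixture: "space (mixture \<nu>) = UNIV"
  using sets_eq_imp_space_eq[OF sets_mixture] by simp

lemma prob_space_mixture: "prob_space (mixture \<nu>)"
  unfolding mixture_def
proof (rule prob_space.prob_space_bind[OF prob_nu _ kernel_nu])
  show "AE x in \<nu>. prob_space (distr (future x) (coord_algebra UNIV) (glue x))"
    by (intro AE_I2 prob_space.prob_space_distr prob_space_future) simp
qed

lemma emeasure_mixture:
  assumes "A \<in> sets (coord_algebra UNIV)"
  shows "emeasure (mixture \<nu>) A = (\<integral>\<^sup>+x. emeasure (future x) (glue x -` A) \<partial>\<nu>)"
  unfolding mixture_def using assms
  by (subst emeasure_bind[OF _ kernel_nu]) (auto simp: emeasure_distr)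

lemma measure_mixture:
  assumes "A \<in> sets (coord_algebra UNIV)"
  shows "measure (mixture \<nu>) A = (\<integral>x. measure (future x) (glue x -` A) \<partial>\<nu>)"
proof -
  interpret prob_space \<nu> by (rule prob_nu)
  show ?thesis
    unfolding mixture_def using assms
    by (subst measure_bind[OF kernel_nu]) (auto simp: measure_distr)
qed

text \<open>For a fixed past the transition at time \<open>n\<close> involves finitely many words of
  length \<open>n\<close>, and \<open>word_prob_append\<close> gives the identity word by word;
  integration over \<open>\<nu>\<close> finishes.\<close>

lemma is_law_mixture: "is_law g \<nu> (mixture \<nu>)"
  unfolding is_law_def
proof (intro conjI ballI allI impI)
  interpret prob_space \<nu> by (rule prob_nu)
  show "prob_space (mixture \<nu>)" by (rule prob_space_mixture)
  show "sets (mixture \<nu>) = sets (coord_algebra UNIV)" by (rule sets_mixture)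
  fix B :: "(nat \<Rightarrow> 'a) set" assume B: "B \<in> sets past_space"
  have "{\<omega>. hist 0 \<omega> \<in> B} \<in> sets (coord_algebra UNIV)"
    using measurable_sets[OF measurable_hist_UNIV B] by (simp add: vimage_def)
  then have "measure (mixture \<nu>) {\<omega>. hist 0 \<omega> \<in> B} = (\<integral>x. measure (future x) (glue x -` {\<omega>. hist 0 \<omega> \<in> B}) \<partial>\<nu>)"
    by (rule measure_mixture)
  also have "\<dots> = (\<integral>x. indicator B x \<partial>\<nu>)"
    using future.prob_space by (intro Bochner_Integration.integral_cong) (auto simp: vimage_def split: split_indicator)
  also have "\<dots> = measure \<nu> B"
    by simp
  finally show "measure (mixture \<nu>) {\<omega>. hist 0 \<omega> \<in> B} = measure \<nu> B" .
next
  fix j :: int and a assume "0 \<le> j"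
  then obtain n where j: "j = int n"
    using nonneg_int_cases by blast
  show "AE \<omega> in mixture \<nu>. real_cond_exp (mixture \<nu>) (coord_algebra {..j - 1}) (indicator {\<omega>. \<omega> j = a}) \<omega> = g (conc [a] (hist j \<omega>))"
    unfolding cond_exp_iff[OF prob_space_mixture sets_mixture]
  proof
    fix B :: "(nat \<Rightarrow> 'a) set" assume B[measurable]: "B \<in> sets past_space"
    have hB[measurable]: "hist j -` B \<in> sets (coord_algebra UNIV)"
      using measurable_sets[OF measurable_hist_UNIV B] by simp
    have j_meas[measurable]: "{\<omega>. \<omega> j = a} \<in> sets (coord_algebra UNIV)"
      using measurable_sets[OF measurable_coord_UNIV, of "{a}" j] by (simp add: vimage_def)
    have f_meas: "(\<lambda>\<omega>. ennreal (g (conc [a] (hist j \<omega>))) * indicator (hist j -` B) \<omega>) \<in> borel_measurable (coord_algebra UNIV)"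
      by measurable
    \<comment> \<open>Once the past \<open>x\<close> is fixed, the history at time \<open>n\<close>
      is \<open>after u x\<close> for the word \<open>u\<close> read so far, so the event is a
      finite disjoint union of cylinders.\<close>
    have step: "emeasure (future x) (glue x -` ({\<omega>. \<omega> j = a} \<inter> hist j -` B))
        = (\<integral>\<^sup>+\<omega>. ennreal (g (conc [a] (after (pre n \<omega>) x))) * indicator B (after (pre n \<omega>) x) \<partial>future x)" for x
    proof -
      let ?W = "{u \<in> words n. after u x \<in> B}"
      have "glue x -` ({\<omega>. \<omega> j = a} \<inter> hist j -` B) = (\<Union>u\<in>?W. cylinder (u @ [a]))"
        by (auto simp: j hist_glue mem_cylinder pre_Suc words_def)
      also have "emeasure (future x) \<dots> = (\<Sum>u\<in>?W. emeasure (future x) (cylinder (u @ [a])))"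
      proof (rule sum_emeasure[symmetric])
        show "finite ?W" by simp
      qed (auto simp: disjoint_family_on_def mem_cylinder words_def)
      also have "\<dots> = (\<Sum>u\<in>?W. ennreal (word_prob u x) * ennreal (g (conc [a] (after u x))))"
        by (simp add: emeasure_future_cylinder word_prob_append ennreal_mult)
      also have "\<dots> = (\<Sum>u\<in>words n. ennreal (g (conc [a] (after u x))) * indicator B (after u x) * emeasure (future x) (cylinder u))"
        by (rule sum.mono_neutral_cong_left) (auto simp: emeasure_future_cylinder mult.commute)
      also have "\<dots> = (\<integral>\<^sup>+\<omega>. (\<Sum>u\<in>words n. ennreal (g (conc [a] (after u x))) * indicator B (after u x) * indicator (cylinder u) \<omega>) \<partial>future x)"
        by (subst nn_integral_sum) (auto intro!: sum.cong nn_integral_cmult_indicator[symmetric])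
      also have "\<dots> = (\<integral>\<^sup>+\<omega>. ennreal (g (conc [a] (after (pre n \<omega>) x))) * indicator B (after (pre n \<omega>) x) \<partial>future x)"
      proof (rule nn_integral_cong)
        fix \<omega>
        have "(\<Sum>u\<in>words n. ennreal (g (conc [a] (after u x))) * indicator B (after u x) * indicator (cylinder u) \<omega>)
            = (\<Sum>u\<in>{pre n \<omega>}. ennreal (g (conc [a] (after u x))) * indicator B (after u x))"
          by (rule sum.mono_neutral_cong_right, rule finite_words) (auto simp: mem_cylinder words_def split: split_indicator)
        also have "\<dots> = ennreal (g (conc [a] (after (pre n \<omega>) x))) * indicator B (after (pre n \<omega>) x)"
          by (subst sum.insert) auto
        finally show "(\<Sum>u\<in>words n. ennreal (g (conc [a] (after u x))) * indicator B (after u x) * indicator (cylinder u) \<omega>)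
            = ennreal (g (conc [a] (after (pre n \<omega>) x))) * indicator B (after (pre n \<omega>) x)" .
      qed
      finally show ?thesis .
    qed
    have "(\<integral>\<^sup>+\<omega>. ennreal (g (conc [a] (hist j \<omega>))) * indicator (hist j -` B) \<omega> \<partial>mixture \<nu>)
        = (\<integral>\<^sup>+x. \<integral>\<^sup>+\<omega>. ennreal (g (conc [a] (hist j \<omega>))) * indicator (hist j -` B) \<omega> \<partial>distr (future x) (coord_algebra UNIV) (glue x) \<partial>\<nu>)"
      unfolding mixture_def by (rule nn_integral_bind[OF f_meas kernel_nu])
    also have "\<dots> = (\<integral>\<^sup>+x. \<integral>\<^sup>+\<omega>. ennreal (g (conc [a] (after (pre n \<omega>) x))) * indicator B (after (pre n \<omega>) x) \<partial>future x \<partial>\<nu>)"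
      using f_meas by (intro nn_integral_cong) (subst nn_integral_distr, auto simp: j hist_glue indicator_def intro!: nn_integral_cong)
    also have "\<dots> = emeasure (mixture \<nu>) ({\<omega>. \<omega> j = a} \<inter> hist j -` B)"
      by (subst emeasure_mixture) (auto simp only: step intro!: sets.Int hB j_meas)
    finally show "emeasure (mixture \<nu>) ({\<omega>. \<omega> j = a} \<inter> hist j -` B)
        = (\<integral>\<^sup>+\<omega>. ennreal (g (conc [a] (hist j \<omega>))) * indicator (hist j -` B) \<omega> \<partial>mixture \<nu>)" ..
  qed
qed

text \<open>The transition property determines the law of the history at time \<open>n + 1\<close>
  from that at time \<open>n\<close>. The start is \<open>\<nu>\<close>, so all history laws agree
  and \<open>process_eqI\<close> applies.\<close>

lemma is_law_unique:
  assumes P: "is_law g \<nu> P" and Q: "is_law g \<nu> Q"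
  shows "P = Q"
proof (rule process_eqI)
  show "prob_space P" "sets P = sets (coord_algebra UNIV)" "sets Q = sets (coord_algebra UNIV)"
    using P Q by (auto simp: is_law_def)
  interpret prob_space \<nu> by (rule prob_nu)
  have start: "distr R past_space (hist 0) = \<nu>" if R: "is_law g \<nu> R" for R
  proof (rule measure_eqI)
    interpret R: prob_space R using R by (simp add: is_law_def)
    have sets_R: "sets R = sets (coord_algebra UNIV)" using R by (simp add: is_law_def)
    have "space R = UNIV" using sets_eq_imp_space_eq[OF sets_R] by simp
    fix B assume "B \<in> sets (distr R past_space (hist 0))"
    then have B: "B \<in> sets past_space" by simp
    have "emeasure (distr R past_space (hist 0)) B = emeasure R (hist 0 -` B)"
      using B \<open>space R = UNIV\<close> by (subst emeasure_distr) (auto simp: measurable_cong_sets[OF sets_R refl])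
    also have "\<dots> = emeasure \<nu> B"
      using R B by (simp add: is_law_def R.emeasure_eq_measure emeasure_eq_measure vimage_def)
    finally show "emeasure (distr R past_space (hist 0)) B = emeasure \<nu> B" .
  qed (simp add: sets_nu)
  have step: "emeasure (distr R past_space (hist (int (Suc n)))) B
      = (\<Sum>a\<in>UNIV. \<integral>\<^sup>+y. ennreal (g (conc [a] y)) * indicator (conc [a] -` B) y \<partial>distr R past_space (hist (int n)))"
    if R: "is_law g \<nu> R" and B: "B \<in> sets past_space" for R n B
  proof -
    interpret R: prob_space R using R by (simp add: is_law_def)
    have sets_R: "sets R = sets (coord_algebra UNIV)" using R by (simp add: is_law_def)
    have sp: "space R = UNIV" using sets_eq_imp_space_eq[OF sets_R] by simp
    note [measurable_cong] = sets_R
    have cB[measurable]: "conc [a] -` B \<in> sets past_space" for a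
      using B by (intro sets_vimage_past measurable_conc)
    have hB: "hist (int n) -` C \<in> sets R" if "C \<in> sets past_space" for C
      using measurable_sets[OF measurable_hist_UNIV that] by (simp add: sets_R)
    have j_meas: "{\<omega>. \<omega> (int n) = a} \<in> sets R" for a
      using measurable_sets[OF measurable_coord_UNIV, of "{a}" "int n"] by (simp add: sets_R vimage_def)
    have hist_Suc: "hist (int (Suc n)) \<omega> = conc [\<omega> (int n)] (hist (int n) \<omega>)" for \<omega> :: "int \<Rightarrow> 'a"
      by (auto simp: hist_def conc_def fun_eq_iff intro!: arg_cong[where f=\<omega>])
    have "emeasure (distr R past_space (hist (int (Suc n)))) B = emeasure R (hist (int (Suc n)) -` B)"
      using B sp by (subst emeasure_distr) auto
    also have "hist (int (Suc n)) -` B = (\<Union>a. {\<omega>. \<omega> (int n) = a} \<inter> hist (int n) -` (conc [a] -` B))"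
      by (auto simp: hist_Suc simp del: of_nat_Suc)
    also have "emeasure R \<dots> = (\<Sum>a\<in>UNIV. emeasure R ({\<omega>. \<omega> (int n) = a} \<inter> hist (int n) -` (conc [a] -` B)))"
      using j_meas hB[OF cB] by (intro sum_emeasure[symmetric]) (auto simp: disjoint_family_on_def)
    also have "\<dots> = (\<Sum>a\<in>UNIV. \<integral>\<^sup>+\<omega>. ennreal (g (conc [a] (hist (int n) \<omega>))) * indicator (hist (int n) -` (conc [a] -` B)) \<omega> \<partial>R)"
    proof (rule sum.cong)
      fix a :: 'a
      have "AE \<omega> in R. real_cond_exp R (coord_algebra {..int n - 1}) (indicator {\<omega>. \<omega> (int n) = a}) \<omega> = g (conc [a] (hist (int n) \<omega>))"
        using R unfolding is_law_def by simp
      then show "emeasure R ({\<omega>. \<omega> (int n) = a} \<inter> hist (int n) -` (conc [a] -` B))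
          = (\<integral>\<^sup>+\<omega>. ennreal (g (conc [a] (hist (int n) \<omega>))) * indicator (hist (int n) -` (conc [a] -` B)) \<omega> \<partial>R)"
        unfolding cond_exp_iff[OF R.prob_space_axioms sets_R] using cB by blast
    qed simp
    also have "\<dots> = (\<Sum>a\<in>UNIV. \<integral>\<^sup>+y. ennreal (g (conc [a] y)) * indicator (conc [a] -` B) y \<partial>distr R past_space (hist (int n)))"
    proof (rule sum.cong)
      fix a :: 'a
      have "(\<lambda>y. ennreal (g (conc [a] y)) * indicator (conc [a] -` B) y) \<in> borel_measurable past_space"
        by measurable
      then show "(\<integral>\<^sup>+\<omega>. ennreal (g (conc [a] (hist (int n) \<omega>))) * indicator (hist (int n) -` (conc [a] -` B)) \<omega> \<partial>R)
          = (\<integral>\<^sup>+y. ennreal (g (conc [a] y)) * indicator (conc [a] -` B) y \<partial>distr R past_space (hist (int n)))"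
        by (subst nn_integral_distr) (auto simp: indicator_def intro!: nn_integral_cong)
    qed simp
    finally show ?thesis .
  qed
  show "distr P past_space (hist (int n)) = distr Q past_space (hist (int n))" for n
  proof (induction n)
    case 0
    then show ?case using start P Q by simp
  next
    case (Suc n)
    show ?case
    proof (rule measure_eqI)
      fix B assume "B \<in> sets (distr P past_space (hist (int (Suc n))))"
      then have "B \<in> sets past_space" by simp
      then show "emeasure (distr P past_space (hist (int (Suc n)))) B = emeasure (distr Q past_space (hist (int (Suc n)))) B"
        using step[OF P] step[OF Q] Suc by simp
    qed simp
  qed
qed

lemma law_eq_mixture: "law g \<nu> = mixture \<nu>"
  unfolding law_def by (rule the_equality) (auto intro: is_law_mixture is_law_unique)

end

lemma return_in_prob_algebra: "return past_space x \<in> space (prob_algebra past_space)"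
  by (simp add: space_prob_algebra prob_space_return)

lemma law_at_eq: "law_at g x = distr (future x) (coord_algebra UNIV) (glue x)"
  unfolding law_at_def law_eq_mixture[OF return_in_prob_algebra] mixture_def
  by (rule bind_return[OF measurable_kernel_subprob]) simp

lemma sets_law_at [simp, measurable_cong]: "sets (law_at g x) = sets (coord_algebra UNIV)"
  by (simp add: law_at_eq)

lemma space_law_at [simp]: "space (law_at g x) = UNIV"
  by (simp add: law_at_eq)

lemma measure_law_at: "A \<in> sets (coord_algebra UNIV) \<Longrightarrow> measure (law_at g x) A = measure (future x) (glue x -` A)"
  unfolding law_at_eq by (subst measure_distr) auto

lemma measure_law_at_forward:
  assumes "B \<in> sets past_space"
  shows "measure (law_at g x) (forward n -` B) = measure (future x) (shift n -` B)"
proof -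
  have "forward n -` B \<in> sets (coord_algebra UNIV)"
    using assms sets_coord_algebra_future sets_coord_algebra_mono[of "{int n..}" UNIV] by blast
  then show ?thesis
    by (simp add: measure_law_at vimage_def)
qed

end

section \<open>Total variation between futures\<close>

text \<open>On a past, \<open>pre k\<close> is the window of the \<open>k\<close> most recent
  symbols. Agreement of windows is the topology in which continuity of \<open>g\<close> is
  expressed, and a common word appended to both pasts preserves it.\<close>

lemma pre_after_cong:
  assumes "pre k x = pre k y"
  shows "pre k (after u x) = pre k (after u y)"
proof -
  have "pre k (after u z) = take k (rev u @ pre k z)" for z :: "nat \<Rightarrow> 'a"
    by (rule nth_equalityI) (auto simp: after_def conc_def nth_pre nth_append)
  then show ?thesis
    using assms by simp
qed

lemma pre_conc_cong: "pre k x = pre k y \<Longrightarrow> pre k (conc u x) = pre k (conc u y)"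
  using pre_after_cong[of k x y "rev u"] by (simp add: after_rev)

text \<open>If no \<open>C n\<close> contained a subcylinder of \<open>cylinder v\<close>, every
  word could be lengthened so that its cylinder avoids a given \<open>C n\<close>; doing this for
  all \<open>n\<close> in turn spells out a point of \<open>cylinder v\<close> outside every
  \<open>C n\<close>.\<close>

lemma cylinder_baire:
  fixes C :: "nat \<Rightarrow> (nat \<Rightarrow> 'a) set"
  assumes closed: "\<And>n x. x \<notin> C n \<Longrightarrow> \<exists>k. \<forall>y. pre k y = pre k x \<longrightarrow> y \<notin> C n"
    and cover: "\<And>x. x \<in> cylinder v \<Longrightarrow> \<exists>n. x \<in> C n"
  shows "\<exists>n w. cylinder (v @ w) \<subseteq> C n"
proof (rule ccontr)
  assume neg: "\<not> ?thesis"
  have ex: "\<exists>w'. cylinder (v @ w @ w') \<inter> C n = {}" for n w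
  proof -
    obtain x where x: "x \<in> cylinder (v @ w)" "x \<notin> C n"
      using neg by blast
    obtain k where k: "\<forall>y. pre k y = pre k x \<longrightarrow> y \<notin> C n"
      using closed x by blast
    define m where "m = length (v @ w)"
    have "pre m x = v @ w"
      using x(1) by (simp add: mem_cylinder m_def)
    then have "v @ w @ pre k (shift m x) = pre (m + k) x"
      by (simp add: pre_add[of m k])
    moreover have "pre k y = pre k x" if "pre (m + k) y = pre (m + k) x" for y
      using arg_cong[OF that, of "take k"] by (simp add: take_pre)
    ultimately have "y \<notin> C n" if "y \<in> cylinder (v @ w @ pre k (shift m x))" for y
      using k that by (metis mem_cylinder length_pre)
    then have "cylinder (v @ w @ pre k (shift m x)) \<inter> C n = {}"
      by blast
    then show ?thesis ..
  qed
  \<comment> \<open>\<open>f n w\<close> is an extension of \<open>v @ w\<close> that avoids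
    \<open>C n\<close>, and \<open>W n\<close> collects the first \<open>n\<close>
    extensions.\<close>
  define f where "f n w = (SOME w'. cylinder (v @ w @ w') \<inter> C n = {})" for n w
  have f: "cylinder (v @ w @ f n w) \<inter> C n = {}" for n w
    unfolding f_def by (rule someI_ex[OF ex])
  define W where "W = rec_nat [] (\<lambda>n w. w @ f n w)"
  have W_Suc: "W (Suc n) = W n @ f n (W n)" and W_0: "W 0 = []" for n
    by (simp_all add: W_def)
  have W_prefix: "\<exists>t. W m = W n @ t" if "n \<le> m" for n m
    using that by (induction m rule: dec_induct) (auto simp: W_Suc)
  have W_nth: "(v @ W n) ! i = (v @ W m) ! i" if "i < length (v @ W n)" "i < length (v @ W m)" for n m i
  proof (cases "n \<le> m")
    case True
    then obtain t where "W m = W n @ t" using W_prefix by blast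
    then show ?thesis using that by (auto simp: nth_append)
  next
    case False
    then obtain t where "W n = W m @ t" using W_prefix[of m n] by auto
    then show ?thesis using that by (auto simp: nth_append)
  qed
  \<comment> \<open>Any sufficiently long \<open>W n\<close> gives the same coordinate by
    \<open>W_nth\<close>. Were the lengths bounded, the remaining coordinates would be arbitrary,
    which is harmless: only membership in the cylinders of the \<open>v @ W n\<close>
    matters.\<close>
  define z where "z i = (v @ W (SOME n. i < length (v @ W n))) ! i" for i
  have z: "z \<in> cylinder (v @ W n)" for n
  proof -
    have "z i = (v @ W n) ! i" if "i < length (v @ W n)" for i
      unfolding z_def using that by (intro W_nth someI[where P="\<lambda>n. i < length (v @ W n)"])
    then show ?thesis
      by (simp add: mem_cylinder list_eq_iff_nth_eq nth_pre)
  qed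
  have "z \<notin> C n" for n
    using z[of "Suc n"] f[of "W n" n] by (auto simp: W_Suc)
  then show False
    using cover[of z] z[of 0] by (simp add: W_0)
qed

locale regular_process = probability_kernel +
  assumes strongly_non_null: "strongly_non_null g"
    and continuous_kernel: "continuous_kernel g"
begin

section \<open>Positivity and continuity of word probabilities\<close>

definition \<delta> :: real where
  "\<delta> = (INF (a, x)\<in>UNIV. g (conc [a] x))"

lemma \<delta>_pos: "0 < \<delta>"
  using strongly_non_null by (simp add: \<delta>_def strongly_non_null_def)

lemma \<delta>_le: "\<delta> \<le> g x"
proof -
  have "x = conc [x 0] (shift 1 x)"
    using conc_pre_shift[of 1 x] by (simp add: pre_def)
  moreover have "(INF (a, x)\<in>UNIV. g (conc [a] x)) \<le> g (conc [x 0] (shift 1 x))"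
    by (rule cINF_lower2[where x="(x 0, shift 1 x)"]) (auto intro!: bdd_belowI[of _ 0])
  ultimately show ?thesis
    by (simp add: \<delta>_def)
qed

lemma g_pos [simp]: "0 < g x"
  using \<delta>_pos \<delta>_le order_less_le_trans by blast

lemma word_prob_pos [simp]: "0 < word_prob u x"
  by (induction u arbitrary: x) simp_all

lemma word_prob_ge: "\<delta> ^ length u \<le> word_prob u x"
  using \<delta>_pos \<delta>_le by (induction u arbitrary: x) (auto intro!: mult_mono)

lemma g_continuous:
  assumes "0 < e"
  shows "\<exists>k. \<forall>y. pre k y = pre k x \<longrightarrow> \<bar>g y - g x\<bar> < e"
proof -
  have "\<forall>\<^sub>F k in sequentially. var_rate g k < e"
    using continuous_kernel assms unfolding continuous_kernel_def by (rule order_tendstoD(2))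
  from eventually_happens'[OF sequentially_bot this] obtain k where k: "var_rate g k < e"
    by blast
  \<comment> \<open>\<open>var_rate g k\<close> fixes \<open>k\<close> symbols besides the newest
    one, hence a window of length \<open>Suc k\<close>.\<close>
  have "\<bar>g y - g x\<bar> < e" if "pre (Suc k) y = pre (Suc k) x" for y
  proof -
    obtain a w where aw: "pre (Suc k) x = a # w" "length w = k"
      by (metis length_Suc_conv length_pre)
    have "conc (a # w) (shift (Suc k) y) = y" "conc (a # w) (shift (Suc k) x) = x"
      using conc_pre_shift[of "Suc k" y] conc_pre_shift[of "Suc k" x] aw that by simp_all
    then have "\<bar>g y - g x\<bar> \<in> {\<bar>g (conc (a # w) x) - g (conc (a # w) y)\<bar> | a w x y. length w = k}"
      using aw(2) by (intro CollectI exI[of _ a] exI[of _ w] exI[of _ "shift (Suc k) y"] exI[of _ "shift (Suc k) x"]) simp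
    moreover have "\<bar>g x - g y\<bar> \<le> 1" for x y
      using g_nonneg[of x] g_le_1[of x] g_nonneg[of y] g_le_1[of y] by linarith
    then have "bdd_above {\<bar>g (conc (a # w) x) - g (conc (a # w) y)\<bar> | a w x y. length w = k}"
      by (intro bdd_aboveI[of _ 1]) auto
    ultimately have "\<bar>g y - g x\<bar> \<le> var_rate g k"
      unfolding var_rate_def by (rule cSup_upper)
    then show ?thesis
      using k by simp
  qed
  then show ?thesis by blast
qed

text \<open>A product of continuous factors bounded by 1. In the induction, agreement of windows
  survives the added letter by \<open>pre_conc_cong\<close>.\<close>

lemma word_prob_continuous:
  assumes "0 < e"
  shows "\<exists>k. \<forall>y. pre k y = pre k x \<longrightarrow> \<bar>word_prob u y - word_prob u x\<bar> < e"
  using assms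
proof (induction u arbitrary: x e)
  case Nil
  then show ?case by simp
next
  case (Cons a u)
  obtain k where k: "\<forall>y. pre k y = pre k (conc [a] x) \<longrightarrow> \<bar>g y - g (conc [a] x)\<bar> < e / 2"
    using g_continuous[OF half_gt_zero[OF Cons.prems], of "conc [a] x"] by (rule exE)
  obtain l where l: "\<forall>y. pre l y = pre l (conc [a] x) \<longrightarrow> \<bar>word_prob u y - word_prob u (conc [a] x)\<bar> < e / 2"
    using Cons.IH[OF half_gt_zero[OF Cons.prems], of "conc [a] x"] by (rule exE)
  have "\<bar>word_prob (a # u) y - word_prob (a # u) x\<bar> < e" if y: "pre (max k l) y = pre (max k l) x" for y
  proof -
    have *: "pre k y = pre k x" "pre l y = pre l x"
      using arg_cong[OF y, of "take k"] arg_cong[OF y, of "take l"] by (simp_all add: take_pre)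
    have kl: "\<bar>g (conc [a] y) - g (conc [a] x)\<bar> < e / 2"
      "\<bar>word_prob u (conc [a] y) - word_prob u (conc [a] x)\<bar> < e / 2"
      using k[rule_format, OF pre_conc_cong[OF *(1)]] l[rule_format, OF pre_conc_cong[OF *(2)]] .
    have "\<bar>word_prob (a # u) y - word_prob (a # u) x\<bar>
        = \<bar>g (conc [a] y) * (word_prob u (conc [a] y) - word_prob u (conc [a] x))
          + (g (conc [a] y) - g (conc [a] x)) * word_prob u (conc [a] x)\<bar>"
      by (rule arg_cong[where f=abs]) (simp add: algebra_simps)
    also have "\<dots> \<le> \<bar>g (conc [a] y) * (word_prob u (conc [a] y) - word_prob u (conc [a] x))\<bar>
        + \<bar>(g (conc [a] y) - g (conc [a] x)) * word_prob u (conc [a] x)\<bar>"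
      by (rule abs_triangle_ineq)
    also have "\<dots> \<le> \<bar>word_prob u (conc [a] y) - word_prob u (conc [a] x)\<bar> + \<bar>g (conc [a] y) - g (conc [a] x)\<bar>"
      unfolding abs_mult abs_of_nonneg[OF g_nonneg] abs_of_nonneg[OF word_prob_nonneg]
      by (intro add_mono mult_left_le_one_le mult_left_le) (simp_all add: word_prob_le_1)
    finally show ?thesis
      using kl by simp
  qed
  then show ?case by blast
qed

lemma measure_future_pre: "measure (future x) {\<omega>. pre m \<omega> \<in> W} = (\<Sum>u\<in>W \<inter> words m. word_prob u x)"
proof -
  have "measure (future x) {\<omega>. pre m \<omega> \<in> W} = (\<Sum>u\<in>W \<inter> words m. measure (future x) (cylinder u))"
    unfolding pre_vimage_eq using disjoint_cylinder
    by (intro future.finite_measure_finite_Union) (auto simp: disjoint_family_on_def)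
  then show ?thesis
    by (simp add: measure_future_cylinder)
qed

lemma measure_future_pre_continuous:
  assumes "0 < e"
  shows "\<exists>k. \<forall>y. pre k y = pre k x \<longrightarrow>
    \<bar>measure (future y) {\<omega>. pre m \<omega> \<in> W} - measure (future x) {\<omega>. pre m \<omega> \<in> W}\<bar> < e"
proof -
  \<comment> \<open>The added 1 keeps the divisor positive when no word is counted and makes the
    final bound strict.\<close>
  define c where "c = real (card (W \<inter> words m)) + 1"
  have "\<exists>k. \<forall>y. pre k y = pre k x \<longrightarrow> \<bar>word_prob u y - word_prob u x\<bar> < e / c" for u
    using assms by (intro word_prob_continuous) (simp add: c_def)
  then have "\<forall>u. \<exists>k. \<forall>y. pre k y = pre k x \<longrightarrow> \<bar>word_prob u y - word_prob u x\<bar> < e / c"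
    by blast
  from choice[OF this]
  obtain k where k: "\<And>u y. pre (k u) y = pre (k u) x \<Longrightarrow> \<bar>word_prob u y - word_prob u x\<bar> < e / c"
    by blast
  define K where "K = (\<Sum>u\<in>W \<inter> words m. k u)"
  have "\<bar>measure (future y) {\<omega>. pre m \<omega> \<in> W} - measure (future x) {\<omega>. pre m \<omega> \<in> W}\<bar> < e"
    if y: "pre K y = pre K x" for y
  proof -
    have "\<bar>word_prob u y - word_prob u x\<bar> \<le> e / c" if "u \<in> W \<inter> words m" for u
    proof -
      have "k u \<le> K"
        unfolding K_def using that by (intro member_le_sum) auto
      then have "pre (k u) y = pre (k u) x"
        using arg_cong[OF y, of "take (k u)"] by (simp add: take_pre)
      then show ?thesis
        using k less_imp_le by blast
    qed
    then have "\<bar>\<Sum>u\<in>W \<inter> words m. word_prob u y - word_prob u x\<bar> \<le> (\<Sum>u\<in>W \<inter> words m. e / c)"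
      by (intro order_trans[OF sum_abs] sum_mono) auto
    also have "\<dots> < e"
      using assms by (simp add: c_def field_simps)
    finally show ?thesis
      by (simp add: measure_future_pre sum_subtractf)
  qed
  then show ?thesis by blast
qed

lemma measure_future_cylinder_Int:
  assumes "A \<in> sets past_space"
  shows "measure (future x) (cylinder u \<inter> A) = word_prob u x * measure (future (after u x)) (conc u -` A)"
proof -
  have "conc u ` (conc u -` A) = cylinder u \<inter> A"
  proof (intro set_eqI iffI)
    fix \<omega> assume "\<omega> \<in> cylinder u \<inter> A"
    then show "\<omega> \<in> conc u ` (conc u -` A)"
      using conc_pre_shift[of "length u" \<omega>] by (intro image_eqI[of _ _ "shift (length u) \<omega>"]) (auto simp: mem_cylinder)
  qed (auto simp: mem_cylinder pre_conc)
  then show ?thesis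
    using future_markov[OF sets_vimage_past[OF measurable_conc assms], where u=u and x=x] by metis
qed

lemma measure_future_cylinder_shift:
  assumes "B \<in> sets past_space"
  shows "measure (future x) (cylinder u \<inter> shift (length u) -` B) = word_prob u x * measure (future (after u x)) B"
proof -
  have "conc u -` shift (length u) -` B = B"
    by (auto simp: shift_conc)
  then show ?thesis
    using measure_future_cylinder_Int[OF sets_vimage_past[OF measurable_shift assms], where u=u and x=x] by metis
qed

lemma measure_future_compl: "A \<in> sets past_space \<Longrightarrow> measure (future x) (UNIV - A) = 1 - measure (future x) A"
  using future.prob_compl[of A x] by simp

lemma emeasure_distr_shift:
  assumes "A \<in> sets past_space"
  shows "emeasure (distr (future x) past_space (shift n)) A = emeasure (future x) (shift n -` A)"
proof -
  have "shift n \<in> measurable (future x) past_space"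
    using measurable_shift by (simp add: measurable_cong_sets[OF sets_future refl])
  then show ?thesis
    using assms by (simp add: emeasure_distr)
qed

text \<open>The inequality is one-sided, but complements reverse it (\<open>close_sym\<close>); so
  this says that the total variation distance on the coordinates from \<open>n\<close> on is at most
  \<open>c\<close>.\<close>

definition close :: "nat \<Rightarrow> real \<Rightarrow> (nat \<Rightarrow> 'a) \<Rightarrow> (nat \<Rightarrow> 'a) \<Rightarrow> bool" where
  "close n c x y \<longleftrightarrow> (\<forall>B\<in>sets past_space. measure (future x) (shift n -` B) \<le> measure (future y) (shift n -` B) + c)"

definition singular :: "(nat \<Rightarrow> 'a) \<Rightarrow> (nat \<Rightarrow> 'a) \<Rightarrow> bool" where
  "singular x y \<longleftrightarrow> (\<exists>D\<in>sets past_space. measure (future x) D = 0 \<and> measure (future y) (UNIV - D) = 0)"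

lemma close_sym: "close n c x y \<Longrightarrow> close n c y x"
  unfolding close_def
proof
  fix B :: "(nat \<Rightarrow> 'a) set"
  assume *: "\<forall>B\<in>sets past_space. measure (future x) (shift n -` B) \<le> measure (future y) (shift n -` B) + c"
    and B: "B \<in> sets past_space"
  then have "UNIV - B \<in> sets past_space"
    using sets.compl_sets[OF B] by simp
  then have "measure (future x) (shift n -` (UNIV - B)) \<le> measure (future y) (shift n -` (UNIV - B)) + c"
    using * by blast
  then show "measure (future y) (shift n -` B) \<le> measure (future x) (shift n -` B) + c"
    using sets_vimage_past[OF measurable_shift B] by (simp add: vimage_Diff measure_future_compl)
qed

lemma close_trans: "close n c x y \<Longrightarrow> close n d y z \<Longrightarrow> close n (c + d) x z"
  unfolding close_def by force

lemma singular_sym: "singular x y \<Longrightarrow> singular y x"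
  unfolding singular_def
proof (elim bexE conjE)
  fix D :: "(nat \<Rightarrow> 'a) set" assume D: "D \<in> sets past_space" "measure (future x) D = 0" "measure (future y) (UNIV - D) = 0"
  then show "\<exists>D\<in>sets past_space. measure (future y) D = 0 \<and> measure (future x) (UNIV - D) = 0"
    using sets.compl_sets[OF D(1)] by (intro bexI[of _ "UNIV - D"]) (auto simp: Diff_Diff_Int)
qed

lemma not_singular_self: "\<not> singular x x"
  by (auto simp: singular_def measure_future_compl)

text \<open>Failure of closeness is witnessed by one event with a strict gap. Replacing it by a
  nearby cylinder event keeps a gap, and the probability of that event is continuous in the
  past.\<close>

lemma closed_close:
  assumes "\<not> close n c x y"
  shows "\<exists>k. \<forall>x'. pre k x' = pre k x \<longrightarrow> \<not> close n c x' y"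
proof -
  obtain B where B: "B \<in> sets past_space"
    and less: "measure (future y) (shift n -` B) + c < measure (future x) (shift n -` B)"
    using assms by (auto simp: close_def not_le)
  \<comment> \<open>A quarter of the gap: three errors of size \<open>e\<close> occur, one for
    replacing the event under each of the two futures and one for moving from \<open>x\<close> to
    \<open>x'\<close>.\<close>
  define e where "e = (measure (future x) (shift n -` B) - measure (future y) (shift n -` B) - c) / 4"
  have e: "0 < e"
    using less by (simp add: e_def)
  \<comment> \<open>With the sum of both shifted futures, a single cylinder event approximates
    \<open>B\<close> for \<open>x\<close> and \<open>y\<close> at once.\<close>
  define M where "M = measure_sum past_space (\<lambda>b. distr (future (if b then x else y)) past_space (shift n))"
  have M: "emeasure M A = emeasure (future x) (shift n -` A) + emeasure (future y) (shift n -` A)"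
    if "A \<in> sets past_space" for A
    unfolding M_def using that
    by (subst emeasure_measure_sum)
       (auto simp: nn_integral_count_space_finite UNIV_bool emeasure_distr_shift add.commute)
  have sets_M: "sets M = sets past_space"
    by (simp add: M_def)
  have "finite_measure M"
  proof (rule finite_measureI)
    show "emeasure M (space M) \<noteq> \<infinity>"
      using M[of UNIV] sets.top[of "past_space :: (nat \<Rightarrow> 'a) measure"] sets_eq_imp_space_eq[OF sets_M] by simp
  qed
  then obtain N W where NW: "measure M (sym_diff B {\<omega>. pre N \<omega> \<in> W}) < e"
    using cylinder_approx_ex[OF _ sets_M B e] by blast
  let ?C = "{\<omega>. pre N \<omega> \<in> W}"
  have C[measurable]: "?C \<in> sets past_space" by simp
  have sd: "sym_diff B ?C \<in> sets past_space"
    using B by auto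
  interpret M: finite_measure M by fact
  have diff: "\<bar>measure (future z) (shift n -` B) - measure (future z) (shift n -` ?C)\<bar> < e" if "z = x \<or> z = y" for z
  proof -
    have "measure M (sym_diff B ?C) = measure (future x) (shift n -` sym_diff B ?C) + measure (future y) (shift n -` sym_diff B ?C)"
      using M[OF sd] by (simp add: M.emeasure_eq_measure future.emeasure_eq_measure flip: ennreal_plus)
    then have z: "measure (future z) (shift n -` sym_diff B ?C) < e"
      using NW that measure_nonneg[of "future x" "shift n -` sym_diff B ?C"]
        measure_nonneg[of "future y" "shift n -` sym_diff B ?C"] by (elim disjE) (simp_all del: measure_nonneg)
    have sets: "shift n -` A \<in> sets past_space" if "A \<in> sets past_space" for A
      using that by (rule sets_vimage_past[OF measurable_shift])
    have "measure (future z) A \<le> measure (future z) A' + measure (future z) (sym_diff A A')"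
      if "A \<in> sets past_space" "A' \<in> sets past_space" for A A'
    proof -
      have "measure (future z) A \<le> measure (future z) (A' \<union> sym_diff A A')"
        using that by (intro future.finite_measure_mono) auto
      also have "\<dots> \<le> measure (future z) A' + measure (future z) (sym_diff A A')"
        using that by (intro measure_Un_le) auto
      finally show ?thesis .
    qed
    from this[OF sets[OF B] sets[OF C]] this[OF sets[OF C] sets[OF B]] z show ?thesis
      by (simp add: vimage_Un vimage_Diff Un_commute)
  qed
  have shC: "shift n -` ?C = {\<omega>. pre (n + N) \<omega> \<in> {u. drop n u \<in> W}}"
    by (simp add: vimage_def pre_add)
  obtain k where k: "\<And>x'. pre k x' = pre k x \<Longrightarrow> \<bar>measure (future x') (shift n -` ?C) - measure (future x) (shift n -` ?C)\<bar> < e"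
    using measure_future_pre_continuous[OF e, of x "n + N"] unfolding shC by blast
  have "\<not> close n c x' y" if "pre k x' = pre k x" for x'
  proof -
    have "measure (future y) (shift n -` ?C) + c < measure (future x') (shift n -` ?C)"
      using k[OF that] diff[of x] diff[of y] unfolding e_def abs_less_iff by simp
    moreover have "measure (future x') (shift n -` ?C) \<le> measure (future y) (shift n -` ?C) + c" if "close n c x' y"
      using that C unfolding close_def by (rule bspec)
    ultimately show ?thesis
      by linarith
  qed
  then show ?thesis by blast
qed

end

section \<open>Uniform overlap of the futures\<close>

context regular_process
begin

lemma word_prob_neq_0 [simp]: "word_prob u x \<noteq> 0"
  using word_prob_pos[of u x] by linarith

definition overlap :: bool where
  "overlap \<longleftrightarrow> (\<exists>\<kappa>>0. \<forall>x y. close 0 (1 - \<kappa>) x y)"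

lemma close_0D: "close 0 c x y \<Longrightarrow> B \<in> sets past_space \<Longrightarrow> measure (future x) B \<le> measure (future y) B + c"
  unfolding close_def by (drule (1) bspec) (simp add: vimage_def)

text \<open>A common dominating measure: both futures have densities with respect to it, and an
  approximation in it holds for both.\<close>

definition pair_sum :: "(nat \<Rightarrow> 'a) \<Rightarrow> (nat \<Rightarrow> 'a) \<Rightarrow> (nat \<Rightarrow> 'a) measure" where
  "pair_sum x y = measure_sum past_space (\<lambda>b. future (if b then x else y))"

lemma sets_pair_sum [simp, measurable_cong]: "sets (pair_sum x y) = sets past_space"
  by (simp add: pair_sum_def)

lemma space_pair_sum [simp]: "space (pair_sum x y) = UNIV"
  using sets_eq_imp_space_eq[OF sets_pair_sum] by simp

lemma emeasure_pair_sum: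
  "A \<in> sets past_space \<Longrightarrow> emeasure (pair_sum x y) A = emeasure (future x) A + emeasure (future y) A"
  unfolding pair_sum_def
  by (subst emeasure_measure_sum) (auto simp: nn_integral_count_space_finite UNIV_bool add.commute)

lemma finite_measure_pair_sum: "finite_measure (pair_sum x y)"
proof (rule finite_measureI)
  show "emeasure (pair_sum x y) (space (pair_sum x y)) \<noteq> \<infinity>"
    using emeasure_pair_sum[of UNIV] sets.top[of "past_space :: (nat \<Rightarrow> 'a) measure"] by simp
qed

sublocale pair_sum: finite_measure "pair_sum x y" for x y
  by (rule finite_measure_pair_sum)

lemma measure_pair_sum:
  "A \<in> sets past_space \<Longrightarrow> measure (pair_sum x y) A = measure (future x) A + measure (future y) A"
  using emeasure_pair_sum[of A x y]
  by (simp add: pair_sum.emeasure_eq_measure future.emeasure_eq_measure flip: ennreal_plus)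

section \<open>Densities with respect to the sum of two futures\<close>

lemma density_pair_sum:
  assumes z: "z = x \<or> z = y"
  obtains f where "f \<in> borel_measurable past_space" "\<And>\<omega>. 0 \<le> f \<omega>"
    "\<And>A. A \<in> sets past_space \<Longrightarrow> emeasure (future z) A = (\<integral>\<^sup>+\<omega>. ennreal (f \<omega>) * indicator A \<omega> \<partial>pair_sum x y)"
proof -
  let ?\<rho> = "pair_sum x y"
  have ac: "absolutely_continuous ?\<rho> (future z)"
    using z by (auto simp: absolutely_continuous_def null_sets_def emeasure_pair_sum)
  obtain f where f: "f \<in> borel_measurable ?\<rho>" "AE \<omega> in ?\<rho>. RN_deriv ?\<rho> (future z) \<omega> = ennreal (f \<omega>)"
    "AE \<omega> in future z. 0 < f \<omega>" "\<And>\<omega>. 0 \<le> f \<omega>"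
    using pair_sum.real_RN_deriv[OF _ ac] future.finite_measure_axioms by auto
  have "future z = density ?\<rho> (RN_deriv ?\<rho> (future z))"
    using pair_sum.density_RN_deriv[OF ac] by simp
  also have "\<dots> = density ?\<rho> (\<lambda>\<omega>. ennreal (f \<omega>))"
    using f by (intro density_cong) auto
  finally have "emeasure (future z) A = (\<integral>\<^sup>+\<omega>. ennreal (f \<omega>) * indicator A \<omega> \<partial>?\<rho>)" if "A \<in> sets past_space" for A
    using that f(1) emeasure_density[of "\<lambda>\<omega>. ennreal (f \<omega>)" ?\<rho> A] by simp
  moreover have "f \<in> borel_measurable past_space"
    using f(1) by (simp add: measurable_cong_sets[OF sets_pair_sum refl])
  ultimately show thesis
    using that[of f] f(4) by blast
qed

lemma density_sandwich:
  assumes f: "f \<in> borel_measurable past_space" "\<And>\<omega>. 0 \<le> f \<omega>"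
    and dens: "\<And>A. A \<in> sets past_space \<Longrightarrow> emeasure (future z) A = (\<integral>\<^sup>+\<omega>. ennreal (f \<omega>) * indicator A \<omega> \<partial>pair_sum x y)"
    and A: "A \<in> sets past_space" and cd: "0 \<le> c" "0 \<le> d" "\<And>\<omega>. \<omega> \<in> A \<Longrightarrow> c \<le> f \<omega> \<and> f \<omega> \<le> d"
  shows "c * measure (pair_sum x y) A \<le> measure (future z) A"
    and "measure (future z) A \<le> d * measure (pair_sum x y) A"
proof -
  have "ennreal c * emeasure (pair_sum x y) A = (\<integral>\<^sup>+\<omega>. ennreal c * indicator A \<omega> \<partial>pair_sum x y)"
    using A by (simp add: nn_integral_cmult_indicator)
  also have "\<dots> \<le> emeasure (future z) A"
    unfolding dens[OF A] using cd by (intro nn_integral_mono) (auto split: split_indicator intro!: ennreal_leI)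
  finally show "c * measure (pair_sum x y) A \<le> measure (future z) A"
    using cd by (simp add: pair_sum.emeasure_eq_measure future.emeasure_eq_measure flip: ennreal_mult)
  have "emeasure (future z) A \<le> (\<integral>\<^sup>+\<omega>. ennreal d * indicator A \<omega> \<partial>pair_sum x y)"
    unfolding dens[OF A] using cd by (intro nn_integral_mono) (auto split: split_indicator intro!: ennreal_leI)
  also have "\<dots> = ennreal d * emeasure (pair_sum x y) A"
    using A by (simp add: nn_integral_cmult_indicator)
  finally show "measure (future z) A \<le> d * measure (pair_sum x y) A"
    using cd by (simp add: pair_sum.emeasure_eq_measure future.emeasure_eq_measure flip: ennreal_mult)
qed

text \<open>On a set where the densities \<open>f\<close> and \<open>h\<close> of the two futures with respect to their sum are
  both nearly constant, the conditioned measures nearly agree. A cylinder on which this set is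
  nearly full provides the word.\<close>

lemma nonsingular_close:
  assumes nons: "\<not> singular x y" and \<alpha>: "0 < \<alpha>"
  shows "\<exists>u. close 0 \<alpha> (after u x) (after u y)"
proof -
  let ?\<rho> = "pair_sum x y"
  obtain f where f[measurable]: "f \<in> borel_measurable past_space" and f0: "\<And>\<omega>. 0 \<le> f \<omega>"
    and f_dens: "\<And>A. A \<in> sets past_space \<Longrightarrow> emeasure (future x) A = (\<integral>\<^sup>+\<omega>. ennreal (f \<omega>) * indicator A \<omega> \<partial>?\<rho>)"
    using density_pair_sum[of x x y] by auto
  obtain h where h[measurable]: "h \<in> borel_measurable past_space" and h0: "\<And>\<omega>. 0 \<le> h \<omega>"
    and h_dens: "\<And>A. A \<in> sets past_space \<Longrightarrow> emeasure (future y) A = (\<integral>\<^sup>+\<omega>. ennreal (h \<omega>) * indicator A \<omega> \<partial>?\<rho>)"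
    using density_pair_sum[of y x y] by auto
  \<comment> \<open>The relative spread \<open>1 + \<eta>\<close> costs at most
    \<open>(1 + \<eta>) - 1 / (1 + \<eta>) \<le> 2 * \<eta>\<close>, a quarter of
    \<open>\<alpha>\<close>, which leaves room for the errors in \<open>e\<close>.\<close>
  define \<eta> where "\<eta> = \<alpha> / 8"
  have \<eta>: "0 < \<eta>" using \<alpha> by (simp add: \<eta>_def)
  define S where "S c d = {\<omega>. c < f \<omega> \<and> f \<omega> < (1 + \<eta>) * c \<and> d < h \<omega> \<and> h \<omega> < (1 + \<eta>) * d}" for c d
  have S_sets[measurable]: "S c d \<in> sets past_space" for c d
  proof -
    have "{\<omega> \<in> space past_space. c < f \<omega> \<and> f \<omega> < (1 + \<eta>) * c \<and> d < h \<omega> \<and> h \<omega> < (1 + \<eta>) * d} \<in> sets past_space"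
      by measurable
    then show ?thesis by (simp add: S_def)
  qed
  let ?Q = "\<rat> \<inter> {0<..} :: real set"
  have rat: "\<exists>c\<in>?Q. c < t \<and> t < (1 + \<eta>) * c" if "0 < t" for t
  proof -
    have "t / (1 + \<eta>) < t"
      using that \<eta> by (simp add: field_simps)
    then obtain c where c: "c \<in> \<rat>" "t / (1 + \<eta>) < c" "c < t"
      using Rats_dense_in_real by blast
    moreover have "0 < t / (1 + \<eta>)"
      using that \<eta> by simp
    ultimately have "c \<in> ?Q"
      by auto
    moreover have "t < (1 + \<eta>) * c"
      using c(2) \<eta> by (simp add: field_simps)
    ultimately show ?thesis
      using c(3) by blast
  qed
  \<comment> \<open>The countably many boxes with rational corners cover the set where both
    densities are positive. If all were null, the zero set of \<open>f\<close> would separate the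
    two futures.\<close>
  have "\<exists>c\<in>?Q. \<exists>d\<in>?Q. 0 < measure ?\<rho> (S c d)"
  proof (rule ccontr)
    assume "\<not> ?thesis"
    then have zero: "measure ?\<rho> (S c d) = 0" if "c \<in> ?Q" "d \<in> ?Q" for c d
      using that by (metis measure_nonneg order_le_less)
    have "(\<Union>p\<in>?Q \<times> ?Q. S (fst p) (snd p)) \<in> null_sets ?\<rho>"
    proof (rule null_sets_UN')
      show "countable (?Q \<times> ?Q)"
        by (intro countable_SIGMA countable_Int1 countable_rat)
      show "S (fst p) (snd p) \<in> null_sets ?\<rho>" if "p \<in> ?Q \<times> ?Q" for p
        using zero[of "fst p" "snd p"] that by (auto simp: null_sets_def pair_sum.emeasure_eq_measure)
    qed
    moreover have "(\<Union>p\<in>?Q \<times> ?Q. S (fst p) (snd p)) = {\<omega>. 0 < f \<omega> \<and> 0 < h \<omega>}"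
    proof (intro set_eqI iffI)
      fix \<omega> assume "\<omega> \<in> {\<omega>. 0 < f \<omega> \<and> 0 < h \<omega>}"
      then obtain c d where "c \<in> ?Q" "d \<in> ?Q" "\<omega> \<in> S c d"
        using rat[of "f \<omega>"] rat[of "h \<omega>"] unfolding S_def by blast
      then show "\<omega> \<in> (\<Union>p\<in>?Q \<times> ?Q. S (fst p) (snd p))"
        by force
    qed (auto simp: S_def)
    ultimately have null: "{\<omega>. 0 < f \<omega> \<and> 0 < h \<omega>} \<in> null_sets ?\<rho>"
      by simp
    have D: "{\<omega>. f \<omega> = 0} \<in> sets past_space"
    proof -
      have "{\<omega> \<in> space past_space. f \<omega> = 0} \<in> sets past_space" by measurable
      then show ?thesis by simp
    qed
    have "emeasure (future x) {\<omega>. f \<omega> = 0} = 0"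
      unfolding f_dens[OF D] by (intro nn_integral_zero') (auto split: split_indicator)
    moreover have "emeasure (future y) (UNIV - {\<omega>. f \<omega> = 0}) = 0"
    proof -
      have D': "UNIV - {\<omega>. f \<omega> = 0} \<in> sets past_space"
        using sets.compl_sets[OF D] by simp
      have "AE \<omega> in ?\<rho>. ennreal (h \<omega>) * indicator (UNIV - {\<omega>. f \<omega> = 0}) \<omega> = 0"
      proof (rule AE_I'[OF null])
        show "{\<omega> \<in> space ?\<rho>. ennreal (h \<omega>) * indicator (UNIV - {\<omega>. f \<omega> = 0}) \<omega> \<noteq> 0} \<subseteq> {\<omega>. 0 < f \<omega> \<and> 0 < h \<omega>}"
        proof
          fix \<omega> assume "\<omega> \<in> {\<omega> \<in> space ?\<rho>. ennreal (h \<omega>) * indicator (UNIV - {\<omega>. f \<omega> = 0}) \<omega> \<noteq> 0}"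
          then have "f \<omega> \<noteq> 0" "h \<omega> \<noteq> 0"
            by (auto split: split_indicator_asm)
          then show "\<omega> \<in> {\<omega>. 0 < f \<omega> \<and> 0 < h \<omega>}"
            using f0[of \<omega>] h0[of \<omega>] by simp
        qed
      qed
      then show ?thesis
        unfolding h_dens[OF D'] by (rule nn_integral_zero')
    qed
    ultimately have "singular x y"
      unfolding singular_def using D by (intro bexI[of _ "{\<omega>. f \<omega> = 0}"]) (auto simp: measure_def)
    then show False
      using nons by simp
  qed
  then obtain c d where cd: "0 < c" "0 < d" and S_pos: "0 < measure ?\<rho> (S c d)"
    by auto
  \<comment> \<open>Both error terms of the final estimate are continuous in \<open>e\<close>: the
    first compares the conditioned masses inside the box, the second bounds the part of the event
    outside it. Their limits at 0 are small enough.\<close>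
  have "\<exists>e. 0 < e \<and> e < 1 \<and> (1 + \<eta>) / (1 - e) - 1 / (1 + \<eta> + e / d) < \<alpha> / 2
      \<and> e / (c * (1 - e)) < \<alpha> / 2"
  proof -
    have "((\<lambda>e. (1 + \<eta>) / (1 - e) - 1 / (1 + \<eta> + e / d)) \<longlongrightarrow> (1 + \<eta>) / (1 - 0) - 1 / (1 + \<eta> + 0 / d)) (at_right 0)"
      using cd \<eta> by (intro tendsto_intros) auto
    moreover have "1 / (1 + \<eta>) \<ge> 1 - \<eta>"
      using \<eta> by (simp add: field_simps)
    then have "(1 + \<eta>) / (1 - 0) - 1 / (1 + \<eta> + 0 / d) < \<alpha> / 2"
      using \<alpha> by (simp add: \<eta>_def)
    ultimately have "\<forall>\<^sub>F e in at_right 0. (1 + \<eta>) / (1 - e) - 1 / (1 + \<eta> + e / d) < \<alpha> / 2"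
      by (rule order_tendstoD(2))
    moreover have "((\<lambda>e. e / (c * (1 - e))) \<longlongrightarrow> 0 / (c * (1 - 0))) (at_right 0)"
      using cd by (intro tendsto_intros) auto
    then have "\<forall>\<^sub>F e in at_right 0. e / (c * (1 - e)) < \<alpha> / 2"
      by (rule order_tendstoD(2)) (use \<alpha> in simp)
    moreover have "\<forall>\<^sub>F e in at_right 0. e \<in> {0<..<1::real}"
      by (rule eventually_at_right_real) simp
    ultimately have "\<forall>\<^sub>F e in at_right 0. 0 < e \<and> e < 1 \<and> (1 + \<eta>) / (1 - e) - 1 / (1 + \<eta> + e / d) < \<alpha> / 2
      \<and> e / (c * (1 - e)) < \<alpha> / 2"
      by eventually_elim simp
    then show ?thesis
      by (rule eventually_happens'[rotated]) simp
  qed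
  then obtain e where e: "0 < e" "e < 1" and e1: "(1 + \<eta>) / (1 - e) - 1 / (1 + \<eta> + e / d) < \<alpha> / 2"
    and e2: "e / (c * (1 - e)) < \<alpha> / 2"
    by blast
  obtain u where u: "measure ?\<rho> (cylinder u - S c d) \<le> e * measure ?\<rho> (cylinder u)" "0 < measure ?\<rho> (cylinder u)"
    using cylinder_density[OF finite_measure_pair_sum sets_pair_sum S_sets S_pos e(1)] by blast
  define r where "r = measure ?\<rho> (cylinder u)"
  have r: "0 < r" using u by (simp add: r_def)
  have sandwich: "c * measure ?\<rho> A \<le> measure (future x) A" "measure (future x) A \<le> (1 + \<eta>) * c * measure ?\<rho> A"
    "d * measure ?\<rho> A \<le> measure (future y) A" "measure (future y) A \<le> (1 + \<eta>) * d * measure ?\<rho> A"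
    if "A \<in> sets past_space" "A \<subseteq> S c d" for A
    using density_sandwich[OF f f0 f_dens that(1), of c "(1 + \<eta>) * c"]
      density_sandwich[OF h h0 h_dens that(1), of d "(1 + \<eta>) * d"] that(2) cd \<eta>
    by (auto simp: S_def subset_iff less_imp_le)
  have rest: "measure (future z) (A - S c d) \<le> e * r" if "z = x \<or> z = y" "A \<subseteq> cylinder u" "A \<in> sets past_space" for z A
  proof -
    have "measure (future z) (A - S c d) \<le> measure (future z) (cylinder u - S c d)"
      using that by (intro future.finite_measure_mono) auto
    also have "\<dots> \<le> measure ?\<rho> (cylinder u - S c d)"
      using that(1) by (auto simp: measure_pair_sum)
    finally show ?thesis
      using u by (simp add: r_def)
  qed
  have split: "measure (future z) A = measure (future z) (A \<inter> S c d) + measure (future z) (A - S c d)"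
    if "A \<in> sets past_space" for z A
    using that by (subst future.finite_measure_Union[symmetric]) (auto intro!: arg_cong[where f="measure (future z)"])
  have r_split: "(1 - e) * r \<le> measure ?\<rho> (cylinder u \<inter> S c d)"
    using pair_sum.finite_measure_Diff'[of "cylinder u" x y "S c d"] u by (simp add: r_def algebra_simps)
  have p_ge: "c * ((1 - e) * r) \<le> word_prob u x"
  proof -
    have "c * ((1 - e) * r) \<le> c * measure ?\<rho> (cylinder u \<inter> S c d)"
      using r_split cd by (intro mult_left_mono) auto
    also have "\<dots> \<le> measure (future x) (cylinder u \<inter> S c d)"
      by (rule sandwich(1)) auto
    also have "\<dots> \<le> measure (future x) (cylinder u)"
      by (intro future.finite_measure_mono) auto
    finally show ?thesis
      by (simp add: measure_future_cylinder)
  qed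
  have q_le: "word_prob u y \<le> ((1 + \<eta>) * d + e) * r"
  proof -
    have "measure ?\<rho> (cylinder u \<inter> S c d) \<le> r"
      unfolding r_def by (intro pair_sum.finite_measure_mono) auto
    then have "(1 + \<eta>) * d * measure ?\<rho> (cylinder u \<inter> S c d) \<le> (1 + \<eta>) * d * r"
      using cd \<eta> by (intro mult_left_mono) auto
    then show ?thesis
      using sandwich(4)[of "cylinder u \<inter> S c d"] rest[of y "cylinder u"] split[of "cylinder u" y]
      by (simp add: measure_future_cylinder algebra_simps)
  qed
  have "close 0 \<alpha> (after u x) (after u y)"
    unfolding close_def
  proof
    fix B :: "(nat \<Rightarrow> 'a) set" assume B: "B \<in> sets past_space"
    define A where "A = cylinder u \<inter> shift (length u) -` B"
    have A[measurable]: "A \<in> sets past_space" and A_sub: "A \<subseteq> cylinder u"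
      using B by (auto simp: A_def intro!: sets.Int sets_vimage_past)
    \<comment> \<open>The share of the cylinder, in the dominating measure, that is taken by
      \<open>A\<close> inside the box. Both conditioned probabilities are compared with this one
      number, so the unknown levels \<open>c\<close> and \<open>d\<close> cancel up to the errors in
      \<open>e\<close>.\<close>
    define \<tau> where "\<tau> = measure ?\<rho> (A \<inter> S c d) / r"
    have "measure ?\<rho> (A \<inter> S c d) \<le> r"
      unfolding r_def using A_sub by (intro pair_sum.finite_measure_mono) auto
    then have \<tau>: "0 \<le> \<tau>" "\<tau> \<le> 1" "measure ?\<rho> (A \<inter> S c d) = \<tau> * r"
      using r by (simp_all add: \<tau>_def)
    have a_le: "measure (future x) A \<le> ((1 + \<eta>) * c * \<tau> + e) * r"
      using sandwich(2)[of "A \<inter> S c d"] rest[of x A] A_sub split[of A x] by (simp add: \<tau>(3) algebra_simps)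
    have b_ge: "d * \<tau> * r \<le> measure (future y) A"
    proof -
      have "d * \<tau> * r = d * measure ?\<rho> (A \<inter> S c d)"
        by (simp add: \<tau>(3))
      also have "\<dots> \<le> measure (future y) (A \<inter> S c d)"
        by (rule sandwich(3)) auto
      also have "\<dots> \<le> measure (future y) A"
        by (intro future.finite_measure_mono) auto
      finally show ?thesis .
    qed
    have "measure (future (after u x)) B = measure (future x) A / word_prob u x"
      using measure_future_cylinder_shift[OF B, of x u] word_prob_pos[of u x] by (simp add: A_def)
    also have "\<dots> \<le> ((1 + \<eta>) * c * \<tau> + e) * r / (c * ((1 - e) * r))"
      using a_le p_ge cd e r \<tau>(1) \<eta> by (intro frac_le) auto
    also have "\<dots> = (1 + \<eta>) / (1 - e) * \<tau> + e / (c * (1 - e))"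
    proof -
      have "((1 + \<eta>) * c * \<tau> + e) * r / (c * (t * r)) = (1 + \<eta>) / t * \<tau> + e / (c * t)" if "0 < t" for t
        using cd r that by (simp add: field_simps)
      then show ?thesis using e by simp
    qed
    finally have x_le: "measure (future (after u x)) B \<le> (1 + \<eta>) / (1 - e) * \<tau> + e / (c * (1 - e))" .
    have "1 / (1 + \<eta> + e / d) * \<tau> = d * \<tau> * r / (((1 + \<eta>) * d + e) * r)"
    proof -
      have "(1 + \<eta>) * d + e = d * (1 + \<eta> + e / d)"
        using cd by (simp add: field_simps)
      then show ?thesis using cd r by simp
    qed
    also have "\<dots> \<le> measure (future y) A / word_prob u y"
      using b_ge q_le word_prob_pos[of u y] by (intro frac_le) auto
    also have "\<dots> = measure (future (after u y)) B"
      using measure_future_cylinder_shift[OF B, of y u] word_prob_pos[of u y] by (simp add: A_def)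
    finally have y_ge: "1 / (1 + \<eta> + e / d) * \<tau> \<le> measure (future (after u y)) B" .
    have "((1 + \<eta>) / (1 - e) - 1 / (1 + \<eta> + e / d)) * \<tau> \<le> \<alpha> / 2 * \<tau>"
      using e1 \<tau> by (intro mult_right_mono) auto
    also have "\<dots> \<le> \<alpha> / 2"
      using \<tau> \<alpha> by (simp add: mult_left_le)
    finally have "(1 + \<eta>) / (1 - e) * \<tau> - 1 / (1 + \<eta> + e / d) * \<tau> \<le> \<alpha> / 2"
      by (simp add: left_diff_distrib)
    then have "measure (future (after u x)) B \<le> measure (future (after u y)) B + \<alpha>"
      using x_le y_ge e2 by linarith
    then show "measure (future (after u x)) (shift 0 -` B) \<le> measure (future (after u y)) (shift 0 -` B) + \<alpha>"
      by (simp add: vimage_def)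
  qed
  then show ?thesis ..
qed

lemma closed_close_after:
  assumes "\<not> close n c (after u x) y"
  shows "\<exists>k. \<forall>x'. pre k x' = pre k x \<longrightarrow> \<not> close n c (after u x') y"
proof -
  obtain k where "\<forall>x'. pre k x' = pre k (after u x) \<longrightarrow> \<not> close n c x' y"
    using closed_close[OF assms] by blast
  then show ?thesis
    using pre_after_cong[of k _ x u] by metis
qed

text \<open>By Baire's theorem and the triangle inequality, all pasts that begin with one fixed word have
  nearly the same future. Strong non-nullness lets every process enter this word.\<close>

lemma overlapI:
  fixes z :: "nat \<Rightarrow> nat \<Rightarrow> 'a"
  assumes "\<And>x. x \<in> cylinder v \<Longrightarrow> \<exists>i. \<not> singular x (z i)"
  shows overlap
proof -
  \<comment> \<open>One natural number codes the index \<open>i\<close> of a reference past together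
    with the word after which closeness is required.\<close>
  define C where "C n = (case prod_decode n of (i, l) \<Rightarrow>
    let u = from_nat l in {x. close 0 (1 / 4) (after u x) (after u (z i))})" for n
  have "\<exists>n w. cylinder (v @ w) \<subseteq> C n"
  proof (rule cylinder_baire)
    show "\<exists>k. \<forall>y. pre k y = pre k x \<longrightarrow> y \<notin> C n" if "x \<notin> C n" for n x
      using that closed_close_after unfolding C_def by (auto simp: Let_def split: prod.splits)
    show "\<exists>n. x \<in> C n" if x: "x \<in> cylinder v" for x
    proof -
      obtain i where "\<not> singular x (z i)"
        using assms x by blast
      then obtain u where "close 0 (1 / 4) (after u x) (after u (z i))"
        using nonsingular_close[of x "z i" "1 / 4"] by auto
      then show ?thesis
        by (intro exI[of _ "prod_encode (i, to_nat u)"]) (simp add: C_def Let_def)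
    qed
  qed
  then obtain n w where nw: "cylinder (v @ w) \<subseteq> C n"
    by blast
  obtain i l where "prod_decode n = (i, l)"
    by fastforce
  then have C_n: "x \<in> C n \<Longrightarrow> close 0 (1 / 4) (after (from_nat l) x) (after (from_nat l) (z i))" for x
    by (simp add: C_def Let_def)
  \<comment> \<open>Cylinders of pasts list the newest symbol first, whereas \<open>after\<close>
    reads chronologically, hence the reversal. The word first brings any past into the cylinder
    found by Baire's theorem and then appends the word coded by \<open>l\<close>.\<close>
  define U where "U = rev (v @ w) @ (from_nat l :: 'a list)"
  have U: "close 0 (1 / 2) (after U x) (after U y)" for x y
  proof -
    have "after U t = after (from_nat l) (conc (v @ w) t)" for t
      unfolding U_def after_append after_rev ..
    moreover have "conc (v @ w) t \<in> cylinder (v @ w)" for t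
      using pre_conc[of "v @ w"] by (simp add: mem_cylinder)
    ultimately have "close 0 (1 / 4) (after U t) (after (from_nat l) (z i))" for t
      using nw C_n by auto
    from close_trans[OF this close_sym[OF this]] show ?thesis
      by simp
  qed
  \<comment> \<open>Every past produces \<open>U\<close> with probability at least \<open>m\<close>,
    and after it the futures are within 1/2 of each other; so mass \<open>m / 2\<close> is shared,
    which is the overlap constant.\<close>
  define m where "m = \<delta> ^ length U"
  have m: "0 < m" "m \<le> word_prob U x" for x
    using \<delta>_pos word_prob_ge by (simp_all add: m_def)
  have "close 0 (1 - m / 2) x y" for x y
    unfolding close_def
  proof
    fix A :: "(nat \<Rightarrow> 'a) set" assume A: "A \<in> sets past_space"
    then have A': "UNIV - A \<in> sets past_space"
      using sets.compl_sets[OF A] by simp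
    have lower: "m * measure (future (after U t)) (conc U -` B) \<le> measure (future t) B"
      if B: "B \<in> sets past_space" for B t
    proof -
      have "m * measure (future (after U t)) (conc U -` B) \<le> word_prob U t * measure (future (after U t)) (conc U -` B)"
        using m by (intro mult_right_mono) auto
      also have "\<dots> = measure (future t) (cylinder U \<inter> B)"
        using measure_future_cylinder_Int[OF B] by simp
      also have "\<dots> \<le> measure (future t) B"
        using B by (intro future.finite_measure_mono) auto
      finally show ?thesis .
    qed
    have UA: "conc U -` A \<in> sets past_space"
      using A by (intro sets_vimage_past measurable_conc)
    have "measure (future (after U x)) (conc U -` A) \<le> measure (future (after U y)) (conc U -` A) + 1 / 2"
      by (rule close_0D[OF U UA])
    then have "m * (1 / 2) \<le> m * (1 - measure (future (after U x)) (conc U -` A)) + m * measure (future (after U y)) (conc U -` A)"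
      using m by (simp flip: distrib_left)
    also have "\<dots> \<le> (1 - measure (future x) A) + measure (future y) A"
      using lower[OF A, of y] lower[OF A', of x] UA A by (simp add: vimage_Diff measure_future_compl)
    finally show "measure (future x) (shift 0 -` A) \<le> measure (future y) (shift 0 -` A) + (1 - m / 2)"
      by (simp add: vimage_def)
  qed
  then show ?thesis
    unfolding overlap_def using m by (intro exI[of _ "m / 2"]) auto
qed

text \<open>By the Markov property, a cylinder nearly filled by \<open>B\<close> is a word after
  which \<open>B\<close> is nearly certain.\<close>

lemma future_density:
  assumes B: "B \<in> sets past_space" "0 < measure (future x) B"
    and pos: "0 < e"
  shows "\<exists>N. \<forall>n\<ge>N. \<exists>u\<in>words n. 1 - e \<le> measure (future (after u x)) (conc u -` B)"
proof -
  obtain N where N: "\<forall>n\<ge>N. \<exists>u\<in>words n. 0 < measure (future x) (cylinder u)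
      \<and> measure (future x) (cylinder u - B) \<le> e * measure (future x) (cylinder u)"
    using cylinder_density[OF future.finite_measure_axioms sets_future B pos] by blast
  have "1 - e \<le> measure (future (after u x)) (conc u -` B)"
    if "measure (future x) (cylinder u - B) \<le> e * measure (future x) (cylinder u)" for u
  proof -
    have "word_prob u x * (1 - e) \<le> word_prob u x * measure (future (after u x)) (conc u -` B)"
      using that B(1) measure_future_cylinder_Int[OF B(1), of x u]
        future.finite_measure_Diff'[of "cylinder u" x B]
      by (simp add: measure_future_cylinder algebra_simps)
    then show ?thesis
      using word_prob_pos[of u x] by simp
  qed
  then show ?thesis
    using N by blast
qed

text \<open>The word \<open>u\<close> makes \<open>B\<close> nearly certain from
  \<open>after u x\<close>. It has positive probability from \<open>y\<close> too, so
  \<open>B\<close> remains null from \<open>after u y\<close>, against overlap for these two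
  pasts.\<close>

lemma overlap_null:
  assumes ov: overlap and B: "B \<in> sets past_space" and y: "measure (future y) B = 0"
  shows "measure (future x) B = 0"
proof (rule ccontr)
  assume "measure (future x) B \<noteq> 0"
  then have x: "0 < measure (future x) B"
    by (simp add: zero_less_measure_iff)
  obtain \<kappa> where \<kappa>: "0 < \<kappa>" "\<And>x y. close 0 (1 - \<kappa>) x y"
    using ov by (auto simp: overlap_def)
  obtain u where u: "1 - \<kappa> / 2 \<le> measure (future (after u x)) (conc u -` B)"
    using future_density[OF B x, of "\<kappa> / 2"] \<kappa>(1) by fastforce
  have "measure (future y) (cylinder u \<inter> B) \<le> measure (future y) B"
    using B by (intro future.finite_measure_mono) auto
  then have "word_prob u y * measure (future (after u y)) (conc u -` B) \<le> 0"
    unfolding measure_future_cylinder_Int[OF B] using y by simp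
  then have "measure (future (after u y)) (conc u -` B) = 0"
    using word_prob_pos[of u y] by (smt (verit) measure_nonneg mult_pos_pos)
  moreover have "measure (future (after u x)) (conc u -` B) \<le> measure (future (after u y)) (conc u -` B) + (1 - \<kappa>)"
    by (intro close_0D \<kappa>(2) sets_vimage_past measurable_conc B)
  ultimately show False
    using u \<kappa>(1) by simp
qed

text \<open>The one-sided counterpart of the future tail; \<open>sets_tail_iff\<close> gives the
  correspondence.\<close>

definition stream_tail :: "(nat \<Rightarrow> 'a) set set" where
  "stream_tail = {A \<in> sets past_space. \<forall>n. \<exists>B\<in>sets past_space. A = shift n -` B}"

text \<open>A tail event has the same remainder \<open>B\<close> after all words of length
  \<open>n\<close>. If both \<open>A\<close> and its complement had positive probability, words
  \<open>u\<close> and \<open>v\<close> of equal length would make \<open>B\<close> nearly certain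
  from \<open>after u x\<close> and nearly impossible from \<open>after v x\<close>.\<close>

lemma overlap_tail_trivial:
  assumes ov: overlap and A: "A \<in> stream_tail"
  shows "measure (future x) A = 0 \<or> measure (future x) A = 1"
proof (rule ccontr)
  assume neg: "\<not> ?thesis"
  have A_sets: "A \<in> sets past_space" and A_sets': "UNIV - A \<in> sets past_space"
    using A sets.compl_sets[of A past_space] by (auto simp: stream_tail_def)
  have "0 < measure (future x) A" "0 < measure (future x) (UNIV - A)"
    using neg A_sets future.prob_le_1[of x A] by (auto simp: zero_less_measure_iff measure_future_compl order_le_less)
  obtain \<kappa> where \<kappa>: "0 < \<kappa>" "\<And>x y. close 0 (1 - \<kappa>) x y"
    using ov by (auto simp: overlap_def)
  obtain N where N: "\<forall>n\<ge>N. \<exists>u\<in>words n. 1 - \<kappa> / 4 \<le> measure (future (after u x)) (conc u -` A)"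
    using future_density[OF A_sets \<open>0 < measure (future x) A\<close>, of "\<kappa> / 4"] \<kappa>(1) by auto
  obtain N' where N': "\<forall>n\<ge>N'. \<exists>u\<in>words n. 1 - \<kappa> / 4 \<le> measure (future (after u x)) (conc u -` (UNIV - A))"
    using future_density[OF A_sets' \<open>0 < measure (future x) (UNIV - A)\<close>, of "\<kappa> / 4"] \<kappa>(1) by auto
  define n where "n = max N N'"
  obtain u where u: "u \<in> words n" "1 - \<kappa> / 4 \<le> measure (future (after u x)) (conc u -` A)"
    using N[rule_format, of n] by (auto simp: n_def)
  obtain v where v: "v \<in> words n" "1 - \<kappa> / 4 \<le> measure (future (after v x)) (conc v -` (UNIV - A))"
    using N'[rule_format, of n] by (auto simp: n_def)
  obtain B where B: "B \<in> sets past_space" "A = shift n -` B"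
    using A unfolding stream_tail_def by blast
  have "conc u -` A = B" "conc v -` (UNIV - A) = UNIV - B"
    using u v B shift_conc[of u] shift_conc[of v] by (auto simp: words_def)
  then have "1 - \<kappa> / 4 \<le> measure (future (after u x)) B" "1 - \<kappa> / 4 \<le> 1 - measure (future (after v x)) B"
    using u v B by (simp_all add: measure_future_compl)
  moreover have "measure (future (after u x)) B \<le> measure (future (after v x)) B + (1 - \<kappa>)"
    by (intro close_0D \<kappa>(2) B(1))
  ultimately show False
    using \<kappa>(1) by simp
qed

text \<open>Both values are 0 or 1, and they differ by at most \<open>1 - \<kappa>\<close>, which is
  less than 1.\<close>

lemma overlap_tail_eq:
  assumes ov: overlap and A: "A \<in> stream_tail"
  shows "measure (future x) A = measure (future y) A"
proof -
  obtain \<kappa> where \<kappa>: "0 < \<kappa>" "\<And>x y. close 0 (1 - \<kappa>) x y"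
    using ov by (auto simp: overlap_def)
  have "A \<in> sets past_space"
    using A by (simp add: stream_tail_def)
  then have "measure (future x) A \<le> measure (future y) A + (1 - \<kappa>)"
    "measure (future y) A \<le> measure (future x) A + (1 - \<kappa>)"
    using close_0D[OF \<kappa>(2)] by blast+
  then show ?thesis
    using overlap_tail_trivial[OF ov A, of x] overlap_tail_trivial[OF ov A, of y] \<kappa>(1) by auto
qed


text \<open>Disjoint supports \<open>E x\<close> of the futures project to sets of streams with multiplicity at most
  the number of words of length \<open>n\<close>, while each projection has probability at least \<open>1/2\<close> under the
  future of \<open>y\<close>.\<close>

lemma card_singular_le:
  assumes fin: "finite Z" and near: "\<And>x. x \<in> Z \<Longrightarrow> close n (1 / 2) x y"
    and sing: "\<And>x x'. x \<in> Z \<Longrightarrow> x' \<in> Z \<Longrightarrow> x \<noteq> x' \<Longrightarrow> singular x x'"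
  shows "card Z \<le> 2 * card (words n :: 'a list set)"
proof -
  define D where "D x x' = (SOME D. D \<in> sets past_space \<and> measure (future x) D = 0 \<and> measure (future x') (UNIV - D) = 0)"
    for x x'
  have D: "D x x' \<in> sets past_space" "measure (future x) (D x x') = 0" "measure (future x') (UNIV - D x x') = 0"
    if "x \<in> Z" "x' \<in> Z" "x \<noteq> x'" for x x'
  proof -
    have "\<exists>D. D \<in> sets past_space \<and> measure (future x) D = 0 \<and> measure (future x') (UNIV - D) = 0"
      using sing[OF that] unfolding singular_def by blast
    from someI_ex[OF this] show "D x x' \<in> sets past_space" "measure (future x) (D x x') = 0"
      "measure (future x') (UNIV - D x x') = 0"
      unfolding D_def by blast+
  qed
  \<comment> \<open>Removing \<open>D x x'\<close> from the support of \<open>x\<close>, and from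
    the support of \<open>x'\<close> the complement of the same set, makes the supports
    \<open>E\<close> exactly disjoint rather than disjoint up to null sets.\<close>
  define N where "N x = (\<Union>x'\<in>Z - {x}. D x x' \<union> (UNIV - D x' x))" for x
  define E where "E x = UNIV - N x" for x
  have D_compl: "UNIV - D x' x \<in> sets past_space" if "x \<in> Z" "x' \<in> Z" "x \<noteq> x'" for x x'
    using sets.compl_sets[OF D(1)[of x' x]] that by simp
  have N_null: "N x \<in> null_sets (future x)" if "x \<in> Z" for x
    unfolding N_def
  proof (rule null_sets_UN')
    show "countable (Z - {x})"
      using fin by (simp add: countable_finite)
    show "D x x' \<union> (UNIV - D x' x) \<in> null_sets (future x)" if "x' \<in> Z - {x}" for x'
      using that \<open>x \<in> Z\<close> D[of x x'] D[of x' x] D_compl[of x x']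
      by (intro null_sets.Un) (auto simp: null_sets_def future.emeasure_eq_measure)
  qed
  have N_sets: "N x \<in> sets past_space" if "x \<in> Z" for x
    using N_null[OF that] by auto
  have E_sets: "E x \<in> sets past_space" if "x \<in> Z" for x
    using sets.compl_sets[OF N_sets[OF that]] by (simp add: E_def)
  have E_full: "measure (future x) (E x) = 1" if "x \<in> Z" for x
    using N_null[OF that] N_sets[OF that] by (simp add: E_def measure_future_compl measure_eq_0_null_sets)
  have E_disj: "E x \<inter> E x' = {}" if "x \<in> Z" "x' \<in> Z" "x \<noteq> x'" for x x'
    using that by (auto simp: E_def N_def)
  \<comment> \<open>The image of \<open>E x\<close> under \<open>shift n\<close>, written as a
    finite union over prefixes so that measurability is clear.\<close>
  define G where "G x = (\<Union>u\<in>words n. conc u -` E x)" for x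
  have part_sets: "conc u -` E x \<in> sets past_space" if "x \<in> Z" for u x
    using E_sets[OF that] by (intro sets_vimage_past measurable_conc)
  have G_sets: "G x \<in> sets past_space" if "x \<in> Z" for x
    unfolding G_def using part_sets[OF that] by (intro sets.finite_UN) auto
  have "1 / 2 \<le> measure (future y) (shift n -` G x)" if "x \<in> Z" for x
  proof -
    have "E x \<subseteq> shift n -` G x"
    proof
      fix \<omega> assume "\<omega> \<in> E x"
      then have "conc (pre n \<omega>) (shift n \<omega>) \<in> E x"
        by (simp add: conc_pre_shift)
      then show "\<omega> \<in> shift n -` G x"
        unfolding G_def using pre_in_words by blast
    qed
    then have "1 \<le> measure (future x) (shift n -` G x)"
      using E_full[OF that] future.finite_measure_mono[of "E x" "shift n -` G x" x]
        sets_vimage_past[OF measurable_shift G_sets[OF that]] by simp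
    then show ?thesis
      using near[OF that] G_sets[OF that] unfolding close_def by force
  qed
  then have "(\<Sum>x\<in>Z. 1 / 2) \<le> (\<Sum>x\<in>Z. measure (future y) (shift n -` G x))"
    by (intro sum_mono) auto
  also have "\<dots> \<le> (\<Sum>x\<in>Z. \<Sum>u\<in>words n. measure (future y) (shift n -` conc u -` E x))"
  proof (rule sum_mono)
    fix x assume "x \<in> Z"
    then show "measure (future y) (shift n -` G x) \<le> (\<Sum>u\<in>words n. measure (future y) (shift n -` conc u -` E x))"
      unfolding G_def vimage_UN
      using sets_vimage_past[OF measurable_shift part_sets[OF \<open>x \<in> Z\<close>]]
      by (intro future.finite_measure_subadditive_finite) auto
  qed
  also have "\<dots> = (\<Sum>u\<in>words n. \<Sum>x\<in>Z. measure (future y) (shift n -` conc u -` E x))"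
    by (rule sum.swap)
  also have "\<dots> \<le> (\<Sum>u\<in>(words n :: 'a list set). 1)"
  proof (rule sum_mono)
    fix u :: "'a list"
    have "(\<Sum>x\<in>Z. measure (future y) (shift n -` conc u -` E x)) = measure (future y) (\<Union>x\<in>Z. shift n -` conc u -` E x)"
    proof (rule future.finite_measure_finite_Union[symmetric])
      show "disjoint_family_on (\<lambda>x. shift n -` conc u -` E x) Z"
        using E_disj by (fastforce simp: disjoint_family_on_def)
      show "(\<lambda>x. shift n -` conc u -` E x) ` Z \<subseteq> sets (future y)"
        using sets_vimage_past[OF measurable_shift part_sets] by auto
    qed fact
    then show "(\<Sum>x\<in>Z. measure (future y) (shift n -` conc u -` E x)) \<le> 1"
      by simp
  qed
  finally have "real (card Z) / 2 \<le> real (card (words n :: 'a list set))"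
    by simp
  then show ?thesis
    by linarith
qed

lemma overlap_if_close:
  assumes "\<And>x y e. 0 < e \<Longrightarrow> \<exists>n. close n e x y"
  shows overlap
proof -
  define y0 :: "nat \<Rightarrow> 'a" where "y0 = (\<lambda>_. undefined)"
  have "\<exists>n w. cylinder ([] @ w) \<subseteq> {x. close n (1 / 2) x y0}"
  proof (rule cylinder_baire)
    show "\<exists>k. \<forall>y. pre k y = pre k x \<longrightarrow> y \<notin> {x. close n (1 / 2) x y0}"
      if "x \<notin> {x. close n (1 / 2) x y0}" for n x
      using that closed_close[of n "1 / 2" x y0] by auto
    show "\<exists>n. x \<in> {x. close n (1 / 2) x y0}" for x
      using assms[of "1 / 2" x y0] by auto
  qed
  then obtain n w where w: "cylinder w \<subseteq> {x. close n (1 / 2) x y0}"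
    by auto
  \<comment> \<open>\<open>P k\<close> says that the cylinder contains \<open>k\<close> pairwise
    singular pasts. The bound on \<open>k\<close> gives a largest family, and a past singular to all
    its members could be adjoined to it.\<close>
  define P where "P k \<longleftrightarrow> (\<exists>Z. finite Z \<and> Z \<subseteq> cylinder w \<and> card Z = k
    \<and> (\<forall>x\<in>Z. \<forall>x'\<in>Z. x \<noteq> x' \<longrightarrow> singular x x'))" for k
  have bound: "k \<le> 2 * card (words n :: 'a list set)" if "P k" for k
    using that w card_singular_le[of _ n y0] unfolding P_def by (metis mem_Collect_eq subsetD)
  have "P 0"
    unfolding P_def by (intro exI[of _ "{}"]) simp
  then obtain k where k: "P k" "\<And>m. P m \<Longrightarrow> m \<le> k"
    using Nat.ex_has_greatest_nat[of P 0 "2 * card (words n :: 'a list set)"] bound by blast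
  then obtain Z where Z: "finite Z" "Z \<subseteq> cylinder w" "card Z = k" "\<And>x x'. x \<in> Z \<Longrightarrow> x' \<in> Z \<Longrightarrow> x \<noteq> x' \<Longrightarrow> singular x x'"
    unfolding P_def by blast
  have ex: "\<exists>z\<in>Z. \<not> singular x z" if x: "x \<in> cylinder w" for x
  proof (rule ccontr)
    assume neg: "\<not> ?thesis"
    then have "x \<notin> Z"
      using not_singular_self by blast
    moreover have "P (card (insert x Z))"
      unfolding P_def using Z x neg singular_sym
      by (intro exI[of _ "insert x Z"]) auto
    ultimately show False
      using k(2)[of "card (insert x Z)"] Z by simp
  qed
  show ?thesis
  proof (rule overlapI)
    show "\<exists>i. \<not> singular x (from_nat_into Z i)" if "x \<in> cylinder w" for x
      using ex[OF that] from_nat_into_to_nat_on[OF countable_finite[OF Z(1)]] by metis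
  qed
qed

lemma overlap_if_ac:
  assumes "\<And>x y A. A \<in> sets past_space \<Longrightarrow> measure (future y) A = 0 \<Longrightarrow> measure (future x) A = 0"
  shows overlap
proof (rule overlapI[of "[]"])
  show "\<exists>i::nat. \<not> singular x (\<lambda>_. undefined)" for x
  proof
    show "\<not> singular x (\<lambda>_. undefined)"
    proof
      assume "singular x (\<lambda>_. undefined)"
      then obtain D where D: "D \<in> sets past_space" "measure (future x) D = 0"
        "measure (future (\<lambda>_. undefined)) (UNIV - D) = 0"
        unfolding singular_def by blast
      then show False
        using assms[of D x "\<lambda>_. undefined"] by (simp add: measure_future_compl)
    qed
  qed
qed

section \<open>The likelihood ratio and the weak square-summability criterion\<close>

definition sq_dev :: "'a list \<Rightarrow> (nat \<Rightarrow> 'a) \<Rightarrow> (nat \<Rightarrow> 'a) \<Rightarrow> real" where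
  "sq_dev u x y = (\<Sum>a\<in>UNIV. (g (conc [a] (after u x)) - g (conc [a] (after u y)))\<^sup>2)"

text \<open>The compensator is predictable: the term of a transition depends only on the letters
  before it (\<open>sum_sq_dev_snoc\<close>). Recursion on the first letter lets the bounds below be
  proved by conditioning on the first step.\<close>

primrec sum_sq_dev :: "'a list \<Rightarrow> (nat \<Rightarrow> 'a) \<Rightarrow> (nat \<Rightarrow> 'a) \<Rightarrow> real" where
  "sum_sq_dev [] x y = 0"
| "sum_sq_dev (a # u) x y = sq_dev [] x y + sum_sq_dev u (conc [a] x) (conc [a] y)"

lemma sq_dev_Cons: "sq_dev (a # u) x y = sq_dev u (conc [a] x) (conc [a] y)"
  by (simp add: sq_dev_def after_Cons)

lemma sq_dev_nonneg [simp]: "0 \<le> sq_dev u x y"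
  by (simp add: sq_dev_def sum_nonneg)

lemma sum_sq_dev_snoc: "sum_sq_dev (u @ [a]) x y = sum_sq_dev u x y + sq_dev u x y"
  by (induction u arbitrary: x y) (simp_all add: sq_dev_Cons)

lemma sum_sq_dev_pre: "sum_sq_dev (pre n \<omega>) x y = (\<Sum>k<n. sq_dev (pre k \<omega>) x y)"
  by (induction n) (simp_all add: pre_Suc sum_sq_dev_snoc)

text \<open>For probability vectors \<open>p\<close> and \<open>q\<close>, the sum of
  \<open>p^2 / q\<close> is 1 plus the chi-square divergence. Strong non-nullness bounds the
  denominators below by \<open>\<delta>\<close>, and \<open>1 + t \<le> exp t\<close>.\<close>

lemma chi_square_step: "(\<Sum>a\<in>UNIV. (g (conc [a] x))\<^sup>2 / g (conc [a] y)) \<le> exp (sq_dev [] x y / \<delta>)"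
proof -
  have "(\<Sum>a\<in>UNIV. (g (conc [a] x))\<^sup>2 / g (conc [a] y))
      = (\<Sum>a\<in>UNIV. 2 * g (conc [a] x) - g (conc [a] y) + (g (conc [a] x) - g (conc [a] y))\<^sup>2 / g (conc [a] y))"
  proof (rule sum.cong)
    fix a
    have "g (conc [a] y) \<noteq> 0"
      using g_pos[of "conc [a] y"] by linarith
    then show "(g (conc [a] x))\<^sup>2 / g (conc [a] y)
        = 2 * g (conc [a] x) - g (conc [a] y) + (g (conc [a] x) - g (conc [a] y))\<^sup>2 / g (conc [a] y)"
      by (simp add: field_simps power2_eq_square)
  qed simp
  also have "\<dots> = 1 + (\<Sum>a\<in>UNIV. (g (conc [a] x) - g (conc [a] y))\<^sup>2 / g (conc [a] y))"
    by (simp add: sum.distrib sum_subtractf sum_g flip: sum_distrib_left)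
  also have "\<dots> \<le> 1 + (\<Sum>a\<in>UNIV. (g (conc [a] x) - g (conc [a] y))\<^sup>2 / \<delta>)"
    using \<delta>_pos \<delta>_le by (intro add_left_mono sum_mono frac_le) auto
  also have "\<dots> = 1 + sq_dev [] x y / \<delta>"
    by (simp add: sq_dev_def sum_divide_distrib)
  also have "\<dots> \<le> exp (sq_dev [] x y / \<delta>)"
    by (rule exp_ge_add_one_self)
  finally show ?thesis .
qed

text \<open>The affinity is 1 minus half the squared Hellinger distance. From
  \<open>p - q = (sqrt p - sqrt q) * (sqrt p + sqrt q)\<close> with second factor at most 2,
  \<open>(p - q)^2\<close> is at most 4 times the Hellinger term, whence the constant 8.\<close>

lemma hellinger_step: "(\<Sum>a\<in>UNIV. sqrt (g (conc [a] x) * g (conc [a] y))) \<le> exp (- (sq_dev [] x y / 8))"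
proof -
  have le: "(p - q)\<^sup>2 / 8 \<le> (p + q) / 2 - sqrt (p * q)" if "0 \<le> p" "p \<le> 1" "0 \<le> q" "q \<le> 1" for p q :: real
  proof -
    have "p - q = (sqrt p - sqrt q) * (sqrt p + sqrt q)"
      using that by (simp add: algebra_simps)
    then have "(p - q)\<^sup>2 = (sqrt p - sqrt q)\<^sup>2 * (sqrt p + sqrt q)\<^sup>2"
      by (simp add: power_mult_distrib)
    also have "\<dots> \<le> (sqrt p - sqrt q)\<^sup>2 * 2\<^sup>2"
    proof -
      have "sqrt p \<le> 1" "sqrt q \<le> 1"
        using that by simp_all
      then have "sqrt p + sqrt q \<le> 2"
        by linarith
      then show ?thesis
        using that by (intro mult_left_mono power_mono) auto
    qed
    also have "(sqrt p - sqrt q)\<^sup>2 = p + q - 2 * sqrt (p * q)"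
      using that by (simp add: power2_diff real_sqrt_mult)
    finally have "(p - q)\<^sup>2 \<le> 4 * (p + q - 2 * sqrt (p * q))"
      by simp
    moreover have "r / 8 \<le> t / 2 - s" if "r \<le> 4 * (t - 2 * s)" for r s t :: real
      using that by simp
    ultimately show ?thesis
      by blast
  qed
  have "sq_dev [] x y / 8 \<le> (\<Sum>a\<in>UNIV. (g (conc [a] x) + g (conc [a] y)) / 2 - sqrt (g (conc [a] x) * g (conc [a] y)))"
    unfolding sq_dev_def sum_divide_distrib after_Nil by (intro sum_mono le) simp_all
  also have "\<dots> = 1 - (\<Sum>a\<in>UNIV. sqrt (g (conc [a] x) * g (conc [a] y)))"
    by (simp add: sum_subtractf sum.distrib sum_g flip: sum_divide_distrib)
  finally have "(\<Sum>a\<in>UNIV. sqrt (g (conc [a] x) * g (conc [a] y))) \<le> 1 + - (sq_dev [] x y / 8)"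
    by simp
  also have "\<dots> \<le> exp (- (sq_dev [] x y / 8))"
    by (rule exp_ge_add_one_self)
  finally show ?thesis .
qed

lemma sum_words_Suc: "(\<Sum>u\<in>words (Suc n). f u) = (\<Sum>a\<in>UNIV. \<Sum>u\<in>words n. f (a # u))"
  for f :: "'a list \<Rightarrow> real"
proof -
  have "(\<Sum>u\<in>words (Suc n). f u) = (\<Sum>(a, u)\<in>UNIV \<times> words n. f (a # u))"
    by (rule sum.reindex_bij_witness[of _ "\<lambda>(a, u). a # u" "\<lambda>u. (hd u, tl u)"])
       (auto simp: words_def length_Suc_conv)
  then show ?thesis
    by (simp add: sum.cartesian_product)
qed

text \<open>The sum is the expectation, under the future of \<open>y\<close>, of the squared
  likelihood ratio discounted by the compensator. By \<open>chi_square_step\<close> the discounted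
  process is a supermartingale with initial value 1.\<close>

lemma chi_square_bound:
  "(\<Sum>u\<in>words n. (word_prob u x)\<^sup>2 / word_prob u y * exp (- (sum_sq_dev u x y / \<delta>))) \<le> 1"
proof (induction n arbitrary: x y)
  case 0
  then show ?case by simp
next
  case (Suc n)
  let ?F = "\<lambda>u x y. (word_prob u x)\<^sup>2 / word_prob u y * exp (- (sum_sq_dev u x y / \<delta>))"
  let ?E = "exp (- (sq_dev [] x y / \<delta>))"
  have exp_eq: "exp (- ((s + t) / \<delta>)) = exp (- (s / \<delta>)) * exp (- (t / \<delta>))" for s t
    by (simp add: add_divide_distrib flip: exp_add)
  have "(\<Sum>u\<in>words (Suc n). ?F u x y)
      = (\<Sum>a\<in>UNIV. (g (conc [a] x))\<^sup>2 / g (conc [a] y) * ?E * (\<Sum>u\<in>words n. ?F u (conc [a] x) (conc [a] y)))"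
    unfolding sum_words_Suc sum_distrib_left
    by (intro sum.cong refl) (simp add: power_mult_distrib exp_eq mult_ac)
  also have "\<dots> \<le> (\<Sum>a\<in>UNIV. (g (conc [a] x))\<^sup>2 / g (conc [a] y) * ?E * 1)"
    using Suc by (intro sum_mono mult_left_mono) auto
  also have "\<dots> = (\<Sum>a\<in>UNIV. (g (conc [a] x))\<^sup>2 / g (conc [a] y)) * ?E"
    by (simp add: sum_distrib_right)
  also have "\<dots> \<le> exp (sq_dev [] x y / \<delta>) * ?E"
    using chi_square_step by (intro mult_right_mono) auto
  also have "\<dots> = 1"
    by (simp flip: exp_add)
  finally show ?case .
qed

text \<open>The sum is the expectation, under the future of \<open>x\<close>, of the root of the
  likelihood ratio of \<open>y\<close> to \<open>x\<close>, amplified by the compensator; by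
  \<open>hellinger_step\<close> this too is a supermartingale started at 1.\<close>

lemma hellinger_bound:
  "(\<Sum>u\<in>words n. sqrt (word_prob u x * word_prob u y) * exp (sum_sq_dev u x y / 8)) \<le> 1"
proof (induction n arbitrary: x y)
  case 0
  then show ?case by simp
next
  case (Suc n)
  let ?F = "\<lambda>u x y. sqrt (word_prob u x * word_prob u y) * exp (sum_sq_dev u x y / 8)"
  let ?E = "exp (sq_dev [] x y / 8)"
  have "(\<Sum>u\<in>words (Suc n). ?F u x y)
      = (\<Sum>a\<in>UNIV. sqrt (g (conc [a] x) * g (conc [a] y)) * ?E * (\<Sum>u\<in>words n. ?F u (conc [a] x) (conc [a] y)))"
    unfolding sum_words_Suc sum_distrib_left
    by (intro sum.cong refl) (simp add: real_sqrt_mult add_divide_distrib exp_add mult_ac)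
  also have "\<dots> \<le> (\<Sum>a\<in>UNIV. sqrt (g (conc [a] x) * g (conc [a] y)) * ?E * 1)"
    using Suc by (intro sum_mono mult_left_mono) auto
  also have "\<dots> = (\<Sum>a\<in>UNIV. sqrt (g (conc [a] x) * g (conc [a] y))) * ?E"
    by (simp add: sum_distrib_right)
  also have "\<dots> \<le> exp (- (sq_dev [] x y / 8)) * ?E"
    using hellinger_step by (intro mult_right_mono) auto
  also have "\<dots> = 1"
    by (simp flip: exp_add)
  finally show ?case .
qed


section \<open>Absolute continuity against summability of the squared deviations\<close>

lemma sets_stream_Collect_pre [measurable]: "{\<omega>. Q (pre n \<omega>)} \<in> sets past_space" for Q :: "'a list \<Rightarrow> bool"
  using sets_pre[of n "Collect Q"] by simp

lemma measure_future_Collect_pre: "measure (future x) {\<omega>. Q (pre n \<omega>)} = (\<Sum>u\<in>Collect Q \<inter> words n. word_prob u x)"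
  using measure_future_pre[of x n "Collect Q"] by simp

text \<open>Truncation of the likelihood ratio at level \<open>L\<close>: where the ratio is at most
  \<open>L\<close>, the first term dominates; where it exceeds \<open>L\<close>, the mass is bounded
  by the second moment divided by \<open>L\<close>.\<close>

lemma sum_le_chi_square:
  assumes W: "W \<subseteq> words n" "\<And>u. u \<in> W \<Longrightarrow> sum_sq_dev u x y \<le> K" and L: "0 < L"
  shows "(\<Sum>u\<in>W. word_prob u x) \<le> L * (\<Sum>u\<in>W. word_prob u y) + exp (K / \<delta>) / L"
proof -
  have finW: "finite W"
    using W(1) finite_words finite_subset by blast
  let ?F = "\<lambda>u. (word_prob u x)\<^sup>2 / word_prob u y * exp (- (sum_sq_dev u x y / \<delta>))"
  have le: "p \<le> L * q + p\<^sup>2 / q / L" if "0 < p" "0 < q" for p q :: real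
  proof -
    have "0 \<le> (L * q - p)\<^sup>2 + L * q * p"
      using that L by (intro add_nonneg_nonneg) auto
    also have "\<dots> = (L * q)\<^sup>2 + p\<^sup>2 - p * (L * q)"
      by (simp add: power2_eq_square algebra_simps)
    finally have "p * (L * q) \<le> (L * q)\<^sup>2 + p\<^sup>2"
      by simp
    then show ?thesis
      using that L by (simp add: field_simps power2_eq_square)
  qed
  have "(\<Sum>u\<in>W. word_prob u x) \<le> (\<Sum>u\<in>W. L * word_prob u y + exp (K / \<delta>) / L * ?F u)"
  proof (rule sum_mono)
    fix u assume u: "u \<in> W"
    have "(word_prob u x)\<^sup>2 / word_prob u y = ?F u * exp (sum_sq_dev u x y / \<delta>)"
      by (simp flip: exp_add)
    also have "\<dots> \<le> ?F u * exp (K / \<delta>)"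
      using W(2)[OF u] \<delta>_pos by (intro mult_left_mono) (auto intro: divide_right_mono)
    finally have "(word_prob u x)\<^sup>2 / word_prob u y / L \<le> ?F u * exp (K / \<delta>) / L"
      using L by (intro divide_right_mono) auto
    then show "word_prob u x \<le> L * word_prob u y + exp (K / \<delta>) / L * ?F u"
      using le[of "word_prob u x" "word_prob u y"] by (simp add: mult.commute)
  qed
  also have "\<dots> = L * (\<Sum>u\<in>W. word_prob u y) + exp (K / \<delta>) / L * (\<Sum>u\<in>W. ?F u)"
    by (simp add: sum.distrib sum_distrib_left)
  also have "\<dots> \<le> L * (\<Sum>u\<in>W. word_prob u y) + exp (K / \<delta>) / L * 1"
  proof (intro add_left_mono mult_left_mono)
    have "(\<Sum>u\<in>W. ?F u) \<le> (\<Sum>u\<in>words n. ?F u)"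
      using W(1) by (intro sum_mono2) auto
    also have "\<dots> \<le> 1"
      by (rule chi_square_bound)
    finally show "(\<Sum>u\<in>W. ?F u) \<le> 1" .
  qed (use L in auto)
  finally show ?thesis
    by simp
qed

text \<open>Where the compensator stays below \<open>K\<close> the second moment is bounded
  uniformly in \<open>n\<close>, so no mass of the future of \<open>x\<close> can escape to an event
  that is null for \<open>y\<close>. Summability says that these regions exhaust almost
  everything.\<close>

lemma null_of_summable:
  assumes summ: "AE \<omega> in future x. summable (\<lambda>n. sq_dev (pre n \<omega>) x y)"
    and B: "B \<in> sets past_space" and null: "measure (future y) B = 0"
  shows "measure (future x) B = 0"
proof -
  define E where "E K = {\<omega>. \<forall>n. sum_sq_dev (pre n \<omega>) x y \<le> real K}" for K :: nat
  have E_sets: "E K \<in> sets past_space" for K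
  proof -
    have "E K = (\<Inter>n. {\<omega>. sum_sq_dev (pre n \<omega>) x y \<le> real K})"
      by (auto simp: E_def)
    also have "\<dots> \<in> sets past_space"
      by (intro sets.countable_INT) (auto intro!: sets_stream_Collect_pre)
    finally show ?thesis .
  qed
  have E_null: "measure (future x) (B \<inter> E K) = 0" for K
  proof -
    have "measure (future x) (B \<inter> E K) \<le> 0"
    proof (rule field_le_epsilon)
      fix \<eta> :: real assume \<eta>: "0 < \<eta>"
      \<comment> \<open>\<open>L\<close> makes the second-moment term
        \<open>exp (K / \<delta>) / L\<close> equal to \<open>\<eta> / 2\<close>, and then
        \<open>e\<close> makes the approximation error \<open>e + L * e\<close> equal to the other
        half.\<close>
      define L where "L = 2 * exp (real K / \<delta>) / \<eta>"
      define e where "e = \<eta> / (2 * (1 + L))"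
      have L: "0 < L" and e: "0 < e"
        using \<eta> by (simp_all add: L_def e_def add_pos_pos)
      have BE: "B \<inter> E K \<in> sets past_space"
        using B E_sets by auto
      obtain n W where W: "measure (pair_sum x y) (sym_diff (B \<inter> E K) {\<omega>. pre n \<omega> \<in> W}) < e"
        using cylinder_approx_ex[OF finite_measure_pair_sum sets_pair_sum BE e] by blast
      define C where "C = {\<omega>. pre n \<omega> \<in> W}"
      have C: "C \<in> sets past_space"
        unfolding C_def by (rule sets_pre)
      \<comment> \<open>Discarding the words above the bound loses no point of \<open>E K\<close>,
        since \<open>E K\<close> requires the bound at every length.\<close>
      define V where "V = {u \<in> W. sum_sq_dev u x y \<le> real K}"
      have sd: "measure (future x) ((B \<inter> E K) - C) < e" "measure (future y) (C - (B \<inter> E K)) < e"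
      proof -
        have sets: "sym_diff (B \<inter> E K) C \<in> sets past_space"
          using BE C by auto
        then have "measure (future x) (sym_diff (B \<inter> E K) C) + measure (future y) (sym_diff (B \<inter> E K) C) < e"
          using W by (simp add: measure_pair_sum C_def)
        moreover have "measure (future x) ((B \<inter> E K) - C) \<le> measure (future x) (sym_diff (B \<inter> E K) C)"
          "measure (future y) (C - (B \<inter> E K)) \<le> measure (future y) (sym_diff (B \<inter> E K) C)"
          using sets by (auto intro!: future.finite_measure_mono)
        ultimately show "measure (future x) ((B \<inter> E K) - C) < e" "measure (future y) (C - (B \<inter> E K)) < e"
          using measure_nonneg[of "future x" "sym_diff (B \<inter> E K) C"] measure_nonneg[of "future y" "sym_diff (B \<inter> E K) C"]
          by linarith+
      qed
      have "measure (future x) (B \<inter> E K) \<le> measure (future x) (((B \<inter> E K) - C) \<union> {\<omega>. pre n \<omega> \<in> V})"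
      proof (rule future.finite_measure_mono)
        show "B \<inter> E K \<subseteq> ((B \<inter> E K) - C) \<union> {\<omega>. pre n \<omega> \<in> V}"
          by (auto simp: C_def V_def E_def)
        show "((B \<inter> E K) - C) \<union> {\<omega>. pre n \<omega> \<in> V} \<in> sets (future x)"
          unfolding sets_future by (intro sets.Un sets.Diff BE C sets_pre)
      qed
      also have "\<dots> \<le> measure (future x) ((B \<inter> E K) - C) + measure (future x) {\<omega>. pre n \<omega> \<in> V}"
        by (intro measure_Un_le) (use BE C in \<open>auto intro!: sets_pre\<close>)
      finally have 1: "measure (future x) (B \<inter> E K) \<le> measure (future x) ((B \<inter> E K) - C) + measure (future x) {\<omega>. pre n \<omega> \<in> V}" .
      have 2: "measure (future x) {\<omega>. pre n \<omega> \<in> V} \<le> L * measure (future y) {\<omega>. pre n \<omega> \<in> V} + exp (real K / \<delta>) / L"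
        unfolding measure_future_pre by (rule sum_le_chi_square[OF _ _ L]) (auto simp: V_def)
      have "measure (future y) {\<omega>. pre n \<omega> \<in> V} \<le> e"
      proof -
        have "measure (future y) {\<omega>. pre n \<omega> \<in> V} \<le> measure (future y) ((C - (B \<inter> E K)) \<union> B)"
        proof (rule future.finite_measure_mono)
          show "(C - (B \<inter> E K)) \<union> B \<in> sets (future y)"
            unfolding sets_future by (intro sets.Un sets.Diff BE C B)
        qed (auto simp: C_def V_def)
        also have "\<dots> \<le> measure (future y) (C - (B \<inter> E K)) + measure (future y) B"
          by (intro measure_Un_le) (use BE C B in auto)
        finally show ?thesis
          using sd null by simp
      qed
      then have "L * measure (future y) {\<omega>. pre n \<omega> \<in> V} \<le> L * e"
        using L by (intro mult_left_mono) auto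
      then have "measure (future x) (B \<inter> E K) \<le> e + (L * e + exp (real K / \<delta>) / L)"
        using 1 2 sd(1) by linarith
      moreover have "e + L * e = \<eta> / 2"
      proof -
        have "e + L * e = e * (1 + L)"
          by (simp add: algebra_simps)
        also have "\<dots> = \<eta> / 2"
          using L by (simp add: e_def field_simps)
        finally show ?thesis .
      qed
      moreover have "exp (real K / \<delta>) / L = \<eta> / 2"
        using \<eta> by (simp add: L_def)
      ultimately show "measure (future x) (B \<inter> E K) \<le> 0 + \<eta>"
        by simp
    qed
    then show ?thesis
      by (simp add: measure_le_0_iff)
  qed
  have "AE \<omega> in future x. \<omega> \<notin> B"
  proof -
    have "AE \<omega> in future x. \<forall>K. \<omega> \<notin> B \<inter> E K"
      unfolding AE_all_countable
    proof
      fix K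
      have "B \<inter> E K \<in> null_sets (future x)"
        using E_null[of K] B E_sets by (auto simp: null_sets_def future.emeasure_eq_measure)
      then show "AE \<omega> in future x. \<omega> \<notin> B \<inter> E K"
        by (rule AE_not_in)
    qed
    with summ show ?thesis
    proof eventually_elim
      case (elim \<omega>)
      obtain K :: nat where K: "(\<Sum>n. sq_dev (pre n \<omega>) x y) \<le> real K"
        using real_arch_simple by blast
      have "sum_sq_dev (pre n \<omega>) x y \<le> real K" for n
        unfolding sum_sq_dev_pre using elim(1) K by (intro order_trans[OF sum_le_suminf K]) auto
      then have "\<omega> \<in> E K"
        by (simp add: E_def)
      then show ?case
        using elim(2) by blast
    qed
  qed
  then have "B \<in> null_sets (future x)"
    using B by (simp add: AE_iff_null_sets)
  then show ?thesis
    by (simp add: measure_eq_0_null_sets)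
qed

text \<open>If it failed, events of probability at most \<open>2^(-n)\<close> under \<open>y\<close>
  and more than \<open>\<eta>\<close> under \<open>x\<close> would have an upper limit that is null
  for \<open>y\<close> by Borel-Cantelli but not for \<open>x\<close>.\<close>

lemma ac_uniform:
  assumes ac: "\<And>A. A \<in> sets past_space \<Longrightarrow> measure (future y) A = 0 \<Longrightarrow> measure (future x) A = 0" and \<eta>: "0 < \<eta>"
  shows "\<exists>e>0. \<forall>A\<in>sets past_space. measure (future y) A \<le> e \<longrightarrow> measure (future x) A \<le> \<eta>"
proof (rule ccontr)
  assume "\<not> ?thesis"
  then have "\<exists>A\<in>sets past_space. measure (future y) A \<le> (1 / 2) ^ n \<and> \<eta> < measure (future x) A" for n :: nat
    by (auto simp: not_le)
  then obtain A where A: "\<And>n. A n \<in> sets past_space" "\<And>n. measure (future y) (A n) \<le> (1 / 2) ^ n"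
    "\<And>n. \<eta> < measure (future x) (A n)"
    by metis
  have "limsup A \<in> null_sets (future y)"
  proof (rule borel_cantelli_limsup1)
    show "summable (\<lambda>n. measure (future y) (A n))"
      by (rule summable_comparison_test'[OF summable_geometric, of "1 / 2" 0]) (use A(2) in auto)
  qed (use A in \<open>auto simp: future.emeasure_eq_measure\<close>)
  then have "measure (future x) (limsup A) = 0"
    using ac[of "limsup A"] by (auto simp: measure_eq_0_null_sets)
  moreover have "(\<lambda>n. measure (future x) (\<Union>k\<in>{n..}. A k)) \<longlonglongrightarrow> measure (future x) (\<Inter>n. \<Union>k\<in>{n..}. A k)"
  proof (rule future.finite_Lim_measure_decseq)
    show "decseq (\<lambda>n. \<Union>k\<in>{n..}. A k)"
      by (intro decseq_SucI UN_mono) auto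
  qed (use A(1) in auto)
  then have "\<eta> \<le> measure (future x) (\<Inter>n. \<Union>k\<in>{n..}. A k)"
  proof (rule LIMSEQ_le_const, intro exI allI impI)
    fix n
    have "measure (future x) (A n) \<le> measure (future x) (\<Union>k\<in>{n..}. A k)"
      using A(1) by (intro future.finite_measure_mono) auto
    then show "\<eta> \<le> measure (future x) (\<Union>k\<in>{n..}. A k)"
      using A(3)[of n] by linarith
  qed
  ultimately show False
    using \<eta> by (simp add: limsup_INF_SUP)
qed

text \<open>A likelihood ratio of at least \<open>e\<close> makes the root of the product at least
  \<open>sqrt e\<close> times the probability under \<open>x\<close>, and the amplified affinity
  bound then pays the factor \<open>exp (- (K / 8))\<close>.\<close>

lemma sum_le_hellinger:
  assumes W: "W \<subseteq> words n" "\<And>u. u \<in> W \<Longrightarrow> K \<le> sum_sq_dev u x y" "\<And>u. u \<in> W \<Longrightarrow> e * word_prob u x \<le> word_prob u y"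
    and e: "0 < e"
  shows "(\<Sum>u\<in>W. word_prob u x) \<le> exp (- (K / 8)) / sqrt e"
proof -
  let ?F = "\<lambda>u. sqrt (word_prob u x * word_prob u y) * exp (sum_sq_dev u x y / 8)"
  have "(\<Sum>u\<in>W. word_prob u x) \<le> (\<Sum>u\<in>W. exp (- (K / 8)) / sqrt e * ?F u)"
  proof (rule sum_mono)
    fix u assume u: "u \<in> W"
    have "sqrt e * word_prob u x = sqrt (word_prob u x * (e * word_prob u x))"
      by (simp add: real_sqrt_mult)
    also have "\<dots> \<le> sqrt (word_prob u x * word_prob u y)"
      using W(3)[OF u] by (intro real_sqrt_le_mono mult_left_mono) auto
    also have "\<dots> = sqrt (word_prob u x * word_prob u y) * exp (K / 8) * exp (- (K / 8))"
      by (simp add: mult.assoc flip: exp_add)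
    also have "\<dots> \<le> ?F u * exp (- (K / 8))"
      using W(2)[OF u] by (intro mult_right_mono mult_left_mono) auto
    finally show "word_prob u x \<le> exp (- (K / 8)) / sqrt e * ?F u"
      using e by (simp add: field_simps)
  qed
  also have "\<dots> = exp (- (K / 8)) / sqrt e * (\<Sum>u\<in>W. ?F u)"
    by (simp add: sum_distrib_left)
  also have "\<dots> \<le> exp (- (K / 8)) / sqrt e * 1"
  proof (rule mult_left_mono)
    have "(\<Sum>u\<in>W. ?F u) \<le> (\<Sum>u\<in>words n. ?F u)"
      using W(1) by (intro sum_mono2) auto
    also have "\<dots> \<le> 1"
      by (rule hellinger_bound)
    finally show "(\<Sum>u\<in>W. ?F u) \<le> 1" .
  qed (use e in auto)
  finally show ?thesis
    by simp
qed

text \<open>For a large compensator either the likelihood ratio of \<open>y\<close> to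
  \<open>x\<close> is tiny, which uniform absolute continuity makes improbable, or it is not, and
  then the Hellinger bound decays in \<open>K\<close>. So the compensator is almost surely
  bounded.\<close>

lemma summable_of_ac:
  assumes ac: "\<And>A. A \<in> sets past_space \<Longrightarrow> measure (future y) A = 0 \<Longrightarrow> measure (future x) A = 0"
  shows "AE \<omega> in future x. summable (\<lambda>n. sq_dev (pre n \<omega>) x y)"
proof -
  define D where "D K = {\<omega>. \<exists>n. real K \<le> sum_sq_dev (pre n \<omega>) x y}" for K :: nat
  have D_eq: "D K = (\<Union>n. {\<omega>. real K \<le> sum_sq_dev (pre n \<omega>) x y})" for K
    by (auto simp: D_def)
  have D_sets: "D K \<in> sets past_space" for K
    unfolding D_eq by (intro sets.countable_UN) (auto intro!: sets_stream_Collect_pre)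
  have D_le: "measure (future x) (D K) \<le> \<eta> + exp (- (real K / 8)) / sqrt e"
    if e: "0 < e" and unif: "\<forall>A\<in>sets past_space. measure (future y) A \<le> e \<longrightarrow> measure (future x) A \<le> \<eta>" for \<eta> e K
  proof (rule LIMSEQ_le_const2)
    show "(\<lambda>n. measure (future x) {\<omega>. real K \<le> sum_sq_dev (pre n \<omega>) x y}) \<longlonglongrightarrow> measure (future x) (D K)"
      unfolding D_eq
    proof (rule future.finite_Lim_measure_incseq)
      show "incseq (\<lambda>n. {\<omega>. real K \<le> sum_sq_dev (pre n \<omega>) x y})"
        by (intro incseq_SucI) (simp add: subset_iff sum_sq_dev_pre add_increasing2)
    qed (auto intro!: sets_stream_Collect_pre)
    have "measure (future x) {\<omega>. real K \<le> sum_sq_dev (pre n \<omega>) x y} \<le> \<eta> + exp (- (real K / 8)) / sqrt e" for n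
    proof -
      let ?A = "{\<omega>. word_prob (pre n \<omega>) y < e * word_prob (pre n \<omega>) x}"
      let ?C = "{\<omega>. real K \<le> sum_sq_dev (pre n \<omega>) x y \<and> e * word_prob (pre n \<omega>) x \<le> word_prob (pre n \<omega>) y}"
      have sets: "?A \<in> sets past_space" "?C \<in> sets past_space"
        by (rule sets_stream_Collect_pre)+
      \<comment> \<open>Summing the defining inequality over words bounds this by \<open>e\<close>
        times the probability under \<open>x\<close>.\<close>
      have "measure (future y) ?A \<le> e"
      proof -
        let ?W = "{u. word_prob u y < e * word_prob u x} \<inter> words n"
        have "measure (future y) ?A = (\<Sum>u\<in>?W. word_prob u y)"
          by (rule measure_future_Collect_pre)
        also have "\<dots> \<le> (\<Sum>u\<in>?W. e * word_prob u x)"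
          by (intro sum_mono) auto
        also have "\<dots> = e * measure (future x) ?A"
          by (simp add: measure_future_Collect_pre[of x "\<lambda>u. word_prob u y < e * word_prob u x" n] sum_distrib_left)
        also have "\<dots> \<le> e"
          using e by (simp add: mult_left_le)
        finally show ?thesis .
      qed
      then have "measure (future x) ?A \<le> \<eta>"
        using unif sets by blast
      moreover have "measure (future x) ?C \<le> exp (- (real K / 8)) / sqrt e"
        unfolding measure_future_Collect_pre[of x "\<lambda>u. real K \<le> sum_sq_dev u x y \<and> e * word_prob u x \<le> word_prob u y" n]
        by (rule sum_le_hellinger[OF _ _ _ e]) auto
      moreover have "measure (future x) {\<omega>. real K \<le> sum_sq_dev (pre n \<omega>) x y} \<le> measure (future x) (?A \<union> ?C)"
        using sets by (intro future.finite_measure_mono) auto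
      moreover have "measure (future x) (?A \<union> ?C) \<le> measure (future x) ?A + measure (future x) ?C"
        using sets by (intro measure_Un_le) auto
      ultimately show ?thesis
        by linarith
    qed
    then show "\<exists>N. \<forall>n\<ge>N. measure (future x) {\<omega>. real K \<le> sum_sq_dev (pre n \<omega>) x y} \<le> \<eta> + exp (- (real K / 8)) / sqrt e"
      by blast
  qed
  have Inter_sets: "(\<Inter>K. D K) \<in> sets past_space"
    using D_sets by auto
  have "measure (future x) (\<Inter>K. D K) \<le> 0"
  proof (rule field_le_epsilon)
    fix \<eta> :: real assume "0 < \<eta>"
    then obtain e where e: "0 < e" "\<forall>A\<in>sets past_space. measure (future y) A \<le> e \<longrightarrow> measure (future x) A \<le> \<eta>"
      using ac_uniform[OF ac] by blast
    have "exp (- (real K / 8)) = exp (- (1 / 8)) ^ K" for K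
      by (simp flip: exp_of_nat_mult)
    then have "(\<lambda>K. exp (- (real K / 8))) \<longlonglongrightarrow> 0"
      by (simp add: LIMSEQ_power_zero)
    then have "(\<lambda>K. \<eta> + exp (- (real K / 8)) / sqrt e) \<longlonglongrightarrow> \<eta> + 0 / sqrt e"
      using e by (intro tendsto_add tendsto_divide tendsto_const) simp_all
    moreover have "measure (future x) (\<Inter>K. D K) \<le> \<eta> + exp (- (real K / 8)) / sqrt e" for K
    proof -
      have "measure (future x) (\<Inter>K. D K) \<le> measure (future x) (D K)"
        using D_sets by (intro future.finite_measure_mono) auto
      then show ?thesis
        using D_le[OF e, of K] by (rule order_trans)
    qed
    ultimately have "measure (future x) (\<Inter>K. D K) \<le> \<eta> + 0 / sqrt e"
      by (intro LIMSEQ_le_const) auto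
    then show "measure (future x) (\<Inter>K. D K) \<le> 0 + \<eta>"
      by simp
  qed
  then have "(\<Inter>K. D K) \<in> null_sets (future x)"
    using Inter_sets by (auto simp: null_sets_def future.emeasure_eq_measure measure_le_0_iff)
  then have "AE \<omega> in future x. \<omega> \<notin> (\<Inter>K. D K)"
    by (rule AE_not_in)
  then show ?thesis
  proof eventually_elim
    case (elim \<omega>)
    then obtain K where "\<omega> \<notin> D K"
      by blast
    then have "(\<Sum>k<n. sq_dev (pre k \<omega>) x y) \<le> real K" for n
      unfolding D_def sum_sq_dev_pre by (auto simp: not_le intro: less_imp_le)
    then show ?case
      by (intro summableI_nonneg_bounded) auto
  qed
qed

end

section \<open>Successful couplings\<close>

text \<open>The common value is the meet of the two measures. At every point one of
  \<open>f\<close>, \<open>f'\<close> equals 1, so the two remainders live on disjoint sets; this is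
  what makes the residual mass in the coupling computable.\<close>

lemma common_density:
  assumes fin: "finite_measure M" "finite_measure M'" and sets: "sets M = sets N" "sets M' = sets N"
  shows "\<exists>f f'. f \<in> borel_measurable N \<and> f' \<in> borel_measurable N
    \<and> (\<forall>\<omega>. 0 \<le> f \<omega> \<and> f \<omega> \<le> 1) \<and> (\<forall>\<omega>. 0 \<le> f' \<omega> \<and> f' \<omega> \<le> 1) \<and> (\<forall>\<omega>. f \<omega> = 1 \<or> f' \<omega> = (1::real))
    \<and> density M (\<lambda>\<omega>. ennreal (f \<omega>)) = density M' (\<lambda>\<omega>. ennreal (f' \<omega>))"
proof -
  interpret M: finite_measure M by fact
  interpret M': finite_measure M' by fact
  define \<rho> where "\<rho> = measure_sum N (\<lambda>b. if b then M else M')"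
  have sets_\<rho>[measurable_cong]: "sets \<rho> = sets N"
    by (simp add: \<rho>_def)
  have \<rho>: "emeasure \<rho> A = emeasure M A + emeasure M' A" if "A \<in> sets N" for A
    unfolding \<rho>_def using that sets
    by (subst emeasure_measure_sum) (auto simp: nn_integral_count_space_finite UNIV_bool add.commute)
  have "finite_measure \<rho>"
  proof (rule finite_measureI)
    show "emeasure \<rho> (space \<rho>) \<noteq> \<infinity>"
      using \<rho>[of "space N"] sets_eq_imp_space_eq[OF sets_\<rho>] by simp
  qed
  then interpret \<rho>: finite_measure \<rho> .
  have ac: "absolutely_continuous \<rho> M" "absolutely_continuous \<rho> M'"
    using sets sets_\<rho> by (auto simp: absolutely_continuous_def null_sets_def \<rho>)
  have dens: "\<exists>p\<in>borel_measurable N. (\<forall>\<omega>. 0 \<le> p \<omega>) \<and> density \<rho> (\<lambda>\<omega>. ennreal (p \<omega>)) = L"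
    if ac: "absolutely_continuous \<rho> L" and L: "finite_measure L" "sets L = sets N" for L
  proof -
    obtain p where p: "p \<in> borel_measurable \<rho>" "AE \<omega> in \<rho>. RN_deriv \<rho> L \<omega> = ennreal (p \<omega>)"
      "AE \<omega> in L. 0 < p \<omega>" "\<And>\<omega>. 0 \<le> p \<omega>"
      using \<rho>.real_RN_deriv[OF L(1) ac] L(2) sets_\<rho> by auto
    have "density \<rho> (\<lambda>\<omega>. ennreal (p \<omega>)) = density \<rho> (RN_deriv \<rho> L)"
      using p by (intro density_cong) (auto elim: eventually_mono)
    then show ?thesis
      using \<rho>.density_RN_deriv[OF ac] p L(2) sets_\<rho> by (intro bexI[of _ p]) (auto cong: measurable_cong_sets)
  qed
  obtain p where p[measurable]: "p \<in> borel_measurable N" and p0: "\<And>\<omega>. 0 \<le> p \<omega>"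
    and M_eq: "density \<rho> (\<lambda>\<omega>. ennreal (p \<omega>)) = M"
    using dens[OF ac(1) fin(1) sets(1)] by blast
  obtain q where q[measurable]: "q \<in> borel_measurable N" and q0: "\<And>\<omega>. 0 \<le> q \<omega>"
    and M'_eq: "density \<rho> (\<lambda>\<omega>. ennreal (q \<omega>)) = M'"
    using dens[OF ac(2) fin(2) sets(2)] by blast
  \<comment> \<open>The common density is the minimum of \<open>p\<close> and \<open>q\<close>. A
    quotient is taken only where its denominator exceeds a nonnegative number, so no division by
    zero occurs.\<close>
  define f where "f \<omega> = (if p \<omega> \<le> q \<omega> then 1 else q \<omega> / p \<omega>)" for \<omega>
  define f' where "f' \<omega> = (if q \<omega> \<le> p \<omega> then 1 else p \<omega> / q \<omega>)" for \<omega>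
  have f_meas[measurable]: "f \<in> borel_measurable N" "f' \<in> borel_measurable N"
    unfolding f_def[abs_def] f'_def[abs_def] by measurable
  have bounds: "0 \<le> f \<omega>" "f \<omega> \<le> 1" "0 \<le> f' \<omega>" "f' \<omega> \<le> 1" "f \<omega> = 1 \<or> f' \<omega> = 1" for \<omega>
    using p0[of \<omega>] q0[of \<omega>] by (auto simp: f_def f'_def field_simps)
  have eq: "p \<omega> * f \<omega> = q \<omega> * f' \<omega>" for \<omega>
    using p0[of \<omega>] q0[of \<omega>] by (auto simp: f_def f'_def)
  have "density M (\<lambda>\<omega>. ennreal (f \<omega>)) = density \<rho> (\<lambda>\<omega>. ennreal (p \<omega>) * ennreal (f \<omega>))"
    unfolding M_eq[symmetric] by (rule density_density_eq) auto
  also have "\<dots> = density \<rho> (\<lambda>\<omega>. ennreal (q \<omega>) * ennreal (f' \<omega>))"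
    using eq p0 q0 bounds by (simp flip: ennreal_mult)
  also have "\<dots> = density M' (\<lambda>\<omega>. ennreal (f' \<omega>))"
    unfolding M'_eq[symmetric] by (rule density_density_eq[symmetric]) auto
  finally show ?thesis
    using f_meas bounds by blast
qed

text \<open>There are finitely many prefixes of length \<open>n\<close>, so conditioning on the
  remaining stream needs only one Radon-Nikodym derivative \<open>p u\<close> per word, of the part
  of \<open>M\<close> with prefix \<open>u\<close> with respect to \<open>\<eta>\<close>.\<close>

lemma prefix_disintegration:
  fixes M :: "(nat \<Rightarrow> 'a::finite) measure" and n :: nat
  assumes fin: "finite_measure M" and sets_M: "sets M = sets past_space"
  defines "\<eta> \<equiv> distr M past_space (shift n)"
  shows "\<exists>p. (\<forall>u. p u \<in> borel_measurable past_space) \<and> (AE z in \<eta>. (\<Sum>u\<in>words n. p u z) = 1)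
    \<and> (\<forall>A\<in>sets past_space. emeasure M A = (\<Sum>u\<in>words n. \<integral>\<^sup>+z. p u z * indicator A (conc u z) \<partial>\<eta>))"
proof -
  interpret M: finite_measure M by fact
  note [measurable_cong] = sets_M
  have shift_M: "shift n \<in> measurable M past_space"
    by measurable
  interpret \<eta>: finite_measure \<eta>
    unfolding \<eta>_def by (rule M.finite_measure_distr[OF shift_M])
  have sets_\<eta>[measurable_cong, simp]: "sets \<eta> = sets past_space"
    by (simp add: \<eta>_def)
  have sp: "space M = UNIV"
    using sets_eq_imp_space_eq[OF sets_M] by simp
  have \<eta>: "emeasure \<eta> A = emeasure M (shift n -` A)" if "A \<in> sets past_space" for A
    unfolding \<eta>_def using that shift_M sp by (simp add: emeasure_distr)
  define m where "m u = distr (density M (indicator (cylinder u))) past_space (shift n)" for u :: "'a list"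
  have m: "emeasure (m u) A = emeasure M (cylinder u \<inter> shift n -` A)" if A: "A \<in> sets past_space" for u A
  proof -
    have [measurable]: "shift n -` A \<in> sets past_space"
      using A by (intro sets_vimage_past measurable_shift)
    have "emeasure (m u) A = emeasure (density M (indicator (cylinder u))) (shift n -` A)"
      unfolding m_def using A sp shift_M by (subst emeasure_distr) auto
    also have "\<dots> = (\<integral>\<^sup>+\<omega>. indicator (cylinder u) \<omega> * indicator (shift n -` A) \<omega> \<partial>M)"
      by (rule emeasure_density) auto
    also have "\<dots> = (\<integral>\<^sup>+\<omega>. indicator (cylinder u \<inter> shift n -` A) \<omega> \<partial>M)"
      by (rule nn_integral_cong) (auto split: split_indicator)
    also have "\<dots> = emeasure M (cylinder u \<inter> shift n -` A)"
      by (rule nn_integral_indicator) auto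
    finally show ?thesis .
  qed
  have ac: "absolutely_continuous \<eta> (m u)" for u
  proof -
    have "emeasure M (cylinder u \<inter> shift n -` A) = 0" if "A \<in> sets past_space" "emeasure M (shift n -` A) = 0" for A
    proof -
      have "emeasure M (cylinder u \<inter> shift n -` A) \<le> emeasure M (shift n -` A)"
        using that sets_vimage_past[OF measurable_shift that(1)] by (intro emeasure_mono) (auto simp: sets_M)
      then show ?thesis using that by simp
    qed
    then show ?thesis
      by (auto simp: absolutely_continuous_def null_sets_def \<eta> m) (simp add: m_def)
  qed
  have "\<exists>p\<in>borel_measurable \<eta>. density \<eta> p = m u" for u
    using \<eta>.Radon_Nikodym[OF ac] by (simp add: m_def)
  then obtain p where p: "\<And>u. p u \<in> borel_measurable \<eta>" "\<And>u. density \<eta> (p u) = m u"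
    by metis
  have p_meas[measurable]: "p u \<in> borel_measurable past_space" for u
    using p(1)[of u] by (simp add: measurable_cong_sets[OF sets_\<eta> refl])
  have p_int: "(\<integral>\<^sup>+z. p u z * indicator A z \<partial>\<eta>) = emeasure M (cylinder u \<inter> shift n -` A)" if "A \<in> sets past_space" for u A
    using that p[of u] m[OF that, of u] by (simp add: emeasure_density flip: p(2))
  have sum_m: "(\<Sum>u\<in>words n. emeasure M (cylinder u \<inter> A)) = emeasure M A" if A: "A \<in> sets past_space" for A
    using measure_split_words[OF fin sets_M A, of n] by (simp add: M.emeasure_eq_measure)
  have "density \<eta> (\<lambda>z. \<Sum>u\<in>words n. p u z) = density \<eta> (\<lambda>_. 1)"
  proof (rule measure_eqI)
    fix A assume "A \<in> sets (density \<eta> (\<lambda>z. \<Sum>u\<in>words n. p u z))"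
    then have A: "A \<in> sets past_space" by simp
    have "emeasure (density \<eta> (\<lambda>z. \<Sum>u\<in>words n. p u z)) A = (\<integral>\<^sup>+z. (\<Sum>u\<in>words n. p u z * indicator A z) \<partial>\<eta>)"
      using A by (subst emeasure_density) (auto simp: sum_distrib_right)
    also have "\<dots> = (\<Sum>u\<in>words n. emeasure M (cylinder u \<inter> shift n -` A))"
      using A by (subst nn_integral_sum) (auto simp: p_int)
    also have "\<dots> = emeasure \<eta> A"
      using A by (simp add: sum_m \<eta> sets_vimage_past[OF measurable_shift])
    finally show "emeasure (density \<eta> (\<lambda>z. \<Sum>u\<in>words n. p u z)) A = emeasure (density \<eta> (\<lambda>_. 1)) A"
      by (simp add: density_1)
  qed simp
  then have sum_1: "AE z in \<eta>. (\<Sum>u\<in>words n. p u z) = 1"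
    by (intro \<eta>.density_unique) auto
  have "emeasure M A = (\<Sum>u\<in>words n. \<integral>\<^sup>+z. p u z * indicator A (conc u z) \<partial>\<eta>)" if A: "A \<in> sets past_space" for A
  proof -
    have "(\<integral>\<^sup>+z. p u z * indicator A (conc u z) \<partial>\<eta>) = emeasure M (cylinder u \<inter> A)" if "u \<in> words n" for u
    proof -
      have "(\<integral>\<^sup>+z. p u z * indicator A (conc u z) \<partial>\<eta>) = (\<integral>\<^sup>+z. p u z * indicator (conc u -` A) z \<partial>\<eta>)"
        by (intro nn_integral_cong) (auto split: split_indicator)
      also have "\<dots> = emeasure M (cylinder u \<inter> shift n -` (conc u -` A))"
        using A by (intro p_int sets_vimage_past measurable_conc)
      also have "cylinder u \<inter> shift n -` (conc u -` A) = cylinder u \<inter> A"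
      proof -
        have "conc u (shift n \<omega>) = \<omega>" if "\<omega> \<in> cylinder u" for \<omega>
          using that \<open>u \<in> words n\<close> conc_pre_shift[of n \<omega>] by (simp add: mem_cylinder words_def)
        then show ?thesis by auto
      qed
      finally show ?thesis .
    qed
    then show ?thesis
      using sum_m[OF A] by simp
  qed
  then show ?thesis
    using p_meas sum_1 by blast
qed

lemma sets_shift_eq:
  "{\<omega> \<in> space (past_space \<Otimes>\<^sub>M past_space). shift n (fst \<omega>) = shift n (snd \<omega>)}
    \<in> sets (past_space \<Otimes>\<^sub>M past_space :: ((nat \<Rightarrow> 'a::finite) \<times> (nat \<Rightarrow> 'a)) measure)"
proof -
  let ?S = "past_space \<Otimes>\<^sub>M past_space :: ((nat \<Rightarrow> 'a) \<times> (nat \<Rightarrow> 'a)) measure"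
  have "{\<omega> \<in> space ?S. fst \<omega> k = snd \<omega> k} \<in> sets ?S" for k
  proof -
    have "(\<lambda>\<omega>. (fst \<omega> k, snd \<omega> k)) \<in> measurable ?S (count_space UNIV \<Otimes>\<^sub>M count_space UNIV)"
      by measurable
    then have "(\<lambda>\<omega>. (fst \<omega> k, snd \<omega> k)) \<in> measurable ?S (count_space (UNIV :: ('a \<times> 'a) set))"
      by (simp add: pair_measure_countable)
    from measurable_sets[OF this, of "{p. fst p = snd p}"] show ?thesis
      by (simp add: vimage_def Int_def conj_commute)
  qed
  then have "(\<Inter>k. {\<omega> \<in> space ?S. fst \<omega> (n + k) = snd \<omega> (n + k)}) \<in> sets ?S"
    by (intro sets.countable_INT) auto
  moreover have "(\<Inter>k. {\<omega> \<in> space ?S. fst \<omega> (n + k) = snd \<omega> (n + k)})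
      = {\<omega> \<in> space ?S. shift n (fst \<omega>) = shift n (snd \<omega>)}"
    by (auto simp: shift_def fun_eq_iff)
  ultimately show ?thesis by simp
qed

text \<open>Conditionally on the common value of \<open>shift n\<close>, the two prefixes are coupled independently.\<close>

lemma shift_coupling:
  fixes M M' :: "(nat \<Rightarrow> 'a::finite) measure"
  assumes fin: "finite_measure M" "finite_measure M'"
    and sets_M: "sets M = sets past_space" "sets M' = sets past_space"
    and same: "distr M past_space (shift n) = distr M' past_space (shift n)"
  shows "\<exists>Q. sets Q = sets (past_space \<Otimes>\<^sub>M past_space)
    \<and> (\<forall>A\<in>sets past_space. emeasure Q (A \<times> UNIV) = emeasure M A \<and> emeasure Q (UNIV \<times> A) = emeasure M' A)
    \<and> emeasure Q {\<omega>. shift n (fst \<omega>) \<noteq> shift n (snd \<omega>)} = 0"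
proof -
  define \<eta> where "\<eta> = distr M past_space (shift n)"
  have sets_\<eta>[measurable_cong, simp]: "sets \<eta> = sets past_space"
    by (simp add: \<eta>_def)
  let ?S = "past_space \<Otimes>\<^sub>M past_space :: ((nat \<Rightarrow> 'a) \<times> (nat \<Rightarrow> 'a)) measure"
  have sp_S: "space ?S = UNIV"
    by (simp add: space_pair_measure)
  obtain p where p[measurable]: "\<And>u. p u \<in> borel_measurable past_space" and p1: "AE z in \<eta>. (\<Sum>u\<in>words n. p u z) = 1"
    and pM: "\<And>A. A \<in> sets past_space \<Longrightarrow> emeasure M A = (\<Sum>u\<in>words n. \<integral>\<^sup>+z. p u z * indicator A (conc u z) \<partial>\<eta>)"
    using prefix_disintegration[OF fin(1) sets_M(1), of n] unfolding \<eta>_def by blast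
  obtain q where q[measurable]: "\<And>u. q u \<in> borel_measurable past_space" and q1: "AE z in \<eta>. (\<Sum>u\<in>words n. q u z) = 1"
    and qM: "\<And>A. A \<in> sets past_space \<Longrightarrow> emeasure M' A = (\<Sum>u\<in>words n. \<integral>\<^sup>+z. q u z * indicator A (conc u z) \<partial>\<eta>)"
    using prefix_disintegration[OF fin(2) sets_M(2), of n] unfolding \<eta>_def same by blast
  \<comment> \<open>The piece for a pair of words puts mass \<open>p u z * q v z\<close> at the pair
    of streams that prefix \<open>u\<close> and \<open>v\<close> to the same \<open>z\<close>. Null
    measures elsewhere reduce the sum over all pairs of lists to a finite one.\<close>
  define R where "R w = (if fst w \<in> words n \<and> snd w \<in> words n
    then distr (density \<eta> (\<lambda>z. p (fst w) z * q (snd w) z)) ?S (\<lambda>z. (conc (fst w) z, conc (snd w) z)) else null_measure ?S)"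
    for w
  define Q where "Q = measure_sum ?S R"
  have sets_R: "sets (R w) = sets ?S" for w
    by (simp add: R_def)
  have R: "emeasure (R (u, v)) X = (\<integral>\<^sup>+z. p u z * q v z * indicator X (conc u z, conc v z) \<partial>\<eta>)"
    if "u \<in> words n" "v \<in> words n" "X \<in> sets ?S" for u v X
  proof -
    have meas: "(\<lambda>z. (conc u z, conc v z)) \<in> measurable past_space ?S"
      by measurable
    then have X': "(\<lambda>z. (conc u z, conc v z)) -` X \<in> sets past_space"
      using that(3) measurable_sets[of "\<lambda>z. (conc u z, conc v z)" past_space ?S X] by simp
    have "space \<eta> = UNIV"
      using sets_eq_imp_space_eq[OF sets_\<eta>] by simp
    then have "emeasure (R (u, v)) X = emeasure (density \<eta> (\<lambda>z. p u z * q v z)) ((\<lambda>z. (conc u z, conc v z)) -` X)"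
      unfolding R_def using that meas by (simp add: emeasure_distr)
    also have "\<dots> = (\<integral>\<^sup>+z. p u z * q v z * indicator ((\<lambda>z. (conc u z, conc v z)) -` X) z \<partial>\<eta>)"
      using X' by (intro emeasure_density) auto
    finally show ?thesis
      by (simp add: indicator_def)
  qed
  have Q: "emeasure Q X = (\<Sum>u\<in>words n. \<Sum>v\<in>words n. \<integral>\<^sup>+z. p u z * q v z * indicator X (conc u z, conc v z) \<partial>\<eta>)"
    if X: "X \<in> sets ?S" for X
  proof -
    have "emeasure Q X = (\<integral>\<^sup>+w. emeasure (R w) X \<partial>count_space UNIV)"
      unfolding Q_def using X sets_R by (intro emeasure_measure_sum) auto
    also have "\<dots> = (\<Sum>w\<in>words n \<times> words n. emeasure (R w) X)"
      by (rule nn_integral_count_space') (auto simp: R_def)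
    also have "\<dots> = (\<Sum>u\<in>words n. \<Sum>v\<in>words n. emeasure (R (u, v)) X)"
      by (simp add: sum.cartesian_product)
    finally show ?thesis
      using R X by simp
  qed
  have fst_marg: "emeasure Q (A \<times> UNIV) = emeasure M A" if A[measurable]: "A \<in> sets past_space" for A
  proof -
    have "A \<times> UNIV \<in> sets ?S"
      using A sets.top[of "past_space :: (nat \<Rightarrow> 'a) measure"] by auto
    then have "emeasure Q (A \<times> UNIV) = (\<Sum>u\<in>words n. \<Sum>v\<in>words n. \<integral>\<^sup>+z. p u z * q v z * indicator A (conc u z) \<partial>\<eta>)"
      by (simp add: Q indicator_def)
    also have "\<dots> = (\<Sum>u\<in>words n. \<integral>\<^sup>+z. (\<Sum>v\<in>words n. p u z * q v z * indicator A (conc u z)) \<partial>\<eta>)"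
      by (intro sum.cong refl nn_integral_sum[symmetric]) measurable
    also have "\<dots> = (\<Sum>u\<in>words n. \<integral>\<^sup>+z. p u z * indicator A (conc u z) \<partial>\<eta>)"
    proof (intro sum.cong refl nn_integral_cong_AE)
      fix u
      show "AE z in \<eta>. (\<Sum>v\<in>words n. p u z * q v z * indicator A (conc u z)) = p u z * indicator A (conc u z)"
        using q1
      proof eventually_elim
        case (elim z)
        have "(\<Sum>v\<in>words n. p u z * q v z * indicator A (conc u z)) = p u z * indicator A (conc u z) * (\<Sum>v\<in>words n. q v z)"
          unfolding sum_distrib_left by (intro sum.cong refl) (simp only: mult_ac)
        then show ?case using elim by simp
      qed
    qed
    finally show ?thesis
      using pM[OF A] by simp
  qed
  have snd_marg: "emeasure Q (UNIV \<times> A) = emeasure M' A" if A[measurable]: "A \<in> sets past_space" for A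
  proof -
    have "UNIV \<times> A \<in> sets ?S"
      using A sets.top[of "past_space :: (nat \<Rightarrow> 'a) measure"] by auto
    then have "emeasure Q (UNIV \<times> A) = (\<Sum>u\<in>words n. \<Sum>v\<in>words n. \<integral>\<^sup>+z. p u z * q v z * indicator A (conc v z) \<partial>\<eta>)"
      by (simp add: Q indicator_def)
    also have "\<dots> = (\<Sum>v\<in>words n. \<Sum>u\<in>words n. \<integral>\<^sup>+z. p u z * q v z * indicator A (conc v z) \<partial>\<eta>)"
      by (rule sum.swap)
    also have "\<dots> = (\<Sum>v\<in>words n. \<integral>\<^sup>+z. (\<Sum>u\<in>words n. p u z * q v z * indicator A (conc v z)) \<partial>\<eta>)"
      by (intro sum.cong refl nn_integral_sum[symmetric]) measurable
    also have "\<dots> = (\<Sum>v\<in>words n. \<integral>\<^sup>+z. q v z * indicator A (conc v z) \<partial>\<eta>)"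
    proof (intro sum.cong refl nn_integral_cong_AE)
      fix v
      show "AE z in \<eta>. (\<Sum>u\<in>words n. p u z * q v z * indicator A (conc v z)) = q v z * indicator A (conc v z)"
        using p1
      proof eventually_elim
        case (elim z)
        have "(\<Sum>u\<in>words n. p u z * q v z * indicator A (conc v z)) = q v z * indicator A (conc v z) * (\<Sum>u\<in>words n. p u z)"
          unfolding sum_distrib_left by (intro sum.cong refl) (simp only: mult_ac)
        then show ?case using elim by simp
      qed
    qed
    finally show ?thesis
      using qM[OF A] by simp
  qed
  have off: "emeasure Q {\<omega>. shift n (fst \<omega>) \<noteq> shift n (snd \<omega>)} = 0"
  proof -
    have "{\<omega>. shift n (fst \<omega>) \<noteq> shift n (snd \<omega>)} \<in> sets ?S"
      using sets.compl_sets[OF sets_shift_eq[of n, where 'a='a]] sp_S by (simp add: set_diff_eq)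
    moreover have "indicator {\<omega>. shift n (fst \<omega>) \<noteq> shift n (snd \<omega>)} (conc u z, conc v z) = (0::ennreal)"
      if "u \<in> words n" "v \<in> words n" for u v and z :: "nat \<Rightarrow> 'a"
      using that shift_conc[of u z] shift_conc[of v z] by (simp add: words_def)
    ultimately show ?thesis
      by (simp add: Q)
  qed
  show ?thesis
    using fst_marg snd_marg off by (intro exI[of _ Q]) (simp add: Q_def)
qed

text \<open>Whatever mass the two laws have in common on the \<open>\<sigma>\<close>-algebra generated by \<open>shift n\<close> is coupled at stage
  \<open>n\<close>. The pieces already coupled agree on this \<open>\<sigma>\<close>-algebra, so the residual mass is at most the
  total variation distance there.\<close>

lemma successful_coupling:
  fixes M M' :: "(nat \<Rightarrow> 'a::finite) measure"
  assumes prob: "prob_space M" "prob_space M'"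
    and sets_M: "sets M = sets past_space" "sets M' = sets past_space"
    and close: "\<And>e. 0 < e \<Longrightarrow> \<exists>n. \<forall>B\<in>sets past_space. measure M (shift n -` B) \<le> measure M' (shift n -` B) + e"
  shows "\<exists>Q. sets Q = sets (past_space \<Otimes>\<^sub>M past_space)
    \<and> (\<forall>A\<in>sets past_space. emeasure Q (A \<times> UNIV) = emeasure M A \<and> emeasure Q (UNIV \<times> A) = emeasure M' A)
    \<and> emeasure Q {\<omega>. \<forall>n. shift n (fst \<omega>) \<noteq> shift n (snd \<omega>)} = 0"
proof -
  interpret M: prob_space M by fact
  interpret M': prob_space M' by fact
  note [measurable_cong] = sets_M
  have sp: "space M = UNIV" "space M' = UNIV"
    using sets_eq_imp_space_eq[OF sets_M(1)] sets_eq_imp_space_eq[OF sets_M(2)] by simp_all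
  have measurable_shift_cong: "shift n \<in> measurable L past_space" if "sets L = sets past_space" for L :: "(nat \<Rightarrow> 'a) measure" and n
    using measurable_shift unfolding measurable_cong_sets[OF that refl] .
  define weight where "weight \<psi> \<longleftrightarrow> \<psi> \<in> borel_measurable past_space \<and> (\<forall>\<omega>. 0 \<le> \<psi> \<omega> \<and> \<psi> \<omega> \<le> (1::real))"
    for \<psi> :: "(nat \<Rightarrow> 'a) \<Rightarrow> real"
  define dens where "dens L \<psi> = density L (\<lambda>\<omega>. ennreal (\<psi> \<omega>))" for L and \<psi> :: "(nat \<Rightarrow> 'a) \<Rightarrow> real"
  have sets_dens[simp]: "sets (dens L \<psi>) = sets L" "space (dens L \<psi>) = space L" for L \<psi>
    by (simp_all add: dens_def)
  have fin_dens: "finite_measure (dens L \<psi>)" if "finite_measure L" "sets L = sets past_space" "weight \<psi>" for L \<psi>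
  proof (rule finite_measureI)
    interpret L: finite_measure L by fact
    have "emeasure (dens L \<psi>) (space L) = (\<integral>\<^sup>+\<omega>. ennreal (\<psi> \<omega>) * indicator (space L) \<omega> \<partial>L)"
      unfolding dens_def using that by (intro emeasure_density) (auto simp: weight_def cong: measurable_cong_sets)
    also have "\<dots> \<le> (\<integral>\<^sup>+\<omega>. indicator (space L) \<omega> \<partial>L)"
      using that(3) by (intro nn_integral_mono) (auto simp: weight_def ennreal_le_1 split: split_indicator)
    also have "\<dots> = emeasure L (space L)"
      by simp
    finally show "emeasure (dens L \<psi>) (space (dens L \<psi>)) \<noteq> \<infinity>"
      using L.emeasure_finite[of "space L"] by (auto simp: top_unique)
  qed
  \<comment> \<open>The state is the pair of densities of the parts not yet coupled. The clause for
    stage 0 forces the recursion to start with the full measures.\<close>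
  define P where "P n s \<longleftrightarrow> weight (fst s) \<and> weight (snd s) \<and> (n = 0 \<longrightarrow> s = (\<lambda>_. 1, \<lambda>_. 1))"
    for n :: nat and s :: "((nat \<Rightarrow> 'a) \<Rightarrow> real) \<times> ((nat \<Rightarrow> 'a) \<Rightarrow> real)"
  \<comment> \<open>Stage \<open>n\<close> removes the meet of the residuals as seen through
    \<open>shift n\<close>; the removed fractions are therefore functions of
    \<open>shift n\<close>.\<close>
  define R where "R n s t \<longleftrightarrow> (\<exists>f f'. weight f \<and> weight f' \<and> (\<forall>\<omega>. f \<omega> = 1 \<or> f' \<omega> = 1)
    \<and> dens (distr (dens M (fst s)) past_space (shift n)) f = dens (distr (dens M' (snd s)) past_space (shift n)) f'
    \<and> fst t = (\<lambda>\<omega>. fst s \<omega> * (1 - f (shift n \<omega>))) \<and> snd t = (\<lambda>\<omega>. snd s \<omega> * (1 - f' (shift n \<omega>))))"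
    for n s t
  have weight_mult: "weight (\<lambda>\<omega>. \<psi> \<omega> * f (shift n \<omega>))" "weight (\<lambda>\<omega>. \<psi> \<omega> * (1 - f (shift n \<omega>)))"
    if "weight \<psi>" "weight f" for \<psi> f n
  proof -
    have [measurable]: "\<psi> \<in> borel_measurable past_space" "f \<in> borel_measurable past_space"
      and bounds: "0 \<le> \<psi> \<omega>" "\<psi> \<omega> \<le> 1" "0 \<le> f \<omega>" "f \<omega> \<le> 1" for \<omega>
      using that by (simp_all add: weight_def)
    have "(\<lambda>\<omega>. \<psi> \<omega> * f (shift n \<omega>)) \<in> borel_measurable past_space"
      "(\<lambda>\<omega>. \<psi> \<omega> * (1 - f (shift n \<omega>))) \<in> borel_measurable past_space"
      by measurable
    then show "weight (\<lambda>\<omega>. \<psi> \<omega> * f (shift n \<omega>))" "weight (\<lambda>\<omega>. \<psi> \<omega> * (1 - f (shift n \<omega>)))"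
      unfolding weight_def using bounds by (simp_all add: mult_le_one)
  qed
  have "\<exists>F. \<forall>n. P n (F n) \<and> R n (F n) (F (Suc n))"
  proof (rule dependent_nat_choice)
    show "\<exists>s. P 0 s"
      by (intro exI[of _ "(\<lambda>_. 1, \<lambda>_. 1)"]) (simp add: P_def weight_def)
    fix s n assume "P n s"
    then have s: "weight (fst s)" "weight (snd s)"
      by (simp_all add: P_def)
    have "shift n \<in> measurable (dens M (fst s)) past_space" "shift n \<in> measurable (dens M' (snd s)) past_space"
      by (simp_all add: measurable_shift_cong sets_M)
    then have "finite_measure (distr (dens M (fst s)) past_space (shift n))"
      "finite_measure (distr (dens M' (snd s)) past_space (shift n))"
      using fin_dens[OF M.finite_measure_axioms sets_M(1) s(1)] fin_dens[OF M'.finite_measure_axioms sets_M(2) s(2)]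
      by (simp_all add: finite_measure.finite_measure_distr)
    from common_density[OF this sets_distr sets_distr]
    obtain f f' where f: "weight f" "weight f'" "\<forall>\<omega>. f \<omega> = 1 \<or> f' \<omega> = 1"
      "dens (distr (dens M (fst s)) past_space (shift n)) f = dens (distr (dens M' (snd s)) past_space (shift n)) f'"
      unfolding weight_def dens_def by blast
    define t where "t = (\<lambda>\<omega>. fst s \<omega> * (1 - f (shift n \<omega>)), \<lambda>\<omega>. snd s \<omega> * (1 - f' (shift n \<omega>)))"
    have "P (Suc n) t"
      using weight_mult(2) s f by (simp add: P_def t_def)
    moreover have "R n s t"
      unfolding R_def t_def using f by (intro exI[of _ f] exI[of _ f']) simp
    ultimately show "\<exists>t. P (Suc n) t \<and> R n s t"
      by blast
  qed
  then obtain F where FP: "\<And>n. P n (F n)" and FR: "\<And>n. R n (F n) (F (Suc n))"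
    by blast
  define \<psi> where "\<psi> n = fst (F n)" for n
  define \<psi>' where "\<psi>' n = snd (F n)" for n
  have \<psi>: "weight (\<psi> n)" "weight (\<psi>' n)" for n
    using FP[of n] by (simp_all add: P_def \<psi>_def \<psi>'_def)
  have \<psi>_0: "\<psi> 0 = (\<lambda>_. 1)" "\<psi>' 0 = (\<lambda>_. 1)"
    using FP[of 0] by (simp_all add: P_def \<psi>_def \<psi>'_def)
  \<comment> \<open>The recursion hides the fractions removed at each stage; they are now fixed as a
    sequence.\<close>
  have "\<forall>n. \<exists>p. weight (fst p) \<and> weight (snd p) \<and> (\<forall>\<omega>. fst p \<omega> = 1 \<or> snd p \<omega> = 1)
    \<and> dens (distr (dens M (\<psi> n)) past_space (shift n)) (fst p) = dens (distr (dens M' (\<psi>' n)) past_space (shift n)) (snd p)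
    \<and> \<psi> (Suc n) = (\<lambda>\<omega>. \<psi> n \<omega> * (1 - fst p (shift n \<omega>))) \<and> \<psi>' (Suc n) = (\<lambda>\<omega>. \<psi>' n \<omega> * (1 - snd p (shift n \<omega>)))"
  proof
    fix n
    obtain f f' where "weight f" "weight f'" "\<forall>\<omega>. f \<omega> = 1 \<or> f' \<omega> = 1"
      "dens (distr (dens M (\<psi> n)) past_space (shift n)) f = dens (distr (dens M' (\<psi>' n)) past_space (shift n)) f'"
      "\<psi> (Suc n) = (\<lambda>\<omega>. \<psi> n \<omega> * (1 - f (shift n \<omega>)))" "\<psi>' (Suc n) = (\<lambda>\<omega>. \<psi>' n \<omega> * (1 - f' (shift n \<omega>)))"
      using FR[of n] unfolding R_def \<psi>_def \<psi>'_def by blast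
    then show "\<exists>p. weight (fst p) \<and> weight (snd p) \<and> (\<forall>\<omega>. fst p \<omega> = 1 \<or> snd p \<omega> = 1)
    \<and> dens (distr (dens M (\<psi> n)) past_space (shift n)) (fst p) = dens (distr (dens M' (\<psi>' n)) past_space (shift n)) (snd p)
    \<and> \<psi> (Suc n) = (\<lambda>\<omega>. \<psi> n \<omega> * (1 - fst p (shift n \<omega>))) \<and> \<psi>' (Suc n) = (\<lambda>\<omega>. \<psi>' n \<omega> * (1 - snd p (shift n \<omega>)))"
      by (intro exI[of _ "(f, f')"]) auto
  qed
  from choice[OF this] obtain ff where ff: "\<And>n. weight (fst (ff n))" "\<And>n. weight (snd (ff n))"
    "\<And>n \<omega>. fst (ff n) \<omega> = 1 \<or> snd (ff n) \<omega> = 1"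
    "\<And>n. dens (distr (dens M (\<psi> n)) past_space (shift n)) (fst (ff n)) = dens (distr (dens M' (\<psi>' n)) past_space (shift n)) (snd (ff n))"
    "\<And>n. \<psi> (Suc n) = (\<lambda>\<omega>. \<psi> n \<omega> * (1 - fst (ff n) (shift n \<omega>)))"
    "\<And>n. \<psi>' (Suc n) = (\<lambda>\<omega>. \<psi>' n \<omega> * (1 - snd (ff n) (shift n \<omega>)))"
    by blast
  define f where "f n = fst (ff n)" for n
  define f' where "f' n = snd (ff n)" for n
  have f: "weight (f n)" "weight (f' n)" "f n \<omega> = 1 \<or> f' n \<omega> = 1"
    "dens (distr (dens M (\<psi> n)) past_space (shift n)) (f n) = dens (distr (dens M' (\<psi>' n)) past_space (shift n)) (f' n)"
    "\<psi> (Suc n) \<omega> = \<psi> n \<omega> * (1 - f n (shift n \<omega>))" "\<psi>' (Suc n) \<omega> = \<psi>' n \<omega> * (1 - f' n (shift n \<omega>))" for n \<omega>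
    using ff by (simp_all add: f_def f'_def)
  \<comment> \<open>The parts of \<open>M\<close> and \<open>M'\<close> that are coupled with each
    other at stage \<open>n\<close>.\<close>
  define \<alpha> where "\<alpha> n = dens M (\<lambda>\<omega>. \<psi> n \<omega> * f n (shift n \<omega>))" for n
  define \<alpha>' where "\<alpha>' n = dens M' (\<lambda>\<omega>. \<psi>' n \<omega> * f' n (shift n \<omega>))" for n
  have sets_\<alpha>: "sets (\<alpha> n) = sets past_space" "sets (\<alpha>' n) = sets past_space" for n
    by (simp_all add: \<alpha>_def \<alpha>'_def sets_M)
  have fin_\<alpha>: "finite_measure (\<alpha> n)" "finite_measure (\<alpha>' n)" for n
    unfolding \<alpha>_def \<alpha>'_def
    by (intro fin_dens M.finite_measure_axioms M'.finite_measure_axioms sets_M weight_mult \<psi> f)+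
  have fin_\<psi>: "finite_measure (dens M (\<psi> n))" "finite_measure (dens M' (\<psi>' n))" for n
    by (intro fin_dens M.finite_measure_axioms M'.finite_measure_axioms sets_M \<psi>)+
  have emeasure_dens: "emeasure (dens L w) A = (\<integral>\<^sup>+\<omega>. ennreal (w \<omega>) * indicator A \<omega> \<partial>L)"
    if "sets L = sets past_space" "weight w" "A \<in> sets past_space" for L w A
    unfolding dens_def using that by (intro emeasure_density) (auto simp: weight_def cong: measurable_cong_sets)
  have distr_dens: "distr (dens L (\<lambda>\<omega>. w \<omega> * h (shift n \<omega>))) past_space (shift n) = dens (distr (dens L w) past_space (shift n)) h"
    if L: "sets L = sets past_space" "weight w" "weight h" for L w h n
  proof -
    have meas: "shift n \<in> measurable (dens L w) past_space"
      by (simp add: measurable_shift_cong L)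
    have w: "(\<lambda>\<omega>. ennreal (w \<omega>)) \<in> borel_measurable L" "(\<lambda>\<omega>. ennreal (h (shift n \<omega>))) \<in> borel_measurable L"
      using L by (auto simp: weight_def measurable_cong_sets[OF L(1) refl])
    have "dens (distr (dens L w) past_space (shift n)) h = distr (density (dens L w) (\<lambda>\<omega>. ennreal (h (shift n \<omega>)))) past_space (shift n)"
      unfolding dens_def[of "distr _ _ _"] using L meas by (intro density_distr) (auto simp: weight_def)
    also have "density (dens L w) (\<lambda>\<omega>. ennreal (h (shift n \<omega>))) = density L (\<lambda>\<omega>. ennreal (w \<omega>) * ennreal (h (shift n \<omega>)))"
      unfolding dens_def by (rule density_density_eq[OF w])
    also have "\<dots> = dens L (\<lambda>\<omega>. w \<omega> * h (shift n \<omega>))"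
      unfolding dens_def using L by (simp add: weight_def ennreal_mult)
    finally show ?thesis ..
  qed
  have same: "distr (\<alpha> n) past_space (shift n) = distr (\<alpha>' n) past_space (shift n)" for n
    unfolding \<alpha>_def \<alpha>'_def using distr_dens sets_M \<psi> f by simp
  define r where "r n A = measure (dens M (\<psi> n)) A" for n A
  define r' where "r' n A = measure (dens M' (\<psi>' n)) A" for n A
  have split_dens: "measure (dens L w) A = measure (dens L (\<lambda>\<omega>. w \<omega> * h (shift n \<omega>))) A + measure (dens L (\<lambda>\<omega>. w \<omega> * (1 - h (shift n \<omega>)))) A"
    if L: "finite_measure L" "sets L = sets past_space" "weight w" "weight h" and A: "A \<in> sets past_space" for L w h n A
  proof -
    interpret D1: finite_measure "dens L w" by (intro fin_dens L)
    interpret D2: finite_measure "dens L (\<lambda>\<omega>. w \<omega> * h (shift n \<omega>))" by (intro fin_dens L weight_mult)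
    interpret D3: finite_measure "dens L (\<lambda>\<omega>. w \<omega> * (1 - h (shift n \<omega>)))" by (intro fin_dens L weight_mult)
    have "emeasure (dens L w) A = (\<integral>\<^sup>+\<omega>. ennreal (w \<omega> * h (shift n \<omega>)) * indicator A \<omega>
        + ennreal (w \<omega> * (1 - h (shift n \<omega>))) * indicator A \<omega> \<partial>L)"
      unfolding emeasure_dens[OF L(2,3) A]
    proof (intro nn_integral_cong)
      fix \<omega>
      have "ennreal (w \<omega>) = ennreal (w \<omega> * h (shift n \<omega>)) + ennreal (w \<omega> * (1 - h (shift n \<omega>)))"
      proof (subst ennreal_plus[symmetric])
        show "0 \<le> w \<omega> * h (shift n \<omega>)" "0 \<le> w \<omega> * (1 - h (shift n \<omega>))"
          using L(3,4) by (simp_all add: weight_def)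
      qed (simp add: algebra_simps)
      then show "ennreal (w \<omega>) * indicator A \<omega> = ennreal (w \<omega> * h (shift n \<omega>)) * indicator A \<omega>
          + ennreal (w \<omega> * (1 - h (shift n \<omega>))) * indicator A \<omega>"
        by (simp add: distrib_right)
    qed
    also have "\<dots> = (\<integral>\<^sup>+\<omega>. ennreal (w \<omega> * h (shift n \<omega>)) * indicator A \<omega> \<partial>L)
        + (\<integral>\<^sup>+\<omega>. ennreal (w \<omega> * (1 - h (shift n \<omega>))) * indicator A \<omega> \<partial>L)"
      using L A by (intro nn_integral_add) (auto simp: weight_def measurable_cong_sets[OF L(2) refl])
    also have "\<dots> = emeasure (dens L (\<lambda>\<omega>. w \<omega> * h (shift n \<omega>))) A + emeasure (dens L (\<lambda>\<omega>. w \<omega> * (1 - h (shift n \<omega>)))) A"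
      using emeasure_dens[OF L(2) weight_mult(1)[OF L(3,4)] A] emeasure_dens[OF L(2) weight_mult(2)[OF L(3,4)] A] by simp
    finally show ?thesis
      by (simp add: D1.emeasure_eq_measure D2.emeasure_eq_measure D3.emeasure_eq_measure flip: ennreal_plus)
  qed
  have \<psi>_Suc: "\<psi> (Suc n) = (\<lambda>\<omega>. \<psi> n \<omega> * (1 - f n (shift n \<omega>)))" "\<psi>' (Suc n) = (\<lambda>\<omega>. \<psi>' n \<omega> * (1 - f' n (shift n \<omega>)))" for n
    using f(5,6) by blast+
  have r_Suc: "r n A = measure (\<alpha> n) A + r (Suc n) A" "r' n A = measure (\<alpha>' n) A + r' (Suc n) A" if "A \<in> sets past_space" for n A
    unfolding r_def r'_def \<alpha>_def \<alpha>'_def \<psi>_Suc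
    using that by (auto intro!: split_dens M.finite_measure_axioms M'.finite_measure_axioms sets_M \<psi> f)
  have r_0: "r 0 A = measure M A" "r' 0 A = measure M' A" for A
    by (simp_all add: r_def r'_def dens_def \<psi>_0 density_1)
  have vim: "shift n -` B \<in> sets past_space" if "B \<in> sets past_space" for n and B :: "(nat \<Rightarrow> 'a) set"
    using that by (intro sets_vimage_past measurable_shift)
  \<comment> \<open>Parts matched through \<open>shift m\<close> also agree on the smaller algebra
    of a later shift.\<close>
  have \<alpha>_eq: "measure (\<alpha> m) (shift n -` B) = measure (\<alpha>' m) (shift n -` B)" if "m \<le> n" and B: "B \<in> sets past_space" for m n B
  proof -
    have "shift n -` B = shift m -` shift (n - m) -` B"
      using \<open>m \<le> n\<close> by (auto simp: shift_shift)
    moreover have "measure (distr L past_space (shift m)) (shift (n - m) -` B) = measure L (shift m -` shift (n - m) -` B)"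
      if "sets L = sets past_space" for L
      using that sets_eq_imp_space_eq[OF that] vim[OF B]
      by (subst measure_distr) (auto simp: measurable_shift_cong)
    ultimately show ?thesis
      using same sets_\<alpha> by metis
  qed
  \<comment> \<open>Stages up to and including \<open>n\<close> remove equal mass from both sides on
    events of \<open>shift n\<close>, so there the residuals differ exactly as \<open>M\<close> and
    \<open>M'\<close> do; including stage \<open>n\<close> itself accounts for
    \<open>Suc n\<close>.\<close>
  have r_diff: "r m (shift n -` B) - r' m (shift n -` B) = measure M (shift n -` B) - measure M' (shift n -` B)"
    if "m \<le> Suc n" and B: "B \<in> sets past_space" for m n B
    using \<open>m \<le> Suc n\<close>
  proof (induction m)
    case 0
    then show ?case by (simp add: r_0)
  next
    case (Suc m)
    then show ?case
      using r_Suc[of "shift n -` B" m, OF vim[OF B]] \<alpha>_eq[OF _ B, of m n] by simp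
  qed
  have UNIV_sets: "UNIV \<in> sets (past_space :: (nat \<Rightarrow> 'a) measure)"
    using sets.top[of "past_space :: (nat \<Rightarrow> 'a) measure"] by simp
  have r_mono: "r n A \<le> r n UNIV" "r' n A \<le> r' n UNIV" if "A \<in> sets past_space" for n A
    unfolding r_def r'_def
    by (intro finite_measure.finite_measure_mono fin_\<psi>; simp add: sets_M UNIV_sets)+
  have r_anti: "r n UNIV \<le> r m UNIV" if "m \<le> n" for m n
    using that
  proof (induction n rule: dec_induct)
    case (step n)
    then show ?case
      using r_Suc(1)[OF UNIV_sets, of n] measure_nonneg[of "\<alpha> n" UNIV] by linarith
  qed simp
  have r_eq: "r' n UNIV = r n UNIV" for n
    using r_diff[of n n UNIV] UNIV_sets M.prob_space M'.prob_space sp by simp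
  have small: "\<exists>n. r n UNIV \<le> e" if e: "0 < e" for e
  proof -
    obtain n where n: "\<forall>B\<in>sets past_space. measure M (shift n -` B) \<le> measure M' (shift n -` B) + e"
      using close[OF e] by blast
    \<comment> \<open>After stage \<open>n\<close> the residual of \<open>M\<close> is carried by
      the preimage of \<open>H\<close> under \<open>shift n\<close>, where \<open>f'\<close> is 1
      and the residual of \<open>M'\<close> vanishes. Hence the residual mass is a difference of the
      two laws on that event.\<close>
    define H where "H = {\<omega>. f n \<omega> < 1}"
    have H: "H \<in> sets past_space"
    proof -
      have [measurable]: "f n \<in> borel_measurable past_space"
        using f(1) by (simp add: weight_def)
      have "{\<omega> \<in> space past_space. f n \<omega> < 1} \<in> sets past_space"
        by measurable
      then show ?thesis by (simp add: H_def)
    qed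
    have "emeasure (dens M (\<psi> (Suc n))) UNIV = emeasure (dens M (\<psi> (Suc n))) (shift n -` H)"
      unfolding emeasure_dens[OF sets_M(1) \<psi>(1) UNIV_sets] emeasure_dens[OF sets_M(1) \<psi>(1) vim[OF H]]
    proof (rule nn_integral_cong)
      fix \<omega>
      show "ennreal (\<psi> (Suc n) \<omega>) * indicator UNIV \<omega> = ennreal (\<psi> (Suc n) \<omega>) * indicator (shift n -` H) \<omega>"
        using f(1)[of n] by (cases "f n (shift n \<omega>) = 1") (auto simp: f(5) H_def weight_def order_less_le)
    qed
    then have "r (Suc n) UNIV = r (Suc n) (shift n -` H)"
      by (simp add: r_def measure_def)
    moreover have "emeasure (dens M' (\<psi>' (Suc n))) (shift n -` H) = 0"
      unfolding emeasure_dens[OF sets_M(2) \<psi>(2) vim[OF H]]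
    proof (rule nn_integral_zero', rule AE_I2)
      fix \<omega>
      have "f' n (shift n \<omega>) = 1" if "f n (shift n \<omega>) < 1"
        using f(3)[of n "shift n \<omega>"] that by auto
      then show "ennreal (\<psi>' (Suc n) \<omega>) * indicator (shift n -` H) \<omega> = 0"
        by (auto simp: f(6) H_def split: split_indicator)
    qed
    then have "r' (Suc n) (shift n -` H) = 0"
      by (simp add: r'_def measure_def)
    ultimately have "r (Suc n) UNIV \<le> e"
      using r_diff[of "Suc n" n H, OF order_refl H] bspec[OF n H] by linarith
    then show ?thesis ..
  qed
  have r_lim: "(\<lambda>n. r n UNIV) \<longlonglongrightarrow> 0"
  proof (rule LIMSEQ_I)
    fix e :: real assume "0 < e"
    then obtain m where "r m UNIV \<le> e / 2"
      using small[of "e / 2"] by auto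
    then have "norm (r n UNIV - 0) < e" if "m \<le> n" for n
      using r_anti[OF that] \<open>0 < e\<close> measure_nonneg[of "dens M (\<psi> n)" UNIV] by (simp add: r_def)
    then show "\<exists>no. \<forall>n\<ge>no. norm (r n UNIV - 0) < e"
      by blast
  qed
  have sums_of_residual: "(\<lambda>n. measure (L n) A) sums s 0"
    if "\<And>n. s n = measure (L n) A + s (Suc n)" "s \<longlonglongrightarrow> 0" for L :: "nat \<Rightarrow> (nat \<Rightarrow> 'a) measure" and A and s :: "nat \<Rightarrow> real"
  proof -
    have "(\<Sum>k<n. measure (L k) A) = s 0 - s n" for n
    proof (induction n)
      case (Suc n)
      then show ?case using that(1)[of n] by simp
    qed simp
    then show ?thesis
      unfolding sums_def using tendsto_diff[OF tendsto_const[of "s 0"] that(2)] by simp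
  qed
  have r_A_lim: "(\<lambda>n. r n A) \<longlonglongrightarrow> 0" "(\<lambda>n. r' n A) \<longlonglongrightarrow> 0" if A: "A \<in> sets past_space" for A
  proof -
    show "(\<lambda>n. r n A) \<longlonglongrightarrow> 0"
      using r_mono(1)[OF A] by (intro tendsto_sandwich[OF _ _ tendsto_const r_lim]) (auto simp: r_def)
    show "(\<lambda>n. r' n A) \<longlonglongrightarrow> 0"
      using r_mono(2)[OF A] r_eq by (intro tendsto_sandwich[OF _ _ tendsto_const r_lim]) (auto simp: r'_def)
  qed
  have \<alpha>_sums: "(\<lambda>n. measure (\<alpha> n) A) sums measure M A" "(\<lambda>n. measure (\<alpha>' n) A) sums measure M' A"
    if A: "A \<in> sets past_space" for A
    using sums_of_residual[of "\<lambda>n. r n A" \<alpha> A, OF r_Suc(1)[OF A] r_A_lim(1)[OF A]]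
      sums_of_residual[of "\<lambda>n. r' n A" \<alpha>' A, OF r_Suc(2)[OF A] r_A_lim(2)[OF A]] by (simp_all add: r_0)
  have \<alpha>_suminf: "(\<Sum>n. emeasure (\<alpha> n) A) = emeasure M A" "(\<Sum>n. emeasure (\<alpha>' n) A) = emeasure M' A"
    if A: "A \<in> sets past_space" for A
    unfolding finite_measure.emeasure_eq_measure[OF fin_\<alpha>(1)] finite_measure.emeasure_eq_measure[OF fin_\<alpha>(2)]
      M.emeasure_eq_measure M'.emeasure_eq_measure
    by (rule suminf_ennreal_eq[OF measure_nonneg \<alpha>_sums(1)[OF A]], rule suminf_ennreal_eq[OF measure_nonneg \<alpha>_sums(2)[OF A]])
  let ?S = "past_space \<Otimes>\<^sub>M past_space :: ((nat \<Rightarrow> 'a) \<times> (nat \<Rightarrow> 'a)) measure"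
  have "\<forall>n. \<exists>Q. sets Q = sets ?S
    \<and> (\<forall>A\<in>sets past_space. emeasure Q (A \<times> UNIV) = emeasure (\<alpha> n) A \<and> emeasure Q (UNIV \<times> A) = emeasure (\<alpha>' n) A)
    \<and> emeasure Q {\<omega>. shift n (fst \<omega>) \<noteq> shift n (snd \<omega>)} = 0"
    using shift_coupling[OF fin_\<alpha> sets_\<alpha> same] by blast
  from choice[OF this] obtain Q where Q: "\<And>n. sets (Q n) = sets ?S"
    "\<And>n A. A \<in> sets past_space \<Longrightarrow> emeasure (Q n) (A \<times> UNIV) = emeasure (\<alpha> n) A"
    "\<And>n A. A \<in> sets past_space \<Longrightarrow> emeasure (Q n) (UNIV \<times> A) = emeasure (\<alpha>' n) A"
    "\<And>n. emeasure (Q n) {\<omega>. shift n (fst \<omega>) \<noteq> shift n (snd \<omega>)} = 0"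
    by blast
  \<comment> \<open>Superposing the stage couplings gives the full marginals because the residuals
    tend to 0, and each stage charges only pairs that eventually agree.\<close>
  define T where "T = measure_sum ?S Q"
  have T: "emeasure T X = (\<Sum>n. emeasure (Q n) X)" if "X \<in> sets ?S" for X
    unfolding T_def using that Q(1) by (simp add: emeasure_measure_sum nn_integral_count_space_nat)
  have off_sets: "{\<omega>. shift n (fst \<omega>) \<noteq> shift n (snd \<omega>)} \<in> sets ?S" for n
    using sets.compl_sets[OF sets_shift_eq[of n, where 'a='a]] by (simp add: set_diff_eq space_pair_measure)
  have all_sets: "{\<omega>. \<forall>n. shift n (fst \<omega>) \<noteq> shift n (snd \<omega>)} \<in> sets ?S"
  proof -
    have "(\<Inter>n. {\<omega>. shift n (fst \<omega>) \<noteq> shift n (snd \<omega>)}) \<in> sets ?S"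
      using off_sets by (intro sets.countable_INT) auto
    moreover have "(\<Inter>n. {\<omega>. shift n (fst \<omega>) \<noteq> shift n (snd \<omega>)}) = {\<omega>. \<forall>n. shift n (fst \<omega>) \<noteq> shift n (snd \<omega> :: nat \<Rightarrow> 'a)}"
      by auto
    ultimately show ?thesis by simp
  qed
  have Q_off: "emeasure (Q n) {\<omega>. \<forall>n. shift n (fst \<omega>) \<noteq> shift n (snd \<omega>)} = 0" for n
  proof -
    have "emeasure (Q n) {\<omega>. \<forall>n. shift n (fst \<omega>) \<noteq> shift n (snd \<omega>)} \<le> emeasure (Q n) {\<omega>. shift n (fst \<omega>) \<noteq> shift n (snd \<omega>)}"
      using off_sets[of n] Q(1)[of n] by (intro emeasure_mono) auto
    then show ?thesis
      using Q(4)[of n] by simp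
  qed
  have rect: "A \<times> UNIV \<in> sets ?S" "UNIV \<times> A \<in> sets ?S" if "A \<in> sets past_space" for A
    using that UNIV_sets by auto
  show ?thesis
  proof (intro exI[of _ T] conjI ballI)
    show "sets T = sets ?S"
      by (simp add: T_def)
    show "emeasure T (A \<times> UNIV) = emeasure M A" "emeasure T (UNIV \<times> A) = emeasure M' A" if "A \<in> sets past_space" for A
      using T rect[OF that] Q(2,3)[OF that] \<alpha>_suminf[OF that] by simp_all
    show "emeasure T {\<omega>. \<forall>n. shift n (fst \<omega>) \<noteq> shift n (snd \<omega>)} = 0"
      unfolding T[OF all_sets] Q_off by simp
  qed
qed

section \<open>The equivalences\<close>

text \<open>The infimum in \<open>enat\<close> of the empty set is infinite, and any admissible time
  bounds it from above.\<close>

lemma coupling_time_finite_iff: "coupling_time p < \<infinity> \<longleftrightarrow> (\<exists>n. forward n (fst p) = forward n (snd p))"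
proof -
  obtain \<omega> \<omega>' where p: "p = (\<omega>, \<omega>')"
    by fastforce
  have iff: "(\<forall>j\<ge>int n. \<omega> j = \<omega>' j) \<longleftrightarrow> forward n \<omega> = forward n \<omega>'" for n
  proof
    assume eq: "forward n \<omega> = forward n \<omega>'"
    show "\<forall>j\<ge>int n. \<omega> j = \<omega>' j"
    proof (intro allI impI)
      fix j assume "int n \<le> j"
      then have "j = int (n + nat (j - int n))"
        by simp
      then show "\<omega> j = \<omega>' j"
        using fun_cong[OF eq, of "nat (j - int n)"] by (simp add: forward_def)
    qed
  qed (simp add: forward_def fun_eq_iff)
  let ?T = "{t. \<forall>j\<ge>int t. \<omega> j = \<omega>' j}"
  have "Inf (enat ` ?T) < \<infinity> \<longleftrightarrow> ?T \<noteq> {}"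
  proof
    assume "?T \<noteq> {}"
    then obtain t where "t \<in> ?T" by blast
    then have "Inf (enat ` ?T) \<le> enat t"
      by (intro Inf_lower imageI)
    then show "Inf (enat ` ?T) < \<infinity>"
      by (rule order_le_less_trans) simp
  next
    assume *: "Inf (enat ` ?T) < \<infinity>"
    show "?T \<noteq> {}"
    proof
      assume "?T = {}"
      then have "Inf (enat ` ?T) = \<infinity>"
        by (simp only: image_empty Inf_empty top_enat_def)
      then show False using * by simp
    qed
  qed
  then show ?thesis
    unfolding coupling_time_def p using iff by auto
qed

context regular_process
begin

section \<open>Two-sided events and laws in terms of streams\<close>

lemma law_at_0: "measure (law_at g x) (forward 0 -` B) = measure (future x) B" if "B \<in> sets past_space"
  using measure_law_at_forward[OF that, of x 0] by (simp add: vimage_def)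

lemma prob_space_law_at: "prob_space (law_at g x)"
  unfolding law_at_eq by (intro prob_space.prob_space_distr prob_space_future) simp

sublocale law_at: prob_space "law_at g x" for x
  by (rule prob_space_law_at)

lemma sets_coord_algebra_UNIV_I: "A \<in> sets (coord_algebra I) \<Longrightarrow> A \<in> sets (coord_algebra UNIV)"
  using sets_coord_algebra_mono[of I UNIV] by blast

lemma stream_tail_sets: "B \<in> stream_tail \<Longrightarrow> B \<in> sets past_space"
  by (simp add: stream_tail_def)

lemma sets_tail_iff: "A \<in> sets tail_algebra \<longleftrightarrow> (\<exists>B\<in>stream_tail. A = forward 0 -` B)"
proof
  assume A: "A \<in> sets tail_algebra"
  have "\<exists>B\<in>sets past_space. A = forward n -` B" if "1 \<le> n" for n
    using A that unfolding sets_tail_algebra by (auto simp: sets_coord_algebra_future)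
  then obtain B where B: "\<And>n. 1 \<le> n \<Longrightarrow> B n \<in> sets past_space" "\<And>n. 1 \<le> n \<Longrightarrow> A = forward n -` B n"
    by metis
  \<comment> \<open>The tail algebra starts at index 1, so the representing set for time 1 is pulled
    back to time 0.\<close>
  define C where "C = shift 1 -` B 1"
  have C: "C \<in> sets past_space"
    using B(1)[of 1] sets_vimage_past[OF measurable_shift] by (simp add: C_def)
  \<comment> \<open>Membership in \<open>A\<close> does not depend on the past, so it may be tested
    by gluing an arbitrary one; this yields the representation of \<open>C\<close> at every later
    time.\<close>
  have mem: "\<omega> \<in> C \<longleftrightarrow> glue x \<omega> \<in> A" for x \<omega>
    using B(2)[of 1] by (auto simp: C_def)
  have "\<exists>D\<in>sets past_space. C = shift n -` D" for n
  proof (cases "n = 0")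
    case True
    then show ?thesis using C by (intro bexI[of _ C]) auto
  next
    case False
    then have "1 \<le> n" by simp
    then have "C = shift n -` B n"
      using B(2)[of n] mem by auto
    then show ?thesis using B(1)[OF \<open>1 \<le> n\<close>] by blast
  qed
  then have "C \<in> stream_tail"
    using C by (simp add: stream_tail_def)
  moreover have "A = forward 0 -` C"
    using B(2)[of 1] by (auto simp: C_def forward_def shift_def)
  ultimately show "\<exists>B\<in>stream_tail. A = forward 0 -` B"
    by blast
next
  assume "\<exists>B\<in>stream_tail. A = forward 0 -` B"
  then obtain C where C: "C \<in> stream_tail" "A = forward 0 -` C"
    by blast
  have "A \<in> sets (coord_algebra {int n..})" for n
  proof -
    obtain D where D: "D \<in> sets past_space" "C = shift n -` D"
      using C(1) unfolding stream_tail_def by blast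
    then have "A = forward n -` D"
      using C(2) by (auto simp: forward_def shift_def)
    then show ?thesis
      using D(1) sets_coord_algebra_future by blast
  qed
  then show "A \<in> sets tail_algebra"
    by (simp add: sets_tail_algebra)
qed

lemma tail_in_coord:
  fixes A :: "(int \<Rightarrow> 'a) set"
  assumes "A \<in> sets tail_algebra"
  shows "A \<in> sets (coord_algebra {int n..})"
proof -
  obtain C where C: "C \<in> stream_tail" "A = forward 0 -` C"
    using assms by (auto simp: sets_tail_iff)
  then obtain D where "D \<in> sets past_space" "C = shift n -` D"
    unfolding stream_tail_def by blast
  then show ?thesis
    unfolding sets_coord_algebra_future
    using C(2) by (intro bexI[of _ D]) (auto simp: forward_def shift_def)
qed

lemma coord_uniform:
  fixes M M' :: "(int \<Rightarrow> 'a) measure"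
  assumes "finite_measure M" "finite_measure M'"
    and sets: "sets M = sets (coord_algebra UNIV)" "sets M' = sets (coord_algebra UNIV)"
    and tail: "\<And>A. A \<in> sets tail_algebra \<Longrightarrow> measure M A = measure M' A"
  shows "(\<lambda>n. SUP A\<in>sets (coord_algebra {int n..}). \<bar>measure M A - measure M' A\<bar>) \<longlonglongrightarrow> 0"
proof (rule decreasing_algebras_uniform)
  have sp: "space M = UNIV"
    using sets_eq_imp_space_eq[OF sets(1)] by simp
  show "sigma_algebra (space M) (sets (coord_algebra {int n..}))" for n
    using sets.sigma_algebra_axioms[of "coord_algebra {int n..} :: (int \<Rightarrow> 'a) measure"] by (simp add: sp)
  show "sets (coord_algebra {int n..}) \<subseteq> sets M" for n
    unfolding sets by (rule sets_coord_algebra_mono) simp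
  show "sets (coord_algebra {int m..}) \<subseteq> sets (coord_algebra {int n..})" if "n \<le> m" for m n
    using that by (intro sets_coord_algebra_mono) auto
  show "measure M A = measure M' A" if "\<And>n. A \<in> sets (coord_algebra {int n..})" for A
    using that by (intro tail) (simp add: sets_tail_algebra)
qed (use assms in auto)

text \<open>The statements share one cycle: equality on the tail gives uniform convergence
  (\<open>coord_uniform\<close>), hence closeness from some \<open>n\<close> on, hence overlap, and
  overlap gives equality on the tail by \<open>overlap_tail_eq\<close>.\<close>

lemma dynamic_uniqueness_iff_overlap: "dynamic_uniqueness g \<longleftrightarrow> overlap"
  and dynamic_uniqueness_iff_uniform: "dynamic_uniqueness g \<longleftrightarrow>
    (\<forall>x y. (\<lambda>n. SUP B\<in>sets (coord_algebra {int n..}). \<bar>measure (law_at g x) B - measure (law_at g y) B\<bar>) \<longlonglongrightarrow> 0)"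
    (is "_ \<longleftrightarrow> ?U")
  and dynamic_uniqueness_imp_close: "dynamic_uniqueness g \<Longrightarrow> 0 < e \<Longrightarrow> \<exists>n. close n e x y"
proof -
  have 1: ?U if "dynamic_uniqueness g"
    using that law_at.finite_measure_axioms unfolding dynamic_uniqueness_def
    by (intro allI coord_uniform) auto
  have 2: "\<exists>n. close n e x y" if U: ?U and e: "0 < e" for x y e
  proof -
    let ?D = "\<lambda>B. \<bar>measure (law_at g x) B - measure (law_at g y) B\<bar>"
    have "\<forall>\<^sub>F n in sequentially. (SUP B\<in>sets (coord_algebra {int n..}). ?D B) < e"
      using U e by (intro order_tendstoD(2)) auto
    from eventually_happens'[OF sequentially_bot this]
    obtain n where n: "(SUP B\<in>sets (coord_algebra {int n..}). ?D B) < e"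
      by blast
    have "close n e x y"
      unfolding close_def
    proof
      fix B :: "(nat \<Rightarrow> 'a) set" assume B: "B \<in> sets past_space"
      have "?D C \<le> 1" for C
        using law_at.prob_le_1[of x C] law_at.prob_le_1[of y C] measure_nonneg[of "law_at g x" C] measure_nonneg[of "law_at g y" C]
        by linarith
      then have "?D (forward n -` B) \<le> (SUP B\<in>sets (coord_algebra {int n..}). ?D B)"
        using B by (intro cSUP_upper bdd_aboveI[of _ 1]) (auto simp: sets_coord_algebra_future)
      then show "measure (future x) (shift n -` B) \<le> measure (future y) (shift n -` B) + e"
        using n unfolding measure_law_at_forward[OF B] by linarith
    qed
    then show ?thesis ..
  qed
  have 3: "dynamic_uniqueness g" if overlap
    unfolding dynamic_uniqueness_def
  proof (intro ballI allI)
    fix A x y assume "A \<in> sets (tail_algebra :: (int \<Rightarrow> 'a) measure)"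
    then obtain B where B: "B \<in> stream_tail" "A = forward 0 -` B"
      by (auto simp: sets_tail_iff)
    have "B \<in> sets past_space"
      by (rule stream_tail_sets[OF B(1)])
    then show "measure (law_at g x) A = measure (law_at g y) A"
      using overlap_tail_eq[OF that B(1)] B(2) by (simp add: law_at_0)
  qed
  have 4: overlap if ?U
    using 2[OF that] by (rule overlap_if_close)
  show "dynamic_uniqueness g \<longleftrightarrow> overlap" "dynamic_uniqueness g \<longleftrightarrow> ?U"
    using 1 3 4 by blast+
  show "\<exists>n. close n e x y" if "dynamic_uniqueness g" "0 < e"
    using 1 2 that by blast
qed

lemma measurable_forward_pair:
  "(\<lambda>p. (forward 0 (fst p), forward 0 (snd p)))
    \<in> measurable (coord_algebra UNIV \<Otimes>\<^sub>M coord_algebra UNIV) (past_space \<Otimes>\<^sub>M past_space :: ((nat \<Rightarrow> 'a) \<times> (nat \<Rightarrow> 'a)) measure)"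
proof -
  have "forward 0 \<in> measurable (coord_algebra UNIV) past_space"
    unfolding forward_def by (rule measurable_pastI) (simp add: measurable_coord)
  then show ?thesis
    by (intro measurable_Pair measurable_compose[OF measurable_fst] measurable_compose[OF measurable_snd])
qed

lemma sets_forward_eq:
  "{p. forward n (fst p) = forward n (snd p)} \<in> sets (coord_algebra UNIV \<Otimes>\<^sub>M coord_algebra UNIV :: ((int \<Rightarrow> 'a) \<times> (int \<Rightarrow> 'a)) measure)"
proof -
  have "(\<lambda>p. (forward 0 (fst p), forward 0 (snd p))) -` {\<omega>. shift n (fst \<omega>) = shift n (snd \<omega>)}
      \<inter> space (coord_algebra UNIV \<Otimes>\<^sub>M coord_algebra UNIV) \<in> sets (coord_algebra UNIV \<Otimes>\<^sub>M coord_algebra UNIV :: ((int \<Rightarrow> 'a) \<times> (int \<Rightarrow> 'a)) measure)"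
    using sets_shift_eq[of n, where 'a='a] by (intro measurable_sets[OF measurable_forward_pair]) (simp add: space_pair_measure)
  then show ?thesis
    by (simp add: space_pair_measure vimage_def forward_def shift_def)
qed

text \<open>Forwards, a successful coupling of the two streams is glued to the two fixed pasts.
  Backwards, the coupling inequality bounds the total variation from \<open>n\<close> on by the
  probability of not having met by time \<open>n\<close>.\<close>

lemma dynamic_uniqueness_iff_coupling: "dynamic_uniqueness g \<longleftrightarrow>
  (\<forall>x y. \<exists>Q. is_coupling (law_at g x) (law_at g y) Q \<and> measure Q {p. coupling_time p < \<infinity>} = 1)"
proof
  assume du: "dynamic_uniqueness g"
  show "\<forall>x y. \<exists>Q. is_coupling (law_at g x) (law_at g y) Q \<and> measure Q {p. coupling_time p < \<infinity>} = 1"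
  proof (intro allI)
    fix x y
    let ?S = "past_space \<Otimes>\<^sub>M past_space :: ((nat \<Rightarrow> 'a) \<times> (nat \<Rightarrow> 'a)) measure"
    let ?C = "coord_algebra UNIV :: (int \<Rightarrow> 'a) measure"
    have "\<exists>n. \<forall>B\<in>sets past_space. measure (future x) (shift n -` B) \<le> measure (future y) (shift n -` B) + e" if "0 < e" for e
      using dynamic_uniqueness_imp_close[OF du that, of x y] unfolding close_def .
    from successful_coupling[OF prob_space_future prob_space_future sets_future sets_future this]
    obtain T where sets_T: "sets T = sets ?S"
      and T1: "\<And>A. A \<in> sets past_space \<Longrightarrow> emeasure T (A \<times> UNIV) = emeasure (future x) A"
      and T2: "\<And>A. A \<in> sets past_space \<Longrightarrow> emeasure T (UNIV \<times> A) = emeasure (future y) A"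
      and T0: "emeasure T {\<omega>. \<forall>n. shift n (fst \<omega>) \<noteq> shift n (snd \<omega>)} = 0"
      by blast
    have sp_T: "space T = UNIV"
      using sets_eq_imp_space_eq[OF sets_T] by (simp add: space_pair_measure)
    have UNIV_sets: "UNIV \<in> sets (past_space :: (nat \<Rightarrow> 'a) measure)"
      using sets.top[of "past_space :: (nat \<Rightarrow> 'a) measure"] by simp
    have "prob_space T"
      by (rule prob_spaceI) (use T1[OF UNIV_sets] future.emeasure_space_1[of x] sp_T in simp)
    then interpret T: prob_space T .
    define h where "h = (\<lambda>\<omega>. (glue x (fst \<omega>), glue y (snd \<omega>)))"
    have h: "h \<in> measurable T (?C \<Otimes>\<^sub>M ?C)"
      unfolding h_def measurable_cong_sets[OF sets_T refl]
      by (intro measurable_Pair measurable_compose[OF measurable_fst] measurable_compose[OF measurable_snd] measurable_glue)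
    define Q where "Q = distr T (?C \<Otimes>\<^sub>M ?C) h"
    have marg1: "distr Q ?C fst = law_at g x"
    proof (rule measure_eqI)
      fix A assume "A \<in> sets (distr Q ?C fst)"
      then have A: "A \<in> sets ?C" by simp
      then have gA: "glue x -` A \<in> sets past_space"
        using measurable_sets[OF measurable_glue A] by simp
      have "distr Q ?C fst = distr T ?C (fst \<circ> h)"
        unfolding Q_def by (rule distr_distr[OF measurable_fst h])
      then have "emeasure (distr Q ?C fst) A = emeasure T ((fst \<circ> h) -` A)"
        using A sp_T measurable_comp[OF h measurable_fst] by (simp add: emeasure_distr)
      also have "(fst \<circ> h) -` A = (glue x -` A) \<times> UNIV"
        by (auto simp: h_def)
      also have "emeasure T \<dots> = emeasure (law_at g x) A"
        unfolding T1[OF gA] law_at_eq using A by (simp add: emeasure_distr)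
      finally show "emeasure (distr Q ?C fst) A = emeasure (law_at g x) A" .
    qed simp
    have marg2: "distr Q ?C snd = law_at g y"
    proof (rule measure_eqI)
      fix A assume "A \<in> sets (distr Q ?C snd)"
      then have A: "A \<in> sets ?C" by simp
      then have gA: "glue y -` A \<in> sets past_space"
        using measurable_sets[OF measurable_glue A] by simp
      have "distr Q ?C snd = distr T ?C (snd \<circ> h)"
        unfolding Q_def by (rule distr_distr[OF measurable_snd h])
      then have "emeasure (distr Q ?C snd) A = emeasure T ((snd \<circ> h) -` A)"
        using A sp_T measurable_comp[OF h measurable_snd] by (simp add: emeasure_distr)
      also have "(snd \<circ> h) -` A = UNIV \<times> (glue y -` A)"
        by (auto simp: h_def)
      also have "emeasure T \<dots> = emeasure (law_at g y) A"
        unfolding T2[OF gA] law_at_eq using A by (simp add: emeasure_distr)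
      finally show "emeasure (distr Q ?C snd) A = emeasure (law_at g y) A" .
    qed simp
    have fin_sets: "{p. coupling_time p < \<infinity>} \<in> sets (?C \<Otimes>\<^sub>M ?C)"
    proof -
      have "{p. coupling_time p < \<infinity>} = (\<Union>n. {p. forward n (fst p) = forward n (snd p :: int \<Rightarrow> 'a)})"
        unfolding coupling_time_finite_iff by auto
      then show ?thesis
        using sets_forward_eq by auto
    qed
    have "measure Q {p. coupling_time p < \<infinity>} = measure T {\<omega>. \<exists>n. shift n (fst \<omega>) = shift n (snd \<omega>)}"
      unfolding Q_def measure_distr[OF h fin_sets] sp_T
      unfolding coupling_time_finite_iff
      by (simp add: vimage_def h_def)
    also have "\<dots> = 1"
    proof (rule T.prob_eq_1[THEN iffD2])
      show "{\<omega>. \<exists>n. shift n (fst \<omega>) = shift n (snd \<omega>)} \<in> T.events"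
      proof -
        have "(\<Union>n. {\<omega> \<in> space ?S. shift n (fst \<omega>) = shift n (snd \<omega>)}) \<in> sets ?S"
          using sets_shift_eq[where 'a='a] by (intro sets.countable_UN) auto
        moreover have "(\<Union>n. {\<omega> \<in> space ?S. shift n (fst \<omega>) = shift n (snd \<omega>)}) = {\<omega>. \<exists>n. shift n (fst \<omega>) = shift n (snd \<omega>)}"
          by (auto simp: space_pair_measure)
        ultimately show ?thesis by (simp add: sets_T)
      qed
      then have "{\<omega>. \<forall>n. shift n (fst \<omega>) \<noteq> shift n (snd \<omega>)} \<in> sets T"
        using sets.compl_sets[of "{\<omega>. \<exists>n. shift n (fst \<omega>) = shift n (snd \<omega>)}" T] sp_T by (simp add: set_diff_eq)
      then have "{\<omega>. \<forall>n. shift n (fst \<omega>) \<noteq> shift n (snd \<omega>)} \<in> null_sets T"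
        using T0 by (simp add: null_sets_def)
      then show "AE \<omega> in T. \<omega> \<in> {\<omega>. \<exists>n. shift n (fst \<omega>) = shift n (snd \<omega>)}"
        by (rule AE_I') auto
    qed
    finally have "measure Q {p. coupling_time p < \<infinity>} = 1" .
    moreover have "prob_space Q"
      unfolding Q_def by (rule T.prob_space_distr[OF h])
    ultimately show "\<exists>Q. is_coupling (law_at g x) (law_at g y) Q \<and> measure Q {p. coupling_time p < \<infinity>} = 1"
      unfolding is_coupling_def using marg1 marg2 by (intro exI[of _ Q]) (simp add: Q_def)
  qed
next
  assume coup: "\<forall>x y. \<exists>Q. is_coupling (law_at g x) (law_at g y) Q \<and> measure Q {p. coupling_time p < \<infinity>} = 1"
  have "\<exists>n. close n e x y" if e: "0 < e" for x y e
  proof -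
    let ?C = "coord_algebra UNIV :: (int \<Rightarrow> 'a) measure"
    obtain Q where Q: "is_coupling (law_at g x) (law_at g y) Q" "measure Q {p. coupling_time p < \<infinity>} = 1"
      using coup by blast
    then interpret Q: prob_space Q
      by (simp add: is_coupling_def)
    have sets_Q: "sets Q = sets (?C \<Otimes>\<^sub>M ?C)" and marg: "distr Q ?C fst = law_at g x" "distr Q ?C snd = law_at g y"
      using Q(1) by (simp_all add: is_coupling_def)
    have sp: "space Q = UNIV"
      using sets_eq_imp_space_eq[OF sets_Q] by (simp add: space_pair_measure)
    \<comment> \<open>The event that the paths agree from \<open>n\<close> on; these events increase
      to finiteness of the coupling time.\<close>
    define E where "E n = {p :: (int \<Rightarrow> 'a) \<times> (int \<Rightarrow> 'a). forward n (fst p) = forward n (snd p)}" for n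
    have E: "E n \<in> sets Q" for n
      unfolding E_def sets_Q by (rule sets_forward_eq)
    have "incseq E"
    proof (rule incseq_SucI, rule subsetI)
      fix n p assume p: "p \<in> E n"
      have "forward (Suc n) \<omega> = shift 1 (forward n \<omega>)" for \<omega> :: "int \<Rightarrow> 'a"
      proof (rule ext)
        fix k
        have "Suc n + k = n + (1 + k)" by simp
        then show "forward (Suc n) \<omega> k = shift 1 (forward n \<omega>) k"
          by (simp only: forward_def shift_def)
      qed
      then show "p \<in> E (Suc n)"
        using p by (simp add: E_def)
    qed
    then have "(\<lambda>n. measure Q (E n)) \<longlonglongrightarrow> measure Q (\<Union>n. E n)"
      using E by (intro Q.finite_Lim_measure_incseq) auto
    moreover have "(\<Union>n. E n) = {p. coupling_time p < \<infinity>}"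
      unfolding coupling_time_finite_iff E_def by auto
    ultimately have "(\<lambda>n. measure Q (E n)) \<longlonglongrightarrow> 1"
      using Q(2) by simp
    then have "\<forall>\<^sub>F n in sequentially. 1 - e < measure Q (E n)"
      using e by (intro order_tendstoD(1)) auto
    from eventually_happens'[OF sequentially_bot this]
    obtain n where n: "1 - e < measure Q (E n)"
      by blast
    have "close n e x y"
      unfolding close_def
    proof
      fix B :: "(nat \<Rightarrow> 'a) set" assume B: "B \<in> sets past_space"
      then have "forward n -` B \<in> sets (coord_algebra {int n..})"
        unfolding sets_coord_algebra_future by (intro bexI[of _ B] refl B)
      then have fB: "forward n -` B \<in> sets ?C"
        by (rule sets_coord_algebra_UNIV_I)
      have meas: "fst \<in> measurable Q ?C" "snd \<in> measurable Q ?C"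
        by (simp_all add: measurable_cong_sets[OF sets_Q refl])
      have X: "fst -` (forward n -` B) \<in> sets Q" "snd -` (forward n -` B) \<in> sets Q"
        using measurable_sets[OF meas(1) fB] measurable_sets[OF meas(2) fB] sp by simp_all
      have "measure (future x) (shift n -` B) = measure Q (fst -` (forward n -` B))"
        using measure_law_at_forward[OF B] measure_distr[OF meas(1) fB] sp marg by simp
      also have "\<dots> \<le> measure Q (snd -` (forward n -` B) \<union> (space Q - E n))"
      proof (rule Q.finite_measure_mono)
        show "fst -` (forward n -` B) \<subseteq> snd -` (forward n -` B) \<union> (space Q - E n)"
          unfolding sp E_def by auto
      qed (intro sets.Un X(2) sets.compl_sets E)
      also have "\<dots> \<le> measure Q (snd -` (forward n -` B)) + measure Q (space Q - E n)"
        using X E by (intro measure_Un_le) auto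
      finally have "measure (future x) (shift n -` B) \<le> measure Q (snd -` (forward n -` B)) + measure Q (space Q - E n)" .
      moreover have "measure Q (snd -` (forward n -` B)) = measure (future y) (shift n -` B)"
        using measure_law_at_forward[OF B] measure_distr[OF meas(2) fB] sp marg by simp
      ultimately show "measure (future x) (shift n -` B) \<le> measure (future y) (shift n -` B) + e"
        using Q.prob_compl[OF E, of n] n by linarith
    qed
    then show ?thesis ..
  qed
  then show "dynamic_uniqueness g"
    unfolding dynamic_uniqueness_iff_overlap by (rule overlap_if_close)
qed

text \<open>The law is the \<open>\<nu>\<close>-average of the laws with fixed past, and under
  dynamic uniqueness the averaged function is constant.\<close>

lemma measure_mixture_tail:
  assumes du: "dynamic_uniqueness g" and \<nu>: "\<nu> \<in> space (prob_algebra past_space)" and A: "A \<in> sets tail_algebra"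
  shows "measure (law g \<nu>) A = measure (law_at g x) A"
proof -
  interpret \<nu>: prob_space \<nu>
    using \<nu> by (simp add: space_prob_algebra)
  have A': "A \<in> sets (coord_algebra UNIV)"
    using tail_in_coord[OF A] by (rule sets_coord_algebra_UNIV_I)
  have "measure (law g \<nu>) A = (\<integral>t. measure (law_at g t) A \<partial>\<nu>)"
    by (simp add: law_eq_mixture[OF \<nu>] measure_mixture[OF \<nu> A'] measure_law_at[OF A'])
  also have "\<dots> = (\<integral>t. measure (law_at g x) A \<partial>\<nu>)"
    using du A unfolding dynamic_uniqueness_def by (intro Bochner_Integration.integral_cong) auto
  finally show ?thesis
    by (simp add: \<nu>.prob_space)
qed

lemma sets_law: "\<nu> \<in> space (prob_algebra past_space) \<Longrightarrow> sets (law g \<nu>) = sets (coord_algebra UNIV)"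
  by (simp add: law_eq_mixture sets_mixture)

lemma prob_space_law: "\<nu> \<in> space (prob_algebra past_space) \<Longrightarrow> prob_space (law g \<nu>)"
  by (simp add: law_eq_mixture prob_space_mixture)

text \<open>Forwards both laws share the tail probabilities of any fixed past; backwards two point
  masses are compared.\<close>

lemma dynamic_uniqueness_iff_restr: "dynamic_uniqueness g \<longleftrightarrow>
  (\<forall>\<nu>\<in>space (prob_algebra past_space). \<forall>\<nu>'\<in>space (prob_algebra past_space).
    restr_to_subalg (law g \<nu>) tail_algebra = restr_to_subalg (law g \<nu>') tail_algebra)"
proof
  assume du: "dynamic_uniqueness g"
  show "\<forall>\<nu>\<in>space (prob_algebra past_space). \<forall>\<nu>'\<in>space (prob_algebra past_space).
    restr_to_subalg (law g \<nu>) tail_algebra = restr_to_subalg (law g \<nu>') tail_algebra"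
  proof (intro ballI measure_eqI)
    fix \<nu> \<nu>' :: "(nat \<Rightarrow> 'a) measure"
    assume \<nu>: "\<nu> \<in> space (prob_algebra past_space)" "\<nu>' \<in> space (prob_algebra past_space)"
    have sub: "subalgebra (law g \<nu>) tail_algebra" "subalgebra (law g \<nu>') tail_algebra"
      using \<nu> by (simp_all add: subalgebra_tail_algebra sets_law)
    show "sets (restr_to_subalg (law g \<nu>) tail_algebra) = sets (restr_to_subalg (law g \<nu>') tail_algebra)"
      using sub by (simp add: sets_restr_to_subalg)
    interpret P: prob_space "law g \<nu>" by (rule prob_space_law[OF \<nu>(1)])
    interpret P': prob_space "law g \<nu>'" by (rule prob_space_law[OF \<nu>(2)])
    fix A assume "A \<in> sets (restr_to_subalg (law g \<nu>) tail_algebra)"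
    then have "A \<in> sets tail_algebra"
      using sub by (simp add: sets_restr_to_subalg)
    then show "emeasure (restr_to_subalg (law g \<nu>) tail_algebra) A = emeasure (restr_to_subalg (law g \<nu>') tail_algebra) A"
      using sub measure_mixture_tail[OF du \<nu>(1)] measure_mixture_tail[OF du \<nu>(2)]
      by (simp add: emeasure_restr_to_subalg P.emeasure_eq_measure P'.emeasure_eq_measure)
  qed
next
  assume eq: "\<forall>\<nu>\<in>space (prob_algebra past_space). \<forall>\<nu>'\<in>space (prob_algebra past_space).
    restr_to_subalg (law g \<nu>) tail_algebra = restr_to_subalg (law g \<nu>') tail_algebra"
  show "dynamic_uniqueness g"
    unfolding dynamic_uniqueness_def
  proof (intro ballI allI)
    fix A and x y :: "nat \<Rightarrow> 'a" assume A: "A \<in> sets (tail_algebra :: (int \<Rightarrow> 'a) measure)"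
    have "restr_to_subalg (law_at g x) tail_algebra = restr_to_subalg (law_at g y) tail_algebra"
      using eq return_in_prob_algebra unfolding law_at_def by blast
    then have "emeasure (law_at g x) A = emeasure (law_at g y) A"
      using A emeasure_restr_to_subalg[OF subalgebra_tail_algebra[OF sets_law_at]] by metis
    then show "measure (law_at g x) A = measure (law_at g y) A"
      by (simp add: measure_def)
  qed
qed

lemma dynamic_uniqueness_iff_trivial: "dynamic_uniqueness g \<longleftrightarrow>
  (\<forall>\<nu>\<in>space (prob_algebra past_space). tail_trivial (law g \<nu>))"
proof
  assume du: "dynamic_uniqueness g"
  show "\<forall>\<nu>\<in>space (prob_algebra past_space). tail_trivial (law g \<nu>)"
    unfolding tail_trivial_def
  proof (intro ballI)
    fix \<nu> :: "(nat \<Rightarrow> 'a) measure" and A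
    assume \<nu>: "\<nu> \<in> space (prob_algebra past_space)" and A: "A \<in> sets (tail_algebra :: (int \<Rightarrow> 'a) measure)"
    obtain B where B: "B \<in> stream_tail" "A = forward 0 -` B"
      using A by (auto simp: sets_tail_iff)
    have "B \<in> sets past_space"
      by (rule stream_tail_sets[OF B(1)])
    then have "measure (law g \<nu>) A = measure (future (\<lambda>_. undefined)) B"
      unfolding measure_mixture_tail[OF du \<nu> A, of "\<lambda>_. undefined"] unfolding B(2) by (rule law_at_0)
    moreover have "measure (future (\<lambda>_. undefined)) B = 0 \<or> measure (future (\<lambda>_. undefined)) B = 1"
      using du unfolding dynamic_uniqueness_iff_overlap by (rule overlap_tail_trivial[OF _ B(1)])
    ultimately show "measure (law g \<nu>) A \<in> {0, 1}"
      by simp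
  qed
next
  assume triv: "\<forall>\<nu>\<in>space (prob_algebra past_space). tail_trivial (law g \<nu>)"
  show "dynamic_uniqueness g"
    unfolding dynamic_uniqueness_def
  proof (intro ballI allI)
    fix A and x y :: "nat \<Rightarrow> 'a" assume A: "A \<in> sets (tail_algebra :: (int \<Rightarrow> 'a) measure)"
    have A': "A \<in> sets (coord_algebra UNIV)"
      by (rule sets_coord_algebra_UNIV_I[OF tail_in_coord[OF A]])
    \<comment> \<open>The equal mixture of two point masses: its tail probability is the mean of two
      numbers in [0, 1], and a mean of 0 or 1 forces both to that value.\<close>
    define \<nu> where "\<nu> = distr (measure_pmf (bernoulli_pmf (1 / 2))) past_space (\<lambda>b. if b then x else y)"
    have \<nu>: "\<nu> \<in> space (prob_algebra past_space)"
    proof -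
      have "prob_space \<nu>"
        unfolding \<nu>_def by (rule prob_space.prob_space_distr[OF measure_pmf.prob_space_axioms]) simp
      then show ?thesis
        by (simp add: space_prob_algebra \<nu>_def)
    qed
    have meas: "(\<lambda>t. measure (law_at g t) A) \<in> borel_measurable past_space"
      unfolding law_at_eq
      by (rule measurable_compose[OF measurable_kernel_subprob measurable_measure_subprob_algebra[OF A']])
    have "measure (law g \<nu>) A = (\<integral>t. measure (law_at g t) A \<partial>\<nu>)"
      by (simp add: law_eq_mixture[OF \<nu>] measure_mixture[OF \<nu> A'] measure_law_at[OF A'])
    also have "\<dots> = (\<integral>b. measure (law_at g (if b then x else y)) A \<partial>measure_pmf (bernoulli_pmf (1 / 2)))"
      unfolding \<nu>_def by (rule integral_distr[OF _ meas]) simp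
    also have "\<dots> = measure (law_at g x) A / 2 + measure (law_at g y) A / 2"
      using integral_bernoulli_pmf[of "1 / 2" "\<lambda>b. measure (law_at g (if b then x else y)) A"] by simp
    finally have half: "measure (law g \<nu>) A = measure (law_at g x) A / 2 + measure (law_at g y) A / 2" .
    have "measure (law g \<nu>) A = 0 \<or> measure (law g \<nu>) A = 1"
      using triv \<nu> A unfolding tail_trivial_def by blast
    then show "measure (law_at g x) A = measure (law_at g y) A"
      using half law_at.prob_le_1[of x A] law_at.prob_le_1[of y A] measure_nonneg[of "law_at g x" A] measure_nonneg[of "law_at g y" A]
      by (elim disjE) linarith+
  qed
qed

lemma tail_trivial_iff_mixing:
  assumes \<nu>: "\<nu> \<in> space (prob_algebra past_space)"
  shows "tail_trivial (law g \<nu>) \<longleftrightarrow> mixing (law g \<nu>)"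
proof -
  let ?P = "law g \<nu>"
  interpret P: prob_space ?P by (rule prob_space_law[OF \<nu>])
  have sets_P: "sets ?P = sets (coord_algebra UNIV)"
    by (rule sets_law[OF \<nu>])
  have sp: "space ?P = UNIV"
    using sets_eq_imp_space_eq[OF sets_P] by simp
  show ?thesis
  proof
    assume triv: "tail_trivial ?P"
    show "mixing ?P"
      unfolding mixing_def
    proof
      fix B :: "(int \<Rightarrow> 'a) set" assume "B \<in> sets (coord_algebra UNIV)"
      then have B: "B \<in> sets ?P"
        by (simp add: sets_P)
      \<comment> \<open>Tail triviality makes \<open>B\<close> independent of every tail event, so
        \<open>M\<close> and \<open>M'\<close> agree on the tail algebra;
        \<open>coord_uniform\<close> turns this into mixing.\<close>
      define M where "M = density ?P (indicator B)"
      define M' where "M' = density ?P (\<lambda>_. ennreal (measure ?P B))"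
      have M: "emeasure M A = emeasure ?P (A \<inter> B)" if "A \<in> sets ?P" for A
      proof -
        have "emeasure M A = (\<integral>\<^sup>+\<omega>. indicator B \<omega> * indicator A \<omega> \<partial>?P)"
          unfolding M_def using that B by (intro emeasure_density) auto
        also have "\<dots> = (\<integral>\<^sup>+\<omega>. indicator (A \<inter> B) \<omega> \<partial>?P)"
          by (intro nn_integral_cong) (auto split: split_indicator)
        finally show ?thesis
          using that B by simp
      qed
      have M': "emeasure M' A = ennreal (measure ?P A * measure ?P B)" if "A \<in> sets ?P" for A
        unfolding M'_def using that
        by (simp add: emeasure_density_const P.emeasure_eq_measure ennreal_mult mult.commute)
      have meas: "measure M A = measure ?P (A \<inter> B)" "measure M' A = measure ?P A * measure ?P B" if "A \<in> sets ?P" for A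
        using M[OF that] M'[OF that] by (simp_all add: measure_def enn2real_mult)
      have "finite_measure M" "finite_measure M'"
        using M[OF sets.top] M'[OF sets.top] by (auto intro!: finite_measureI simp: M_def M'_def)
      moreover have "measure M A = measure M' A" if A: "A \<in> sets tail_algebra" for A
      proof -
        have A': "A \<in> sets ?P"
          unfolding sets_P by (rule sets_coord_algebra_UNIV_I[OF tail_in_coord[OF A]])
        have "measure ?P A \<in> {0, 1}"
          using triv A by (simp add: tail_trivial_def)
        then have "measure ?P (A \<inter> B) = measure ?P A * measure ?P B"
        proof
          assume "measure ?P A = 0"
          moreover have "measure ?P (A \<inter> B) \<le> measure ?P A"
            using A' by (intro P.finite_measure_mono) auto
          ultimately show ?thesis
            by (simp add: measure_le_0_iff)
        next
          assume "measure ?P A \<in> {1}"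
          then have 1: "measure ?P A = 1" by simp
          then have "measure ?P (space ?P - A) = 0"
            using P.prob_compl[OF A'] by simp
          moreover have "measure ?P (B - A) \<le> measure ?P (space ?P - A)"
            using sets.compl_sets[OF A'] sp by (intro P.finite_measure_mono) auto
          ultimately have "measure ?P (B - A) = 0"
            by (simp add: measure_le_0_iff)
          then show ?thesis
            using P.finite_measure_Diff'[OF B A'] 1 by (simp add: Int_commute)
        qed
        then show ?thesis
          using meas[OF A'] by simp
      qed
      ultimately have "(\<lambda>n. SUP A\<in>sets (coord_algebra {int n..}). \<bar>measure M A - measure M' A\<bar>) \<longlonglongrightarrow> 0"
        by (intro coord_uniform) (auto simp: M_def M'_def sets_P)
      moreover have "(SUP A\<in>sets (coord_algebra {int n..}). \<bar>measure M A - measure M' A\<bar>)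
          = (SUP A\<in>sets (coord_algebra {int n..}). \<bar>measure ?P (A \<inter> B) - measure ?P A * measure ?P B\<bar>)" for n
      proof (rule SUP_cong)
        fix A :: "(int \<Rightarrow> 'a) set" assume "A \<in> sets (coord_algebra {int n..})"
        then have "A \<in> sets ?P"
          unfolding sets_P by (rule sets_coord_algebra_UNIV_I)
        then show "\<bar>measure M A - measure M' A\<bar> = \<bar>measure ?P (A \<inter> B) - measure ?P A * measure ?P B\<bar>"
          by (simp add: meas)
      qed simp
      ultimately show "(\<lambda>n. SUP A\<in>sets (coord_algebra {int n..}). \<bar>measure ?P (A \<inter> B) - measure ?P A * measure ?P B\<bar>) \<longlonglongrightarrow> 0"
        by simp
    qed
  next
    assume mix: "mixing ?P"
    show "tail_trivial ?P"
      unfolding tail_trivial_def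
    proof
      fix A assume A: "A \<in> sets (tail_algebra :: (int \<Rightarrow> 'a) measure)"
      let ?D = "\<lambda>C. \<bar>measure ?P (C \<inter> A) - measure ?P C * measure ?P A\<bar>"
      have lim: "(\<lambda>n. SUP C\<in>sets (coord_algebra {int n..}). ?D C) \<longlonglongrightarrow> 0"
        using mix sets_coord_algebra_UNIV_I[OF tail_in_coord[OF A]] unfolding mixing_def by (rule bspec)
      have bound: "?D C \<le> 1" for C
      proof -
        have "0 \<le> measure ?P C * measure ?P A" "measure ?P C * measure ?P A \<le> 1"
          by (auto intro: mult_le_one)
        then show ?thesis
          using P.prob_le_1[of "C \<inter> A"] measure_nonneg[of ?P "C \<inter> A"] by linarith
      qed
      \<comment> \<open>A tail event competes in every supremum, also as its own partner. The limit
        then says that its probability equals its square.\<close>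
      have "?D A \<le> (SUP C\<in>sets (coord_algebra {int n..}). ?D C)" for n
        using tail_in_coord[OF A] bound by (intro cSUP_upper bdd_aboveI[of _ 1]) auto
      then have "?D A \<le> 0"
        by (intro LIMSEQ_le_const[OF lim] exI[of _ 0] allI impI)
      then have "measure ?P A * (1 - measure ?P A) = 0"
        by (simp add: algebra_simps)
      then show "measure ?P A \<in> {0, 1}"
        by auto
    qed
  qed
qed

lemma overlap_iff_ac:
  "overlap \<longleftrightarrow> (\<forall>x y. \<forall>A\<in>sets past_space. measure (future y) A = 0 \<longrightarrow> measure (future x) A = 0)"
proof
  assume overlap
  then show "\<forall>x y. \<forall>A\<in>sets past_space. measure (future y) A = 0 \<longrightarrow> measure (future x) A = 0"
    by (intro allI ballI impI) (rule overlap_null)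
next
  assume "\<forall>x y. \<forall>A\<in>sets past_space. measure (future y) A = 0 \<longrightarrow> measure (future x) A = 0"
  then show overlap
    by (intro overlap_if_ac) blast
qed

text \<open>The dominating measure is the first argument of \<open>absolutely_continuous\<close>.
  Null sets of the future algebra correspond to null sets of streams through
  \<open>forward 0\<close>.\<close>

lemma dynamic_uniqueness_iff_ac: "dynamic_uniqueness g \<longleftrightarrow>
  (\<forall>x y. absolutely_continuous (restr_to_subalg (law_at g y) (coord_algebra {0..}))
    (restr_to_subalg (law_at g x) (coord_algebra {0..})))"
proof -
  have iff: "absolutely_continuous (restr_to_subalg (law_at g y) (coord_algebra {0..}))
      (restr_to_subalg (law_at g x) (coord_algebra {0..}))
    \<longleftrightarrow> (\<forall>A\<in>sets past_space. measure (future y) A = 0 \<longrightarrow> measure (future x) A = 0)" for x y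
  proof -
    have null: "A \<in> null_sets (restr_to_subalg (law_at g z) (coord_algebra {0..}))
      \<longleftrightarrow> (\<exists>B\<in>sets past_space. A = forward 0 -` B \<and> measure (future z) B = 0)" for A z
    proof -
      have restr: "null_sets (restr_to_subalg (law_at g z) (coord_algebra {0..})) = null_sets (law_at g z) \<inter> sets (coord_algebra {0..})"
        by (rule null_sets_restr_to_subalg[OF subalgebra_coord_algebra[OF sets_law_at]])
      have "A \<in> sets (coord_algebra {0..}) \<Longrightarrow> A \<in> null_sets (law_at g z) \<longleftrightarrow> measure (law_at g z) A = 0"
        using sets_coord_algebra_UNIV_I[of A "{0..}"] by (simp add: null_sets_def law_at.emeasure_eq_measure)
      then have "A \<in> null_sets (restr_to_subalg (law_at g z) (coord_algebra {0..}))
        \<longleftrightarrow> A \<in> sets (coord_algebra {int 0..}) \<and> measure (law_at g z) A = 0"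
        unfolding restr of_nat_0 by blast
      also have "\<dots> \<longleftrightarrow> (\<exists>B\<in>sets past_space. A = forward 0 -` B \<and> measure (law_at g z) (forward 0 -` B) = 0)"
        unfolding sets_coord_algebra_future by blast
      also have "\<dots> \<longleftrightarrow> (\<exists>B\<in>sets past_space. A = forward 0 -` B \<and> measure (future z) B = 0)"
        by (intro bex_cong refl) (simp only: law_at_0)
      finally show ?thesis .
    qed
    \<comment> \<open>\<open>forward 0\<close> is onto, by gluing any past, so an event determines
      its representing set of streams.\<close>
    have inj: "B = C" if "forward 0 -` B = forward 0 -` C" for B C :: "(nat \<Rightarrow> 'a) set"
    proof (rule set_eqI)
      fix \<omega>
      have "glue \<omega> \<omega> \<in> forward 0 -` B \<longleftrightarrow> glue \<omega> \<omega> \<in> forward 0 -` C"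
        by (simp only: that)
      then show "\<omega> \<in> B \<longleftrightarrow> \<omega> \<in> C"
        by (simp only: vimage_eq forward_glue shift_0)
    qed
    show ?thesis
    proof
      assume ac: "absolutely_continuous (restr_to_subalg (law_at g y) (coord_algebra {0..}))
        (restr_to_subalg (law_at g x) (coord_algebra {0..}))"
      show "\<forall>A\<in>sets past_space. measure (future y) A = 0 \<longrightarrow> measure (future x) A = 0"
      proof (intro ballI impI)
        fix A :: "(nat \<Rightarrow> 'a) set" assume A: "A \<in> sets past_space" "measure (future y) A = 0"
        then have "forward 0 -` A \<in> null_sets (restr_to_subalg (law_at g y) (coord_algebra {0..}))"
          unfolding null by (intro bexI[of _ A] conjI refl)
        then have "forward 0 -` A \<in> null_sets (restr_to_subalg (law_at g x) (coord_algebra {0..}))"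
          using ac unfolding absolutely_continuous_def by (rule rev_subsetD)
        then obtain B where B: "forward 0 -` A = forward 0 -` B" "measure (future x) B = 0"
          unfolding null by (elim bexE conjE)
        show "measure (future x) A = 0"
          unfolding inj[OF B(1)] by (rule B(2))
      qed
    next
      assume "\<forall>A\<in>sets past_space. measure (future y) A = 0 \<longrightarrow> measure (future x) A = 0"
      then have ac: "measure (future x) A = 0" if "A \<in> sets past_space" "measure (future y) A = 0" for A
        using that by blast
      show "absolutely_continuous (restr_to_subalg (law_at g y) (coord_algebra {0..}))
        (restr_to_subalg (law_at g x) (coord_algebra {0..}))"
        unfolding absolutely_continuous_def
      proof
        fix N assume "N \<in> null_sets (restr_to_subalg (law_at g y) (coord_algebra {0..}))"
        then obtain B where B: "B \<in> sets past_space" "N = forward 0 -` B" "measure (future y) B = 0"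
          unfolding null by (elim bexE conjE)
        show "N \<in> null_sets (restr_to_subalg (law_at g x) (coord_algebra {0..}))"
          unfolding null using B(1,2) ac[OF B(1,3)] by (intro bexI[of _ B] conjI)
      qed
    qed
  qed
  show ?thesis
    unfolding dynamic_uniqueness_iff_overlap overlap_iff_ac iff by (rule refl)
qed

lemma weak_l2_iff: "weak_l2 g \<longleftrightarrow> (\<forall>x y. AE \<omega> in future x. summable (\<lambda>n. sq_dev (pre n \<omega>) x y))"
proof -
  have block: "block n \<omega> = rev (pre (Suc n) (forward 0 \<omega>))" for n and \<omega> :: "int \<Rightarrow> 'a"
    by (simp add: block_def forward_def pre_def rev_map)
  have conc_block: "conc (a # block n \<omega>) x = conc [a] (after (pre (Suc n) (forward 0 \<omega>)) x)" for a n x and \<omega> :: "int \<Rightarrow> 'a"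
    unfolding block after_def conc_append[symmetric] by simp
  \<comment> \<open>\<open>block n\<close> has the \<open>n + 1\<close> letters from 0 to
    \<open>n\<close>, so the criterion omits the term of the empty word; a single term does not
    affect summability.\<close>
  have summ: "summable (\<lambda>n. \<Sum>a\<in>UNIV. (g (conc (a # block n \<omega>) x) - g (conc (a # block n \<omega>) y))\<^sup>2)
      \<longleftrightarrow> summable (\<lambda>n. sq_dev (pre n (forward 0 \<omega>)) x y)" for x y \<omega>
    unfolding conc_block sq_dev_def[symmetric] by (rule summable_Suc_iff)
  have "(AE \<omega> in law_at g x. summable (\<lambda>n. sq_dev (pre n (forward 0 \<omega>)) x y))
      \<longleftrightarrow> (AE \<omega> in future x. summable (\<lambda>n. sq_dev (pre n \<omega>) x y))" for x y
  proof
    assume "AE \<omega> in law_at g x. summable (\<lambda>n. sq_dev (pre n (forward 0 \<omega>)) x y)"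
    then have "AE \<omega> in future x. summable (\<lambda>n. sq_dev (pre n (forward 0 (glue x \<omega>))) x y)"
      unfolding law_at_eq by (rule AE_distrD[OF measurable_glue_future])
    then show "AE \<omega> in future x. summable (\<lambda>n. sq_dev (pre n \<omega>) x y)"
      by simp
  next
    \<comment> \<open>An exceptional null set of streams is carried back through
      \<open>forward 0\<close>, which needs no measurability of the summability event
      itself.\<close>
    assume "AE \<omega> in future x. summable (\<lambda>n. sq_dev (pre n \<omega>) x y)"
    then obtain N where N: "{\<omega> \<in> space (future x). \<not> summable (\<lambda>n. sq_dev (pre n \<omega>) x y)} \<subseteq> N"
      "emeasure (future x) N = 0" "N \<in> sets (future x)"
      by (rule AE_E)
    then have "measure (law_at g x) (forward 0 -` N) = 0"
      using law_at_0[of N x] by (simp add: measure_def)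
    moreover have "forward 0 -` N \<in> sets (coord_algebra UNIV)"
    proof (rule sets_coord_algebra_UNIV_I)
      show "forward 0 -` N \<in> sets (coord_algebra {int 0..})"
        unfolding sets_coord_algebra_future using N(3) by (intro bexI[of _ N] refl) simp
    qed
    ultimately have "forward 0 -` N \<in> null_sets (law_at g x)"
      by (simp add: null_sets_def law_at.emeasure_eq_measure)
    then show "AE \<omega> in law_at g x. summable (\<lambda>n. sq_dev (pre n (forward 0 \<omega>)) x y)"
      by (rule AE_I') (use N(1) in auto)
  qed
  then show ?thesis
    unfolding weak_l2_def summ by simp
qed

lemma dynamic_uniqueness_iff_weak_l2: "dynamic_uniqueness g \<longleftrightarrow> weak_l2 g"
  unfolding dynamic_uniqueness_iff_overlap overlap_iff_ac weak_l2_iff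
proof (intro iffI allI ballI impI)
  show "AE \<omega> in future x. summable (\<lambda>n. sq_dev (pre n \<omega>) x y)"
    if "\<forall>x y. \<forall>A\<in>sets past_space. measure (future y) A = 0 \<longrightarrow> measure (future x) A = 0" for x y
    by (rule summable_of_ac) (use that in blast)
next
  fix x y A
  assume "\<forall>x y. AE \<omega> in future x. summable (\<lambda>n. sq_dev (pre n \<omega>) x y)"
    and "A \<in> sets past_space" "measure (future y) A = 0"
  then show "measure (future x) A = 0"
    by (intro null_of_summable[of x y A]) blast+
qed

end

theorem theorem1:
  fixes g :: "(nat \<Rightarrow> 'a::finite) \<Rightarrow> real"
  assumes "regular_kernel g"
  shows
    "(dynamic_uniqueness g \<longleftrightarrow>
        (\<forall>x y. (\<lambda>n. SUP B\<in>sets (coord_algebra {int n..}).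
            \<bar>measure (law_at g x) B - measure (law_at g y) B\<bar>) \<longlonglongrightarrow> 0)) \<and>
     (dynamic_uniqueness g \<longleftrightarrow>
        (\<forall>x y. \<exists>Q. is_coupling (law_at g x) (law_at g y) Q \<and>
            measure Q {p. coupling_time p < \<infinity>} = 1)) \<and>
     (dynamic_uniqueness g \<longleftrightarrow>
        (\<forall>\<nu>\<in>space (prob_algebra past_space). \<forall>\<nu>'\<in>space (prob_algebra past_space).
            restr_to_subalg (law g \<nu>) tail_algebra = restr_to_subalg (law g \<nu>') tail_algebra)) \<and>
     (dynamic_uniqueness g \<longleftrightarrow>
        (\<forall>\<nu>\<in>space (prob_algebra past_space). tail_trivial (law g \<nu>))) \<and>
     (dynamic_uniqueness g \<longleftrightarrow>
        (\<forall>\<nu>\<in>space (prob_algebra past_space). mixing (law g \<nu>))) \<and>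
     (dynamic_uniqueness g \<longleftrightarrow>
        (\<forall>x y. absolutely_continuous
            (restr_to_subalg (law_at g y) (coord_algebra {0..}))
            (restr_to_subalg (law_at g x) (coord_algebra {0..})))) \<and>
     (dynamic_uniqueness g \<longleftrightarrow> weak_l2 g)"
proof -
  interpret regular_process g
    using assms by unfold_locales (simp_all add: regular_kernel_def)
  have "dynamic_uniqueness g \<longleftrightarrow> (\<forall>\<nu>\<in>space (prob_algebra past_space). mixing (law g \<nu>))"
    unfolding dynamic_uniqueness_iff_trivial using tail_trivial_iff_mixing by blast
  then show ?thesis
    using dynamic_uniqueness_iff_uniform dynamic_uniqueness_iff_coupling dynamic_uniqueness_iff_restr
      dynamic_uniqueness_iff_trivial dynamic_uniqueness_iff_ac dynamic_uniqueness_iff_weak_l2 by blast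
qed

end
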